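(* Let $x^A=x_1^{\alpha_1}\cdots x_N^{\alpha_N}$ with $\alpha_i\ge0$, $D=N+\sum_i\alpha_i$, $\mathbb{R}^N_*=\{x\in\mathbb{R}^N:x_i>0\text{ whenever }\alpha_i>0\}$. For $u\in S_A$ define $$\delta_A(u)=\left(\int_{\mathbb{R}^N_*}|\nabla u|^2x^A dx\right)^{1/2}\left(\int_{\mathbb{R}^N_*}|u|^2|x|^2x^Adx\right)^{1/2}-\frac D2\int_{\mathbb{R}^N_*}|u|^2x^Adx$$ and $$d_A(u,E_{HUPA})=\inf_{c\in\mathbb{R},\,\lambda\ne0}\left(\int_{\mathbb{R}^N_*}\left|u-ce^{-\frac{|x|^2}{2\lambda^2}}\right|^2x^Adx\right)^{1/2}.$$ Then for all $u\in S_A$, $\delta_A(u)\ge d_A^2(u,E_{HUPA})$. Moreover, if $x^A$ is partial, then equality is attained by some nontrivial $u\notin E_{HUPA}$, where $E_{HUPA}=\{\alpha e^{-\beta|x|^2}:\alpha\in\mathbb{R},\beta>0\}$.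
   Context: $N_*$ is the set of $u\in C_0^\infty(\overline{\mathbb{R}^N_*})$ with $\nabla u\cdot\vec\eta=0$ on $\partial\mathbb{R}^N_*$ ($\vec\eta$ the outer normal). $S_A$ is the completion of $N_*$ under the norm $\left(\int_{\mathbb{R}^N_*}|\nabla u|^2x^Adx\right)^{1/2}+\left(\int_{\mathbb{R}^N_*}|u|^2|x|^2x^Adx\right)^{1/2}$. The monomial weight $x^A$ is full if $\alpha_i>0$ for all $i$, and partial otherwise. *)

theory Defs
  imports "HOL-Analysis.Analysis"
begin

definition RNstar :: "('n::finite \<Rightarrow> real) \<Rightarrow> (real ^ 'n) set" where
  "RNstar \<alpha> = {x. \<forall>i. 0 < \<alpha> i \<longrightarrow> 0 < x $ i}"

definition RNstar_cl :: "('n::finite \<Rightarrow> real) \<Rightarrow> (real ^ 'n) set" where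
  "RNstar_cl \<alpha> = {x. \<forall>i. 0 < \<alpha> i \<longrightarrow> 0 \<le> x $ i}"

definition wA :: "('n::finite \<Rightarrow> real) \<Rightarrow> real ^ 'n \<Rightarrow> real" where
  "wA \<alpha> x = (\<Prod>i\<in>UNIV. if \<alpha> i = 0 then 1 else x $ i powr \<alpha> i)"

definition pdx :: "'n::finite \<Rightarrow> (real ^ 'n \<Rightarrow> real) \<Rightarrow> real ^ 'n \<Rightarrow> real" where
  "pdx i f x = frechet_derivative f (at x) (axis i 1)"

definition grad :: "(real ^ 'n::finite \<Rightarrow> real) \<Rightarrow> real ^ 'n \<Rightarrow> real ^ 'n" where
  "grad f x = (\<chi> i. pdx i f x)"

definition smooth_fun :: "(real ^ 'n::finite \<Rightarrow> real) \<Rightarrow> bool" where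
  "smooth_fun f \<longleftrightarrow> (\<forall>is :: 'n list. \<forall>x. foldr pdx is f differentiable (at x))"

text \<open>N_*: smooth, compactly supported functions whose normal derivative vanishes on the boundary
  of R^N_* (the faces x_i = 0, alpha_i > 0, with outer normal -e_i).\<close>
definition Nstar :: "('n::finite \<Rightarrow> real) \<Rightarrow> (real ^ 'n \<Rightarrow> real) set" where
  "Nstar \<alpha> = {\<phi>. smooth_fun \<phi> \<and> bounded {x. \<phi> x \<noteq> 0} \<and>
      (\<forall>i x. 0 < \<alpha> i \<and> x \<in> RNstar_cl \<alpha> \<and> x $ i = 0 \<longrightarrow> pdx i \<phi> x = 0)}"

text \<open>S_A, the completion of N_* in the norm
  (int |grad u|^2 x^A)^(1/2) + (int |u|^2 |x|^2 x^A)^(1/2).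
  An element is represented by the pair (u, G) of its L^2-limits: u is the limit of the functions,
  G the limit of their gradients (G plays the role of grad u).\<close>
definition SA :: "('n::finite \<Rightarrow> real) \<Rightarrow> (real ^ 'n \<Rightarrow> real) \<Rightarrow> (real ^ 'n \<Rightarrow> real ^ 'n) \<Rightarrow> bool" where
  "SA \<alpha> u G \<longleftrightarrow> u \<in> borel_measurable lborel \<and> G \<in> borel_measurable lborel \<and>
     (\<exists>\<phi>. (\<forall>n. \<phi> n \<in> Nstar \<alpha>) \<and>
        (\<lambda>n. \<integral>\<^sup>+x\<in>RNstar \<alpha>. ennreal ((\<phi> n x - u x)\<^sup>2 * (norm x)\<^sup>2 * wA \<alpha> x) \<partial>lborel)
           \<longlonglongrightarrow> 0 \<and>
        (\<lambda>n. \<integral>\<^sup>+x\<in>RNstar \<alpha>. ennreal ((norm (grad (\<phi> n) x - G x))\<^sup>2 * wA \<alpha> x) \<partial>lborel)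
           \<longlonglongrightarrow> 0)"

definition dimA :: "('n::finite \<Rightarrow> real) \<Rightarrow> real" where
  "dimA \<alpha> = real CARD('n) + (\<Sum>i\<in>UNIV. \<alpha> i)"

definition deltaA :: "('n::finite \<Rightarrow> real) \<Rightarrow> (real ^ 'n \<Rightarrow> real) \<Rightarrow> (real ^ 'n \<Rightarrow> real ^ 'n) \<Rightarrow> real" where
  "deltaA \<alpha> u G =
     sqrt (LINT x:RNstar \<alpha>|lborel. (norm (G x))\<^sup>2 * wA \<alpha> x) *
     sqrt (LINT x:RNstar \<alpha>|lborel. (u x)\<^sup>2 * (norm x)\<^sup>2 * wA \<alpha> x)
     - dimA \<alpha> / 2 * (LINT x:RNstar \<alpha>|lborel. (u x)\<^sup>2 * wA \<alpha> x)"

definition dA :: "('n::finite \<Rightarrow> real) \<Rightarrow> (real ^ 'n \<Rightarrow> real) \<Rightarrow> real" where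
  "dA \<alpha> u = (INF p \<in> {(c, l). (l::real) \<noteq> 0}.
     sqrt (LINT x:RNstar \<alpha>|lborel. (u x - fst p * exp (- (norm x)\<^sup>2 / (2 * (snd p)\<^sup>2)))\<^sup>2 * wA \<alpha> x))"

definition in_EHUPA :: "('n::finite \<Rightarrow> real) \<Rightarrow> (real ^ 'n \<Rightarrow> real) \<Rightarrow> bool" where
  "in_EHUPA \<alpha> u \<longleftrightarrow> (\<exists>a b. 0 < b \<and>
      (AE x in lborel. x \<in> RNstar \<alpha> \<longrightarrow> u x = a * exp (- b * (norm x)\<^sup>2)))"

definition trivial_fun :: "('n::finite \<Rightarrow> real) \<Rightarrow> (real ^ 'n \<Rightarrow> real) \<Rightarrow> bool" where
  "trivial_fun \<alpha> u \<longleftrightarrow> (AE x in lborel. x \<in> RNstar \<alpha> \<longrightarrow> u x = 0)"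

end

theory Submission
  imports Defs "HOL-Probability.Probability"
begin

text \<open>
  For \<open>t > 0\<close> put \<open>f = u exp (|x|\<^sup>2 / 2t)\<close> and let \<open>\<gamma>\<close> be the measure \<open>exp (- |x|\<^sup>2 / t) x\<^sup>A dx\<close>.
  Integrating \<open>x\<^sub>i \<partial>\<^sub>i (u\<^sup>2)\<close> by parts gives
  \<open>t \<integral>|\<nabla>f|\<^sup>2 d\<gamma> = t \<integral>|\<nabla>u|\<^sup>2 x\<^sup>A + (1/t) \<integral>|x|\<^sup>2 u\<^sup>2 x\<^sup>A - D \<integral>u\<^sup>2 x\<^sup>A\<close>,
  and the Poincare inequality \<open>\<integral>(f - c)\<^sup>2 d\<gamma> \<le> (t/2) \<integral>|\<nabla>f|\<^sup>2 d\<gamma>\<close> bounds the left side below by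
  \<open>2 \<integral>(u - c exp (- |x|\<^sup>2 / 2t))\<^sup>2 x\<^sup>A\<close>; optimizing over \<open>t\<close> proves the stability estimate.
  The Poincare inequality follows by tensorization (Efron--Stein) from the densities
  \<open>s\<^sup>a exp (- s\<^sup>2 / t)\<close> on the (half) line, where the variance is bounded by the mean square
  deviation of \<open>f\<close> from its value at the mode of the density.
  If \<open>\<alpha>\<^sub>j = 0\<close>, then \<open>x\<^sub>j exp (- |x|\<^sup>2 / 2)\<close> is orthogonal to all Gaussians and gives equality.
\<close>

section \<open>The one-dimensional Poincare inequality\<close>

text \<open>The constant \<open>t / 2\<close> has to be exact: linear functions on an unweighted
  line attain it, and any loss would spoil the coefficient one in front of the squared distance.
  Comparing \<open>f\<close> with its value at the mode instead of its mean keeps the sharp bound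
  elementary: such an increment depends only on the derivative between two points, so exchanging the
  integrals leaves a kernel integral that the derivative of the weight majorizes. Deviations from
  point values are turned into variances before passing to several variables, because variances are
  subadditive over coordinates, whereas a point value in several variables is not controlled by the
  gradient in mean square. Efron--Stein is used for bounded functions only, so the substitution is
  made for compactly supported functions. The constant \<open>c\<close> it yields depends on
  \<open>t\<close> and on the approximating function; in the completion no limit of \<open>c\<close>
  is taken, and the bound passes through the infimum \<open>dA\<close> instead.\<close>

definition half_line :: "real \<Rightarrow> real set" where
  "half_line a = {s. 0 < a \<longrightarrow> 0 < s}"

text \<open>The case \<open>a = 0\<close> is split off because \<open>0 powr 0 = 0\<close>, while an
  unweighted direction should carry plain Lebesgue measure on the whole line.\<close>

definition power_factor :: "real \<Rightarrow> real \<Rightarrow> real" where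
  "power_factor a s = (if a = 0 then 1 else s powr a)"

definition power_weight :: "real \<Rightarrow> real \<Rightarrow> real" where
  "power_weight a s = indicator (half_line a) s * power_factor a s"

lemma half_line_measurable [measurable]: "half_line a \<in> sets borel"
  by (auto simp: half_line_def)

lemma power_factor_measurable [measurable]: "power_factor a \<in> borel_measurable borel"
  unfolding power_factor_def by measurable

lemma power_weight_measurable [measurable]: "power_weight a \<in> borel_measurable borel"
  unfolding power_weight_def by measurable

lemma power_factor_nonneg [simp]: "0 \<le> power_factor a s"
  by (simp add: power_factor_def)

lemma power_weight_nonneg [simp]: "0 \<le> power_weight a s"
  by (simp add: power_weight_def)

text \<open>Cauchy-Schwarz on an interval, obtained by integrating the squared deviation of
  \<open>f'\<close> from the mean slope \<open>D / L\<close>. The \<open>ennreal\<close> form is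
  ready for Tonelli.\<close>

lemma square_increment_le:
  fixes f f' :: "real \<Rightarrow> real"
  assumes d: "\<And>s. (f has_real_derivative f' s) (at s)" and c: "continuous_on UNIV f'" and "x \<le> y"
  shows "ennreal ((f y - f x)\<^sup>2) \<le> ennreal (y - x) * (\<integral>\<^sup>+s\<in>{x<..<y}. ennreal ((f' s)\<^sup>2) \<partial>lborel)"
proof (cases "x = y")
  case False
  define L where "L = y - x"
  define D where "D = f y - f x"
  have L: "L > 0" using False assms(3) by (simp add: L_def)
  have c': "continuous_on {x..y} f'" using c continuous_on_subset by blast
  define I where "I = integral {x..y} (\<lambda>s. (f' s)\<^sup>2)"
  have I: "((\<lambda>s. (f' s)\<^sup>2) has_integral I) {x..y}"
    unfolding I_def by (intro integrable_integral integrable_continuous_real continuous_intros c')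
  have DI: "(f' has_integral D) {x..y}"
    unfolding D_def using assms
    by (intro fundamental_theorem_of_calculus)
       (auto simp: has_real_derivative_iff_has_vector_derivative[symmetric] intro: has_field_derivative_at_within)
  have "((\<lambda>s. (f' s)\<^sup>2 - 2 * (D/L) * f' s + (D/L)\<^sup>2) has_integral I - 2 * (D/L) * D + L * (D/L)\<^sup>2) {x..y}"
    using has_integral_const_real[of "(D/L)\<^sup>2" x y] L
    by (intro has_integral_add has_integral_diff I has_integral_mult_right DI) (simp add: L_def)
  then have "0 \<le> I - 2 * (D/L) * D + L * (D/L)\<^sup>2"
  proof (rule has_integral_nonneg)
    fix s
    have "(f' s)\<^sup>2 - 2 * (D/L) * f' s + (D/L)\<^sup>2 = (f' s - D/L)\<^sup>2"
      by (simp add: power2_eq_square algebra_simps)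
    then show "0 \<le> (f' s)\<^sup>2 - 2 * (D/L) * f' s + (D/L)\<^sup>2" by simp
  qed
  also have "\<dots> = I - D\<^sup>2 / L" using L by (simp add: field_simps power2_eq_square)
  finally have *: "D\<^sup>2 \<le> L * I" using L by (simp add: field_simps)
  have "(\<integral>\<^sup>+s\<in>{x<..<y}. ennreal ((f' s)\<^sup>2) \<partial>lborel) = (\<integral>\<^sup>+s\<in>{x..y}. ennreal ((f' s)\<^sup>2) \<partial>lborel)"
    by (rule nn_integral_cong_AE)
       (use AE_lborel_singleton[of x] AE_lborel_singleton[of y] in eventually_elim, auto split: split_indicator)
  also have "\<dots> = ennreal I"
    using I by (intro nn_integral_has_integral_lebesgue') auto
  finally show ?thesis
    using * L by (simp add: D_def L_def ennreal_mult'[symmetric] ennreal_leI)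
qed simp

text \<open>Continuity from below of the measure with density \<open>g\<close>. It serves for
  integrals whose left endpoint can only be approached.\<close>

lemma nn_integral_Union_le:
  fixes g :: "real \<Rightarrow> ennreal"
  assumes [measurable]: "g \<in> borel_measurable borel" and "incseq A" and [measurable]: "\<And>n. A n \<in> sets borel"
    and le: "\<And>n::nat. (\<integral>\<^sup>+x\<in>A n. g x \<partial>lborel) \<le> C"
  shows "(\<integral>\<^sup>+x\<in>(\<Union>n. A n). g x \<partial>lborel) \<le> C"
proof -
  have "emeasure (density lborel g) (\<Union>n. A n) = (SUP n. emeasure (density lborel g) (A n))"
    using assms(2) by (intro SUP_emeasure_incseq[symmetric]) auto
  also have "\<dots> \<le> C" using le by (intro SUP_least) (simp add: emeasure_density)
  finally show ?thesis by (simp add: emeasure_density)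
qed

section \<open>Gaussian power weights on a line and their mode\<close>

definition gauss_weight :: "real \<Rightarrow> real \<Rightarrow> real \<Rightarrow> real" where
  "gauss_weight a t s = power_weight a s * exp (- s\<^sup>2 / t)"

definition mode :: "real \<Rightarrow> real \<Rightarrow> real" where
  "mode a t = sqrt (t * a / 2)"

lemma gauss_weight_measurable [measurable]: "gauss_weight a t \<in> borel_measurable borel"
  unfolding gauss_weight_def by measurable

lemma gauss_weight_nonneg [simp]: "0 \<le> gauss_weight a t s"
  by (simp add: gauss_weight_def)

lemma gauss_weight_eq: "s \<in> half_line a \<Longrightarrow> gauss_weight a t s = power_factor a s * exp (- s\<^sup>2 / t)"
  by (simp add: gauss_weight_def power_weight_def)

lemma power_factor_deriv:
  assumes a: "0 \<le> a" and s: "s \<in> half_line a"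
  shows "(power_factor a has_real_derivative a / s * power_factor a s) (at s)"
proof (cases "a = 0")
  case True
  then have "power_factor a = (\<lambda>_. 1)" by (auto simp: power_factor_def)
  then show ?thesis using True by simp
next
  case False
  with a s have s: "0 < s" by (simp add: half_line_def)
  have "((\<lambda>s. s powr a) has_real_derivative a * s powr (a - 1)) (at s)"
    using s by (rule has_real_derivative_powr)
  also have "a * s powr (a - 1) = a / s * power_factor a s"
    using s False by (simp add: powr_diff power_factor_def)
  also have "(\<lambda>s. s powr a) = power_factor a" using False by (auto simp: power_factor_def)
  finally show ?thesis .
qed

context
  fixes a t :: real
  assumes a: "0 \<le> a" and t: "0 < t"
begin

text \<open>Since \<open>t * a / 2\<close> is the square of the mode \<open>m\<close>, the first
  factor of the derivative is \<open>m * m / s - s\<close>. On \<open>half_line a\<close> it has the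
  sign of \<open>m - s\<close> and at least the same modulus, which is what the two kernel bounds
  exploit.\<close>

lemma gauss_power_factor_deriv:
  assumes "s \<in> half_line a"
  shows "((\<lambda>s. t / 2 * (power_factor a s * exp (- s\<^sup>2 / t))) has_real_derivative
     (t * a / (2 * s) - s) * (power_factor a s * exp (- s\<^sup>2 / t))) (at s)"
proof -
  have "((\<lambda>s. t / 2 * (power_factor a s * exp (- s\<^sup>2 / t))) has_real_derivative
     t / 2 * (power_factor a s * (exp (- s\<^sup>2 / t) * (- (2 * s) / t)) + a / s * power_factor a s * exp (- s\<^sup>2 / t))) (at s)"
    using t by (auto intro!: derivative_eq_intros power_factor_deriv[OF a assms] simp: field_simps)
  also have "t / 2 * (power_factor a s * (exp (- s\<^sup>2 / t) * (- (2 * s) / t)) + a / s * power_factor a s * exp (- s\<^sup>2 / t)) 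
     = (t * a / (2 * s) - s) * (power_factor a s * exp (- s\<^sup>2 / t))"
    using t by (cases "s = 0") (simp_all add: field_simps)
  finally show ?thesis .
qed

lemma mode_half_line: "mode a t \<in> half_line a"
  using t by (auto simp: mode_def half_line_def)

lemma mode_sq: "t * a / 2 = mode a t * mode a t" "0 \<le> mode a t"
  using a t by (auto simp: mode_def)

text \<open>The mode is where the logarithmic derivative of the weight vanishes; since that derivative has slope
  at most \<open>- 2 / t\<close>, \<open>|x - mode|\<close> times the weight is dominated by \<open>t / 2\<close> times the modulus of the
  derivative of the weight on either side of the mode.\<close>

lemma kernel_right:
  assumes "mode a t < s"
  shows "(\<integral>\<^sup>+x. ennreal ((x - mode a t) * gauss_weight a t x) * indicator {s..} x \<partial>lborel) \<le> ennreal (t / 2 * gauss_weight a t s)"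
proof -
  have hl: "x \<in> half_line a" if "s \<le> x" for x
    using that assms mode_half_line by (auto simp: half_line_def)
  define F where "F = (\<lambda>x. - (t / 2 * (power_factor a x * exp (- x\<^sup>2 / t))))"
  define f where "f = (\<lambda>x. - ((t * a / (2 * x) - x) * (power_factor a x * exp (- x\<^sup>2 / t))))"
  have le: "(x - mode a t) * gauss_weight a t x \<le> f x" if "s \<le> x" for x
  proof -
    have "t * a / (2 * x) = mode a t * mode a t / x" using mode_sq by (simp add: field_simps)
    also have "\<dots> \<le> mode a t" using that assms mode_sq(2) by (simp add: field_simps mult_right_mono)
    finally have "(x - mode a t) * gauss_weight a t x \<le> (x - t * a / (2 * x)) * gauss_weight a t x" by (intro mult_right_mono) auto
    also have "\<dots> = f x" using hl[OF that] by (simp add: f_def gauss_weight_eq algebra_simps)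
    finally show ?thesis .
  qed
  have "(\<integral>\<^sup>+x. ennreal ((x - mode a t) * gauss_weight a t x) * indicator {s..} x \<partial>lborel) \<le> (\<integral>\<^sup>+x. ennreal (f x) * indicator {s..} x \<partial>lborel)"
    using le by (intro nn_integral_mono) (auto split: split_indicator intro!: ennreal_leI)
  also have "\<dots> = 0 - F s"
  proof (rule nn_integral_FTC_atLeast)
    show "f \<in> borel_measurable borel" unfolding f_def by measurable
    show "DERIV F x :> f x" if "s \<le> x" for x
      unfolding F_def f_def by (intro DERIV_minus gauss_power_factor_deriv hl that)
    show "0 \<le> f x" if "s \<le> x" for x
      using le[OF that] assms that by (intro order_trans[OF _ le[OF that]] mult_nonneg_nonneg) auto
    have "((\<lambda>x. x powr a * exp (- x\<^sup>2 / t)) \<longlongrightarrow> 0) at_top" using t by real_asymp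
    moreover have "((\<lambda>x. exp (- x\<^sup>2 / t)) \<longlongrightarrow> 0) at_top" using t by real_asymp
    ultimately have "((\<lambda>x. power_factor a x * exp (- x\<^sup>2 / t)) \<longlongrightarrow> 0) at_top"
      by (cases "a = 0") (simp_all add: power_factor_def)
    from tendsto_mult[OF tendsto_const[of "-(t/2)"] this] show "(F \<longlongrightarrow> 0) at_top"
      by (simp add: F_def)
  qed
  also have "\<dots> = ennreal (t / 2 * gauss_weight a t s)" using hl[of s] by (simp add: F_def gauss_weight_eq)
  finally show ?thesis .
qed

lemma kernel_left:
  assumes "s < mode a t"
  shows "(\<integral>\<^sup>+x. ennreal ((mode a t - x) * gauss_weight a t x) * indicator {..s} x \<partial>lborel) \<le> ennreal (t / 2 * gauss_weight a t s)"
proof (cases "s \<in> half_line a")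
  case False
  then have z: "gauss_weight a t x = 0" if "x \<le> s" for x using that by (auto simp: gauss_weight_def power_weight_def half_line_def)
  have "(\<integral>\<^sup>+x. ennreal ((mode a t - x) * gauss_weight a t x) * indicator {..s} x \<partial>lborel) = (\<integral>\<^sup>+x. 0 \<partial>(lborel :: real measure))"
    by (intro nn_integral_cong) (auto simp: z split: split_indicator)
  then show ?thesis by simp
next
  case True
  define F where "F = (\<lambda>x. t / 2 * (power_factor a x * exp (- x\<^sup>2 / t)))"
  define f where "f = (\<lambda>x. (t * a / (2 * x) - x) * (power_factor a x * exp (- x\<^sup>2 / t)))"
  \<comment> \<open>Left endpoints tending to \<open>-\<infinity>\<close> or to \<open>0\<close>.
    For \<open>a > 0\<close> they stay positive, where the primitive \<open>F\<close> is
    differentiable.\<close>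
  define l where "l = (\<lambda>n::nat. if a = 0 then - real n else 1 / real (Suc n))"
  define A where "A = (\<lambda>n. {l n..s})"
  have hl: "x \<in> half_line a" if "l n \<le> x" for n x
  proof -
    have "0 < x" if "a > 0"
    proof -
      have "0 < l n" using that by (simp add: l_def)
      then show ?thesis using \<open>l n \<le> x\<close> by linarith
    qed
    then show ?thesis by (simp add: half_line_def)
  qed
  have le: "(mode a t - x) * gauss_weight a t x \<le> f x" if "x \<le> s" "x \<in> half_line a" for x
  proof -
    have "mode a t \<le> t * a / (2 * x)"
    proof (cases "a = 0")
      case True then show ?thesis using mode_sq by simp
    next
      case False
      with a that have x: "0 < x" by (simp add: half_line_def)
      have "mode a t \<le> mode a t * mode a t / x" using that assms mode_sq(2) x by (simp add: field_simps mult_left_mono)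
      also have "\<dots> = t * a / (2 * x)" using mode_sq by (simp add: field_simps)
      finally show ?thesis .
    qed
    then have "(mode a t - x) * gauss_weight a t x \<le> (t * a / (2 * x) - x) * gauss_weight a t x" by (intro mult_right_mono) auto
    then show ?thesis using that by (simp add: f_def gauss_weight_eq)
  qed
  have f0: "0 \<le> f x" if "x \<le> s" "x \<in> half_line a" for x
    using assms that by (intro order_trans[OF _ le[OF that]] mult_nonneg_nonneg) auto
  have [measurable]: "f \<in> borel_measurable borel" unfolding f_def by measurable
  have "(\<integral>\<^sup>+x. ennreal ((mode a t - x) * gauss_weight a t x) * indicator {..s} x \<partial>lborel) 
      \<le> (\<integral>\<^sup>+x\<in>(\<Union>n. A n). ennreal (f x) \<partial>lborel)"
  proof (intro nn_integral_mono)
    fix x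
    have "x \<in> (\<Union>n. A n)" if "x \<le> s" "x \<in> half_line a"
    proof (cases "a = 0")
      case True
      obtain n where "- x \<le> real n" using real_arch_simple by blast
      then show ?thesis using True that by (auto simp: A_def l_def intro!: exI[of _ n])
    next
      case False
      then have "0 < x" using that a by (simp add: half_line_def)
      then obtain n where "inverse (real (Suc n)) < x" using reals_Archimedean by blast
      then show ?thesis using False that by (auto simp: A_def l_def inverse_eq_divide intro!: exI[of _ n])
    qed
    moreover have "gauss_weight a t x = 0" if "x \<notin> half_line a" using that by (simp add: gauss_weight_def power_weight_def)
    ultimately show "ennreal ((mode a t - x) * gauss_weight a t x) * indicator {..s} x \<le> ennreal (f x) * indicator (\<Union>n. A n) x"
      using le[of x] by (cases "x \<in> half_line a") (auto split: split_indicator intro!: ennreal_leI)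
  qed
  also have "\<dots> \<le> ennreal (t / 2 * gauss_weight a t s)"
  proof (rule nn_integral_Union_le)
    have "l n \<le> l m" if "m \<le> n" for m n
      using that by (simp add: l_def frac_le)
    then show "incseq A" by (auto simp: incseq_def A_def intro: order_trans)
    fix n
    show "(\<integral>\<^sup>+x\<in>A n. ennreal (f x) \<partial>lborel) \<le> ennreal (t / 2 * gauss_weight a t s)"
    proof (cases "l n \<le> s")
      case True
      have "(\<integral>\<^sup>+x\<in>A n. ennreal (f x) \<partial>lborel) = ennreal (F s - F (l n))"
        unfolding A_def
      proof (rule nn_integral_FTC_Icc)
        show "DERIV F x :> f x" if "x \<in> {l n..s}" for x
          using that unfolding F_def f_def by (intro gauss_power_factor_deriv hl[of n]) auto
        show "0 \<le> f x" if "x \<in> {l n..s}" for x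
          using that by (intro f0 hl[of n]) auto
      qed (use True in auto)
      also have "\<dots> \<le> ennreal (t / 2 * gauss_weight a t s)"
        using t \<open>s \<in> half_line a\<close> by (intro ennreal_leI) (simp add: F_def gauss_weight_eq)
      finally show ?thesis .
    qed (simp add: A_def)
  qed (simp_all add: A_def)
  finally show ?thesis .
qed

text \<open>Cauchy-Schwarz bounds \<open>(f x - f m)\<^sup>2\<close> by the distance to the mode
  \<open>m\<close> times the integral of \<open>(f' s)\<^sup>2\<close> over the points
  \<open>s\<close> in between. After Tonelli, each \<open>(f' s)\<^sup>2\<close> is multiplied by a
  kernel integral over the points \<open>x\<close> beyond \<open>s\<close>. For \<open>a = 0\<close>
  and \<open>f x = x\<close> equality holds.\<close>

theorem poincare_1d:
  assumes d: "\<And>s. (f has_real_derivative f' s) (at s)" and c: "continuous_on UNIV f'"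
  shows "(\<integral>\<^sup>+x. ennreal ((f x - f (mode a t))\<^sup>2) * ennreal (gauss_weight a t x) \<partial>lborel)
     \<le> ennreal (t / 2) * (\<integral>\<^sup>+x. ennreal ((f' x)\<^sup>2) * ennreal (gauss_weight a t x) \<partial>lborel)"
proof -
  have [measurable]: "f' \<in> borel_measurable borel" using c by (rule borel_measurable_continuous_onI)
  \<comment> \<open>The kernel is the distance from \<open>x\<close> to the mode if \<open>s\<close>
    lies strictly between them, and \<open>0\<close> otherwise; strictness makes it vanish for
    \<open>s\<close> equal to the mode.\<close>
  define k where "k = (\<lambda>x s. (if (mode a t) < s \<and> s < x then x - mode a t else if x < s \<and> s < mode a t then mode a t - x else 0))"
  have [measurable]: "case_prod k \<in> borel_measurable (lborel \<Otimes>\<^sub>M lborel)" unfolding k_def by measurable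
  have "(\<integral>\<^sup>+x. ennreal ((f x - f (mode a t))\<^sup>2) * ennreal (gauss_weight a t x) \<partial>lborel)
     \<le> (\<integral>\<^sup>+x. (\<integral>\<^sup>+s. ennreal ((f' s)\<^sup>2) * ennreal (k x s * gauss_weight a t x) \<partial>lborel) \<partial>lborel)"
  proof (rule nn_integral_mono)
    fix x
    have "ennreal ((f x - f (mode a t))\<^sup>2) \<le> (\<integral>\<^sup>+s. ennreal (k x s) * ennreal ((f' s)\<^sup>2) \<partial>lborel)"
    proof (cases "mode a t \<le> x")
      case True
      have "ennreal ((f x - f (mode a t))\<^sup>2) \<le> ennreal (x - mode a t) * (\<integral>\<^sup>+s\<in>{mode a t<..<x}. ennreal ((f' s)\<^sup>2) \<partial>lborel)"
        by (rule square_increment_le[OF d c True])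
      also have "\<dots> = (\<integral>\<^sup>+s. ennreal (k x s) * ennreal ((f' s)\<^sup>2) \<partial>lborel)"
        using True
        by (subst nn_integral_cmult[symmetric])
           (auto simp: k_def split: split_indicator intro!: nn_integral_cong)
      finally show ?thesis .
    next
      case False
      then have "ennreal ((f (mode a t) - f x)\<^sup>2) \<le> ennreal (mode a t - x) * (\<integral>\<^sup>+s\<in>{x<..<mode a t}. ennreal ((f' s)\<^sup>2) \<partial>lborel)"
        by (intro square_increment_le[OF d c]) simp
      also have "\<dots> = (\<integral>\<^sup>+s. ennreal (k x s) * ennreal ((f' s)\<^sup>2) \<partial>lborel)"
        using False
        by (subst nn_integral_cmult[symmetric])
           (auto simp: k_def split: split_indicator intro!: nn_integral_cong)
      finally show ?thesis by (simp add: power2_commute)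
    qed
    then have "ennreal ((f x - f (mode a t))\<^sup>2) * ennreal (gauss_weight a t x) \<le> (\<integral>\<^sup>+s. ennreal (k x s) * ennreal ((f' s)\<^sup>2) \<partial>lborel) * ennreal (gauss_weight a t x)"
      by (rule mult_right_mono) simp
    also have "\<dots> = (\<integral>\<^sup>+s. ennreal ((f' s)\<^sup>2) * ennreal (k x s * gauss_weight a t x) \<partial>lborel)"
      by (subst nn_integral_multc[symmetric])
         (auto simp: ennreal_mult'' mult_ac intro!: nn_integral_cong)
    finally show "ennreal ((f x - f (mode a t))\<^sup>2) * ennreal (gauss_weight a t x) \<le> (\<integral>\<^sup>+s. ennreal ((f' s)\<^sup>2) * ennreal (k x s * gauss_weight a t x) \<partial>lborel)" .
  qed
  also have "\<dots> = (\<integral>\<^sup>+s. (\<integral>\<^sup>+x. ennreal ((f' s)\<^sup>2) * ennreal (k x s * gauss_weight a t x) \<partial>lborel) \<partial>lborel)"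
    by (rule lborel_pair.Fubini') measurable
  also have "\<dots> = (\<integral>\<^sup>+s. ennreal ((f' s)\<^sup>2) * (\<integral>\<^sup>+x. ennreal (k x s * gauss_weight a t x) \<partial>lborel) \<partial>lborel)"
    by (intro nn_integral_cong nn_integral_cmult) measurable
  also have "\<dots> \<le> (\<integral>\<^sup>+s. ennreal ((f' s)\<^sup>2) * ennreal (t / 2 * gauss_weight a t s) \<partial>lborel)"
  proof (intro nn_integral_mono mult_left_mono)
    fix s
    consider "s < mode a t" | "s = mode a t" | "mode a t < s" by linarith
    then show "(\<integral>\<^sup>+x. ennreal (k x s * gauss_weight a t x) \<partial>lborel) \<le> ennreal (t / 2 * gauss_weight a t s)"
    proof cases
      case 1
      have "(\<integral>\<^sup>+x. ennreal (k x s * gauss_weight a t x) \<partial>lborel) \<le> (\<integral>\<^sup>+x. ennreal ((mode a t - x) * gauss_weight a t x) * indicator {..s} x \<partial>lborel)"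
        using 1 by (intro nn_integral_mono) (auto simp: k_def split: split_indicator)
      then show ?thesis using kernel_left[OF 1] by (rule order_trans)
    next
      case 2 then show ?thesis by (simp add: k_def)
    next
      case 3
      have "(\<integral>\<^sup>+x. ennreal (k x s * gauss_weight a t x) \<partial>lborel) \<le> (\<integral>\<^sup>+x. ennreal ((x - mode a t) * gauss_weight a t x) * indicator {s..} x \<partial>lborel)"
        using 3 by (intro nn_integral_mono) (auto simp: k_def split: split_indicator)
      then show ?thesis using kernel_right[OF 3] by (rule order_trans)
    qed
  qed simp
  also have "\<dots> = ennreal (t / 2) * (\<integral>\<^sup>+x. ennreal ((f' x)\<^sup>2) * ennreal (gauss_weight a t x) \<partial>lborel)"
    using t by (subst nn_integral_cmult[symmetric])
      (auto simp: ennreal_mult'' mult.left_commute simp del: times_divide_eq_left intro!: nn_integral_cong)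
  finally show ?thesis .
qed

end

section \<open>Tensorization of the variance\<close>

definition var :: "'a measure \<Rightarrow> ('a \<Rightarrow> real) \<Rightarrow> real" where
  "var M f = (\<integral>x. (f x)\<^sup>2 \<partial>M) - (\<integral>x. f x \<partial>M)\<^sup>2"

lemma (in prob_space) integrable_bdd:
  fixes f :: "'a \<Rightarrow> real"
  assumes "f \<in> borel_measurable M" "\<And>x. \<bar>f x\<bar> \<le> C"
  shows "integrable M f"
  by (rule integrable_const_bound[of _ C]) (use assms in auto)

lemma (in prob_space) abs_integral_le:
  fixes f :: "'a \<Rightarrow> real"
  assumes f: "\<And>x. \<bar>f x\<bar> \<le> C"
  shows "\<bar>\<integral>x. f x \<partial>M\<bar> \<le> C"
proof (cases "integrable M f")
  case True
  have "\<bar>\<integral>x. f x \<partial>M\<bar> \<le> (\<integral>x. \<bar>f x\<bar> \<partial>M)" by simp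
  also have "\<dots> \<le> (\<integral>x. C \<partial>M)" using True f by (intro integral_mono) auto
  finally show ?thesis by (simp add: prob_space)
next
  case False
  \<comment> \<open>A non-integrable function has integral \<open>0\<close> by convention, so only
    the sign of \<open>C\<close> matters.\<close>
  have "0 \<le> C" using f[of undefined] by linarith
  then show ?thesis using False by (simp add: not_integrable_integral_eq)
qed

lemma square_bdd: "\<bar>x\<bar> \<le> C \<Longrightarrow> \<bar>x\<^sup>2\<bar> \<le> (C::real)\<^sup>2"
  by (metis abs_ge_zero abs_power2 power2_abs power_mono)

lemma mult_bdd: "\<bar>x\<bar> \<le> C \<Longrightarrow> \<bar>y\<bar> \<le> D \<Longrightarrow> \<bar>x * y\<bar> \<le> C * (D::real)"
  unfolding abs_mult by (rule mult_mono) auto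

lemma (in prob_space) var_shift:
  assumes [measurable]: "f \<in> borel_measurable M" and b: "\<And>x. \<bar>f x\<bar> \<le> C"
  shows "(\<integral>x. (f x - c)\<^sup>2 \<partial>M) = var M f + ((\<integral>x. f x \<partial>M) - c)\<^sup>2"
proof -
  have [simp]: "integrable M f" "integrable M (\<lambda>x. (f x)\<^sup>2)"
    by (rule integrable_bdd, simp, rule b) (rule integrable_bdd, simp, rule square_bdd, rule b)
  have "(\<integral>x. (f x - c)\<^sup>2 \<partial>M) = (\<integral>x. (f x)\<^sup>2 - 2 * c * f x + c\<^sup>2 \<partial>M)"
    by (simp add: power2_diff algebra_simps)
  also have "\<dots> = (\<integral>x. (f x)\<^sup>2 \<partial>M) - 2 * c * (\<integral>x. f x \<partial>M) + c\<^sup>2"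
    by (simp add: prob_space)
  finally show ?thesis by (simp add: var_def power2_diff)
qed

lemma (in prob_space) var_le:
  assumes "f \<in> borel_measurable M" "\<And>x. \<bar>f x\<bar> \<le> C"
  shows "var M f \<le> (\<integral>x. (f x - c)\<^sup>2 \<partial>M)"
  using var_shift[OF assms, of c] by simp

lemma (in prob_space) var_nonneg:
  assumes "f \<in> borel_measurable M" "\<And>x. \<bar>f x\<bar> \<le> C"
  shows "0 \<le> var M f"
proof -
  have "0 \<le> (\<integral>x. (f x - (\<integral>x. f x \<partial>M))\<^sup>2 \<partial>M)" by (rule integral_nonneg_AE) simp
  then show ?thesis using var_shift[OF assms, of "\<integral>x. f x \<partial>M"] by simp
qed

text \<open>With the marginal means \<open>g\<close>, \<open>h\<close> and the total mean
  \<open>m\<close>, the interaction part \<open>f - g - h + m\<close> has a nonnegative square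
  integral. Its cross terms reduce to marginals, leaving the integrals of
  \<open>f\<^sup>2 - g\<^sup>2 - h\<^sup>2\<close> plus \<open>m\<^sup>2\<close>. This is the claim,
  as the averaged fibre variances are the integrals of \<open>f\<^sup>2 - g\<^sup>2\<close> and
  \<open>f\<^sup>2 - h\<^sup>2\<close>.\<close>

lemma efron_stein_pair:
  assumes "prob_space M1" "prob_space M2"
    and f[measurable]: "f \<in> borel_measurable (M1 \<Otimes>\<^sub>M M2)" and b: "\<And>z. \<bar>f z\<bar> \<le> C"
  shows "integrable M1 (\<lambda>x. var M2 (\<lambda>y. f (x, y)))"
    and "integrable M2 (\<lambda>y. var M1 (\<lambda>x. f (x, y)))"
    and "var (M1 \<Otimes>\<^sub>M M2) f \<le> (\<integral>x. var M2 (\<lambda>y. f (x, y)) \<partial>M1) + (\<integral>y. var M1 (\<lambda>x. f (x, y)) \<partial>M2)"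
proof -
  interpret M1: prob_space M1 by fact
  interpret M2: prob_space M2 by fact
  interpret P: pair_prob_space M1 M2 ..
  define g where "g = (\<lambda>x. \<integral>y. f (x, y) \<partial>M2)"
  define h where "h = (\<lambda>y. \<integral>x. f (x, y) \<partial>M1)"
  define m where "m = (\<integral>z. f z \<partial>(M1 \<Otimes>\<^sub>M M2))"
  have [measurable]: "g \<in> borel_measurable M1" "h \<in> borel_measurable M2"
    unfolding g_def h_def by measurable
  have gb: "\<bar>g x\<bar> \<le> C" for x unfolding g_def by (rule M2.abs_integral_le[OF b])
  have hb: "\<bar>h y\<bar> \<le> C" for y unfolding h_def by (rule M1.abs_integral_le[OF b])
  have gx: "(\<integral>y. f (x, y) \<partial>M2) = g x" for x by (simp add: g_def)
  have hy: "(\<integral>x. f (x, y) \<partial>M1) = h y" for y by (simp add: h_def)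
  note bds = b gb hb square_bdd mult_bdd
  have ig: "integrable M1 (\<lambda>x. (g x)\<^sup>2)" "integrable M1 g"
    by (rule M1.integrable_bdd, measurable, rule bds, (rule bds)?)+
  have ih: "integrable M2 (\<lambda>x. (h x)\<^sup>2)" "integrable M2 h"
    by (rule M2.integrable_bdd, measurable, rule bds, (rule bds)?)+
  have f2x: "integrable M1 (\<lambda>x. \<integral>y. (f (x, y))\<^sup>2 \<partial>M2)"
    by (rule M1.integrable_bdd, measurable, rule M2.abs_integral_le, rule square_bdd, rule b)
  have f2y: "integrable M2 (\<lambda>y. \<integral>x. (f (x, y))\<^sup>2 \<partial>M1)"
    by (rule M2.integrable_bdd, measurable, rule M1.abs_integral_le, rule square_bdd, rule b)
  have fint: "integrable (M1 \<Otimes>\<^sub>M M2) f" by (rule P.integrable_bdd[OF f b])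
  have f2int: "integrable (M1 \<Otimes>\<^sub>M M2) (\<lambda>z. (f z)\<^sup>2)"
    by (rule P.integrable_bdd, measurable, rule square_bdd, rule b)
  have i1: "integrable (M1 \<Otimes>\<^sub>M M2) (\<lambda>z. g (fst z) * f z)"
    by (rule P.integrable_bdd, measurable, rule mult_bdd, rule gb, rule b)
  have i2: "integrable (M1 \<Otimes>\<^sub>M M2) (\<lambda>z. h (snd z) * f z)"
    by (rule P.integrable_bdd, measurable, rule mult_bdd, rule hb, rule b)
  have i3: "integrable (M1 \<Otimes>\<^sub>M M2) (\<lambda>z. g (fst z) * h (snd z))"
    by (rule P.integrable_bdd, measurable, rule mult_bdd, rule gb, rule hb)
  have i4: "integrable (M1 \<Otimes>\<^sub>M M2) (\<lambda>z. g (fst z))"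
    by (rule P.integrable_bdd, measurable, rule gb)
  have i5: "integrable (M1 \<Otimes>\<^sub>M M2) (\<lambda>z. h (snd z))"
    by (rule P.integrable_bdd, measurable, rule hb)
  have i6: "integrable (M1 \<Otimes>\<^sub>M M2) (\<lambda>z. (g (fst z))\<^sup>2)"
    by (rule P.integrable_bdd, measurable, rule square_bdd, rule gb)
  have i7: "integrable (M1 \<Otimes>\<^sub>M M2) (\<lambda>z. (h (snd z))\<^sup>2)"
    by (rule P.integrable_bdd, measurable, rule square_bdd, rule hb)
  have Fx: "(\<integral>z. k z \<partial>(M1 \<Otimes>\<^sub>M M2)) = (\<integral>x. \<integral>y. k (x, y) \<partial>M2 \<partial>M1)"
    if "integrable (M1 \<Otimes>\<^sub>M M2) k" for k :: "_ \<Rightarrow> real"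
    using P.integral_fst'[OF that] by simp
  have Fy: "(\<integral>z. k z \<partial>(M1 \<Otimes>\<^sub>M M2)) = (\<integral>y. \<integral>x. k (x, y) \<partial>M1 \<partial>M2)"
    if "integrable (M1 \<Otimes>\<^sub>M M2) k" for k :: "_ \<Rightarrow> real"
    using P.integral_snd[of "\<lambda>x y. k (x, y)"] that by simp
  have mg: "m = (\<integral>x. g x \<partial>M1)" unfolding m_def g_def by (rule Fx[OF fint])
  have mh: "m = (\<integral>y. h y \<partial>M2)" unfolding m_def h_def by (rule Fy[OF fint])
  have e1: "(\<integral>z. g (fst z) * f z \<partial>(M1 \<Otimes>\<^sub>M M2)) = (\<integral>x. (g x)\<^sup>2 \<partial>M1)"
    by (subst Fx[OF i1]) (simp add: g_def power2_eq_square)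
  have e2: "(\<integral>z. h (snd z) * f z \<partial>(M1 \<Otimes>\<^sub>M M2)) = (\<integral>y. (h y)\<^sup>2 \<partial>M2)"
    by (subst Fy[OF i2]) (simp add: h_def power2_eq_square)
  have e3: "(\<integral>z. g (fst z) * h (snd z) \<partial>(M1 \<Otimes>\<^sub>M M2)) = m\<^sup>2"
    by (subst Fx[OF i3]) (simp add: mg[symmetric] mh[symmetric] power2_eq_square)
  have e4: "(\<integral>z. g (fst z) \<partial>(M1 \<Otimes>\<^sub>M M2)) = m"
    by (subst Fx[OF i4]) (simp add: mg M2.prob_space)
  have e5: "(\<integral>z. h (snd z) \<partial>(M1 \<Otimes>\<^sub>M M2)) = m"
    by (subst Fx[OF i5]) (simp add: mh M1.prob_space)
  have e6: "(\<integral>z. (g (fst z))\<^sup>2 \<partial>(M1 \<Otimes>\<^sub>M M2)) = (\<integral>x. (g x)\<^sup>2 \<partial>M1)"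
    by (subst Fx[OF i6]) (simp add: M2.prob_space)
  have e7: "(\<integral>z. (h (snd z))\<^sup>2 \<partial>(M1 \<Otimes>\<^sub>M M2)) = (\<integral>y. (h y)\<^sup>2 \<partial>M2)"
    by (subst Fx[OF i7]) (simp add: M1.prob_space)
  show "integrable M1 (\<lambda>x. var M2 (\<lambda>y. f (x, y)))"
    unfolding var_def gx by (intro Bochner_Integration.integrable_diff f2x ig)
  show "integrable M2 (\<lambda>y. var M1 (\<lambda>x. f (x, y)))"
    unfolding var_def hy by (intro Bochner_Integration.integrable_diff f2y ih)
  have "0 \<le> (\<integral>z. (f z - g (fst z) - h (snd z) + m)\<^sup>2 \<partial>(M1 \<Otimes>\<^sub>M M2))"
    by (rule integral_nonneg_AE) simp
  also have "\<dots> = (\<integral>z. (f z)\<^sup>2 + (g (fst z))\<^sup>2 + (h (snd z))\<^sup>2 + m\<^sup>2 - 2 * (g (fst z) * f z)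
      - 2 * (h (snd z) * f z) + 2 * (g (fst z) * h (snd z)) + 2 * m * f z - 2 * m * g (fst z) - 2 * m * h (snd z) \<partial>(M1 \<Otimes>\<^sub>M M2))"
    by (intro Bochner_Integration.integral_cong) (auto simp: power2_eq_square algebra_simps)
  also have "\<dots> = (\<integral>z. (f z)\<^sup>2 \<partial>(M1 \<Otimes>\<^sub>M M2)) - (\<integral>x. (g x)\<^sup>2 \<partial>M1) - (\<integral>y. (h y)\<^sup>2 \<partial>M2) + m\<^sup>2"
    using fint f2int i1 i2 i3 i4 i5 i6 i7
    by (simp add: e1 e2 e3 e4 e5 e6 e7 m_def[symmetric] P.prob_space; simp add: power2_eq_square)
  finally have "(\<integral>x. (g x)\<^sup>2 \<partial>M1) + (\<integral>y. (h y)\<^sup>2 \<partial>M2) \<le> (\<integral>z. (f z)\<^sup>2 \<partial>(M1 \<Otimes>\<^sub>M M2)) + m\<^sup>2" by simp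
  moreover have "(\<integral>x. var M2 (\<lambda>y. f (x, y)) \<partial>M1) = (\<integral>z. (f z)\<^sup>2 \<partial>(M1 \<Otimes>\<^sub>M M2)) - (\<integral>x. (g x)\<^sup>2 \<partial>M1)"
    unfolding var_def gx Fx[OF f2int] by (intro Bochner_Integration.integral_diff f2x ig)
  moreover have "(\<integral>y. var M1 (\<lambda>x. f (x, y)) \<partial>M2) = (\<integral>z. (f z)\<^sup>2 \<partial>(M1 \<Otimes>\<^sub>M M2)) - (\<integral>y. (h y)\<^sup>2 \<partial>M2)"
    unfolding var_def hy Fy[OF f2int] by (intro Bochner_Integration.integral_diff f2y ih)
  ultimately show "var (M1 \<Otimes>\<^sub>M M2) f \<le> (\<integral>x. var M2 (\<lambda>y. f (x, y)) \<partial>M1) + (\<integral>y. var M1 (\<lambda>x. f (x, y)) \<partial>M2)"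
    by (simp add: var_def m_def)
qed

text \<open>The functions \<open>d i\<close> stand for a multiple of \<open>|\<partial>\<^sub>i f|\<^sup>2\<close>.\<close>

theorem efron_stein:
  fixes M :: "'i \<Rightarrow> 'a measure" and d :: "'i \<Rightarrow> ('i \<Rightarrow> 'a) \<Rightarrow> ennreal"
  assumes "finite I" and M: "\<And>i. prob_space (M i)"
    and "f \<in> borel_measurable (PiM I M)" and "\<And>x. \<bar>f x\<bar> \<le> C"
    and "\<And>i. i \<in> I \<Longrightarrow> d i \<in> borel_measurable (PiM I M)"
    and "\<And>i x. i \<in> I \<Longrightarrow> x \<in> space (PiM I M) \<Longrightarrow>
       ennreal (var (M i) (\<lambda>s. f (x(i := s)))) \<le> (\<integral>\<^sup>+s. d i (x(i := s)) \<partial>M i)"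
  shows "ennreal (var (PiM I M) f) \<le> (\<Sum>i\<in>I. \<integral>\<^sup>+x. d i x \<partial>PiM I M)"
  using assms(1,3-)
proof (induction I arbitrary: f d rule: finite_induct)
  case empty
  \<comment> \<open>With no coordinates the product is a point mass, for which every variance
    vanishes.\<close>
  show ?case
    by (simp add: var_def PiM_empty lebesgue_integral_count_space_finite)
next
  case (insert j I)
  interpret product_prob_space M using M by (intro product_prob_space.intro product_prob_space_axioms.intro product_sigma_finite.intro prob_space_imp_sigma_finite)
  interpret PI: prob_space "PiM I M" by (intro prob_space_PiM M)
  note insert(1)[simp]
  note [measurable] = insert(4) insert(6)
  have f': "(\<lambda>z. f ((snd z)(j := fst z))) \<in> borel_measurable (M j \<Otimes>\<^sub>M PiM I M)" by measurable
  have distr: "PiM (insert j I) M = distr (M j \<Otimes>\<^sub>M PiM I M) (PiM (insert j I) M) (\<lambda>z. (snd z)(j := fst z))"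
    using distr_pair_PiM_eq_PiM[of I M j] M by (simp add: case_prod_beta')
  have v: "var (PiM (insert j I) M) f = var (M j \<Otimes>\<^sub>M PiM I M) (\<lambda>z. f ((snd z)(j := fst z)))"
    unfolding var_def by (subst (1 2) distr) (simp add: integral_distr)
  \<comment> \<open>The new coordinate \<open>j\<close> forms one factor and all coordinates in
    \<open>I\<close> the other; the induction hypothesis treats the latter for each fixed value
    \<open>s\<close> of coordinate \<open>j\<close>.\<close>
  note es = efron_stein_pair[OF M[of j] PI.prob_space_axioms f' insert(5), unfolded fst_conv snd_conv]
  have m1: "(\<lambda>x. f (x(j := s))) \<in> borel_measurable (PiM I M)" if "s \<in> space (M j)" for s
    using that by measurable
  have "ennreal (var (PiM (insert j I) M) f) \<le> ennreal ((\<integral>s. var (PiM I M) (\<lambda>x. f (x(j := s))) \<partial>M j)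
      + (\<integral>x. var (M j) (\<lambda>s. f (x(j := s))) \<partial>PiM I M))"
    unfolding v by (intro ennreal_leI es(3))
  also have "\<dots> = (\<integral>\<^sup>+s. ennreal (var (PiM I M) (\<lambda>x. f (x(j := s)))) \<partial>M j)
      + (\<integral>\<^sup>+x. ennreal (var (M j) (\<lambda>s. f (x(j := s)))) \<partial>PiM I M)"
  proof -
    have p1: "AE s in M j. 0 \<le> var (PiM I M) (\<lambda>x. f (x(j := s)))"
      by (intro AE_I2 PI.var_nonneg[OF m1 insert(5)])
    have p2: "AE x in PiM I M. 0 \<le> var (M j) (\<lambda>s. f (x(j := s)))"
      by (intro AE_I2 prob_space.var_nonneg[OF M _ insert(5)]) measurable
    show ?thesis
      unfolding nn_integral_eq_integral[OF es(1) p1] nn_integral_eq_integral[OF es(2) p2]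
      by (intro ennreal_plus integral_nonneg_AE p1 p2)
  qed
  also have "\<dots> \<le> (\<integral>\<^sup>+s. (\<Sum>i\<in>I. \<integral>\<^sup>+x. d i (x(j := s)) \<partial>PiM I M) \<partial>M j)
      + (\<integral>\<^sup>+x. \<integral>\<^sup>+s. d j (x(j := s)) \<partial>M j \<partial>PiM I M)"
  proof (intro add_mono nn_integral_mono)
    fix s assume s: "s \<in> space (M j)"
    show "ennreal (var (PiM I M) (\<lambda>x. f (x(j := s)))) \<le> (\<Sum>i\<in>I. \<integral>\<^sup>+x. d i (x(j := s)) \<partial>PiM I M)"
    proof (rule insert.IH[OF m1[OF s] insert(5)])
      show "(\<lambda>x. d i (x(j := s))) \<in> borel_measurable (PiM I M)" if "i \<in> I" for i
      proof -
        have [measurable]: "d i \<in> borel_measurable (PiM (insert j I) M)" using that by (intro insert(6)) auto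
        show ?thesis using s by measurable
      qed
      fix i x assume i: "i \<in> I" and x: "x \<in> space (PiM I M)"
      have "i \<noteq> j" using i insert(2) by auto
      have "x(j := s) \<in> space (PiM (insert j I) M)" using x s by (auto simp: space_PiM PiE_def extensional_def)
      from insert(7)[OF insertI2[OF i] this]
      show "ennreal (var (M i) (\<lambda>s'. f ((x(i := s'))(j := s)))) \<le> (\<integral>\<^sup>+s'. d i ((x(i := s'))(j := s)) \<partial>M i)"
        unfolding fun_upd_twist[OF \<open>i \<noteq> j\<close>] .
    qed
  next
    fix x assume x: "x \<in> space (PiM I M)"
    \<comment> \<open>The fibre hypothesis speaks of points of the full product, so coordinate
      \<open>j\<close> is filled with an arbitrary \<open>s0\<close>, which the update by
      \<open>s\<close> overwrites.\<close>
    obtain s0 where "s0 \<in> space (M j)" using prob_space.not_empty[OF M, of j] by auto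
    then have "x(j := s0) \<in> space (PiM (insert j I) M)" using x by (auto simp: space_PiM PiE_def extensional_def)
    from insert(7)[OF insertI1 this]
    show "ennreal (var (M j) (\<lambda>s. f (x(j := s)))) \<le> (\<integral>\<^sup>+s. d j (x(j := s)) \<partial>M j)"
      unfolding fun_upd_upd .
  qed
  also have "(\<integral>\<^sup>+s. (\<Sum>i\<in>I. \<integral>\<^sup>+x. d i (x(j := s)) \<partial>PiM I M) \<partial>M j) = (\<Sum>i\<in>I. \<integral>\<^sup>+s. \<integral>\<^sup>+x. d i (x(j := s)) \<partial>PiM I M \<partial>M j)"
  proof (rule nn_integral_sum)
    fix i assume "i \<in> I"
    then have [measurable]: "d i \<in> borel_measurable (PiM (insert j I) M)" by (intro insert(6)) auto
    show "(\<lambda>s. \<integral>\<^sup>+x. d i (x(j := s)) \<partial>PiM I M) \<in> borel_measurable (M j)" by measurable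
  qed
  also have "\<dots> = (\<Sum>i\<in>I. \<integral>\<^sup>+x. d i x \<partial>PiM (insert j I) M)"
    by (intro sum.cong refl product_nn_integral_insert_rev[symmetric] insert(1,2,6)) auto
  also have "(\<integral>\<^sup>+x. \<integral>\<^sup>+s. d j (x(j := s)) \<partial>M j \<partial>PiM I M) = (\<integral>\<^sup>+x. d j x \<partial>PiM (insert j I) M)"
    by (intro product_nn_integral_insert[symmetric] insert(1,2,6)) auto
  finally show ?case using insert(1,2) by (simp add: add.commute)
qed

section \<open>The Poincare inequality for the Gaussian monomial weight\<close>

lemma vec_lambda_measurable [measurable]:
  "(vec_lambda :: ('n::finite \<Rightarrow> real) \<Rightarrow> real ^ 'n) \<in> PiM UNIV (\<lambda>_. borel) \<rightarrow>\<^sub>M borel"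
proof (subst borel_measurable_euclidean_space, intro ballI)
  fix b :: "real ^ 'n" assume "b \<in> Basis"
  then obtain i where "b = axis i 1" by (auto simp: Basis_vec_def)
  then show "(\<lambda>x. vec_lambda x \<bullet> b) \<in> borel_measurable (PiM UNIV (\<lambda>_. borel))"
    by (simp add: inner_axis)
qed

lemma vec_lambda_measurable':
  assumes "\<And>i. sets (M i) = sets borel"
  shows "(vec_lambda :: ('n::finite \<Rightarrow> real) \<Rightarrow> real ^ 'n) \<in> PiM UNIV M \<rightarrow>\<^sub>M borel"
proof -
  have "sets (PiM UNIV M) = sets (PiM UNIV (\<lambda>_::'n. borel))" using assms by (intro sets_PiM_cong) auto
  from measurable_cong_sets[OF this refl] show ?thesis using vec_lambda_measurable by blast
qed

lemma vec_nth_measurable [measurable]: "(\<lambda>x :: real ^ 'n::finite. x $ i) \<in> borel_measurable borel"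
  by (intro borel_measurable_continuous_onI continuous_intros)

lemma prod_Basis_vec: "(\<Prod>b\<in>Basis. f b) = (\<Prod>i\<in>UNIV. f (axis i (1::real) :: real ^ 'n::finite))"
proof -
  have "Basis = (\<lambda>i. axis i 1 :: real ^ 'n) ` UNIV" by (auto simp: Basis_vec_def)
  moreover have "inj (\<lambda>i. axis i 1 :: real ^ 'n)" by (auto simp: inj_on_def axis_eq_axis)
  ultimately show ?thesis using prod.reindex[of "\<lambda>i. axis i 1 :: real ^ 'n" UNIV f] by (simp add: o_def)
qed

text \<open>Efron--Stein lives on \<open>PiM\<close>, the weighted integrals on
  \<open>real ^ 'n\<close>. Lebesgue measure is determined by its values on boxes, and both sides
  give the product of the edge lengths.\<close>

lemma lborel_vec_eq:
  "(lborel :: (real ^ 'n::finite) measure) = distr (PiM UNIV (\<lambda>_. lborel)) borel vec_lambda"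
proof (rule lborel_eqI)
  interpret product_sigma_finite "\<lambda>_::'n. lborel :: real measure" ..
  fix l u :: "real ^ 'n" assume le: "\<And>b. b \<in> Basis \<Longrightarrow> l \<bullet> b \<le> u \<bullet> b"
  have le': "l $ i \<le> u $ i" for i using le[of "axis i 1"] by (simp add: inner_axis)
  have "emeasure (distr (PiM UNIV (\<lambda>_. lborel)) borel vec_lambda) (box l u)
     = emeasure (PiM UNIV (\<lambda>_. lborel)) (vec_lambda -` box l u \<inter> space (PiM UNIV (\<lambda>_::'n. lborel)))"
    by (intro emeasure_distr vec_lambda_measurable') auto
  also have "vec_lambda -` box l u \<inter> space (PiM UNIV (\<lambda>_::'n. lborel)) = PiE UNIV (\<lambda>i. {l $ i<..<u $ i})"
    by (auto simp: space_PiM mem_box_cart PiE_def Pi_iff)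
  also have "emeasure (PiM UNIV (\<lambda>_. lborel)) \<dots> = (\<Prod>i\<in>UNIV. emeasure lborel {l $ i<..<u $ i})"
    by (rule emeasure_PiM) auto
  also have "\<dots> = ennreal (\<Prod>b\<in>Basis. (u - l) \<bullet> b)"
    by (subst prod_Basis_vec) (simp add: inner_axis le' prod_ennreal)
  finally show "emeasure (distr (PiM UNIV (\<lambda>_. lborel)) borel vec_lambda) (box l u) = ennreal (\<Prod>b\<in>Basis. (u - l) \<bullet> b)" .
qed simp

lemma sigma_finite_density_lborel:
  fixes p :: "real \<Rightarrow> real"
  assumes [measurable]: "p \<in> borel_measurable borel"
  shows "sigma_finite_measure (density lborel (\<lambda>s. ennreal (p s)))"
  by (subst sigma_finite_measure.sigma_finite_iff_density_finite) (auto intro: sigma_finite_lborel)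

text \<open>Measurable rectangles suffice, and there the integral factorizes over the coordinates.
  It is applied to normalized Gaussian weights for Efron--Stein and to bare power weights for
  Fubini.\<close>

lemma vec_product_density:
  fixes p :: "'n::finite \<Rightarrow> real \<Rightarrow> real"
  assumes [measurable]: "\<And>i. p i \<in> borel_measurable borel"
  shows "distr (PiM UNIV (\<lambda>i. density lborel (\<lambda>s. ennreal (p i s)))) borel vec_lambda
    = density lborel (\<lambda>x. \<Prod>i\<in>UNIV. ennreal (p i (x $ i)))"
proof -
  interpret L: product_sigma_finite "\<lambda>_::'n. lborel :: real measure" ..
  interpret D: product_sigma_finite "\<lambda>i::'n. density lborel (\<lambda>s. ennreal (p i s))"
    by (intro product_sigma_finite.intro sigma_finite_density_lborel) auto
  have "density (PiM UNIV (\<lambda>_. lborel)) (\<lambda>y. \<Prod>i\<in>UNIV. ennreal (p i (y i)))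
     = PiM UNIV (\<lambda>i. density lborel (\<lambda>s. ennreal (p i s)))"
  proof (rule D.PiM_eqI)
    show "sets (density (PiM UNIV (\<lambda>_. lborel)) (\<lambda>y. \<Prod>i\<in>UNIV. ennreal (p i (y i))))
       = sets (PiM UNIV (\<lambda>i. density lborel (\<lambda>s. ennreal (p i s))))"
      by (simp cong: sets_PiM_cong)
    fix A assume A: "\<And>i. i \<in> UNIV \<Longrightarrow> A i \<in> sets (density lborel (\<lambda>s. ennreal (p i s)))"
    then have [measurable]: "A i \<in> sets borel" for i by simp
    have "emeasure (density (PiM UNIV (\<lambda>_. lborel)) (\<lambda>y. \<Prod>i\<in>UNIV. ennreal (p i (y i)))) (PiE UNIV A)
       = (\<integral>\<^sup>+y. (\<Prod>i\<in>UNIV. ennreal (p i (y i))) * indicator (PiE UNIV A) y \<partial>PiM UNIV (\<lambda>_. lborel))"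
      by (subst emeasure_density) (auto intro!: sets_PiM_I_finite)
    also have "\<dots> = (\<integral>\<^sup>+y. (\<Prod>i\<in>UNIV. ennreal (p i (y i)) * indicator (A i) (y i)) \<partial>PiM UNIV (\<lambda>_. lborel))"
    proof (intro nn_integral_cong)
      fix y
      have "indicator (PiE UNIV A) y = (\<Prod>i\<in>UNIV. indicator (A i) (y i) :: ennreal)"
        by (auto simp: indicator_def PiE_def prod_zero_iff Pi_iff)
      then show "(\<Prod>i\<in>UNIV. ennreal (p i (y i))) * indicator (PiE UNIV A) y
         = (\<Prod>i\<in>UNIV. ennreal (p i (y i)) * indicator (A i) (y i))"
        by (simp add: prod.distrib)
    qed
    also have "\<dots> = (\<Prod>i\<in>UNIV. emeasure (density lborel (\<lambda>s. ennreal (p i s))) (A i))"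
      by (subst L.product_nn_integral_prod) (auto simp: emeasure_density)
    finally show "emeasure (density (PiM UNIV (\<lambda>_. lborel)) (\<lambda>y. \<Prod>i\<in>UNIV. ennreal (p i (y i)))) (PiE UNIV A)
       = (\<Prod>i\<in>UNIV. emeasure (density lborel (\<lambda>s. ennreal (p i s))) (A i))" .
  qed simp
  moreover have "density lborel (\<lambda>x. \<Prod>i\<in>UNIV. ennreal (p i (x $ i)))
     = distr (density (PiM UNIV (\<lambda>_. lborel)) (\<lambda>y. \<Prod>i\<in>UNIV. ennreal (p i (vec_lambda y $ i)))) borel vec_lambda"
  proof -
    have "(vec_lambda :: ('n \<Rightarrow> real) \<Rightarrow> real ^ 'n) \<in> PiM UNIV (\<lambda>_. lborel) \<rightarrow>\<^sub>M borel"
      by (rule vec_lambda_measurable') simp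
    then show ?thesis by (subst lborel_vec_eq, intro density_distr) measurable
  qed
  ultimately show ?thesis by simp
qed

lemma has_derivative_vec_upd:
  "((\<lambda>s. vec_lambda (y(i := s)) :: real ^ 'n::finite) has_derivative (\<lambda>h. h *\<^sub>R axis i 1)) (at s)"
proof -
  have "(\<lambda>s. vec_lambda (y(i := s)) :: real ^ 'n) = (\<lambda>s. vec_lambda (y(i := 0)) + s *\<^sub>R axis i 1)"
    by (auto simp: vec_eq_iff axis_def)
  then show ?thesis by (auto intro!: derivative_eq_intros)
qed

lemma pdx_fiber:
  fixes f :: "real ^ 'n::finite \<Rightarrow> real"
  assumes "f differentiable (at (vec_lambda (y(i := s))))"
  shows "((\<lambda>s. f (vec_lambda (y(i := s)))) has_real_derivative pdx i f (vec_lambda (y(i := s)))) (at s)"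
proof -
  let ?x = "vec_lambda (y(i := s))"
  have d: "(f has_derivative frechet_derivative f (at ?x)) (at ?x)"
    using assms frechet_derivative_works by blast
  have "((\<lambda>s. f (vec_lambda (y(i := s)))) has_derivative (\<lambda>h. frechet_derivative f (at ?x) (h *\<^sub>R axis i 1))) (at s)"
    using diff_chain_at[OF has_derivative_vec_upd d] unfolding o_def .
  moreover have "frechet_derivative f (at ?x) (h *\<^sub>R axis i 1) = pdx i f ?x * h" for h
    using linear_cmul[OF has_derivative_linear[OF d]] by (simp add: pdx_def)
  ultimately show ?thesis by (simp add: has_field_derivative_def)
qed

lemma continuous_vec_upd: "continuous_on UNIV (\<lambda>s. vec_lambda (y(i := s)) :: real ^ 'n::finite)"
  by (intro continuous_at_imp_continuous_on ballI has_derivative_continuous[OF has_derivative_vec_upd])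

section \<open>Finite and positive mass of the Gaussian power weights\<close>

lemma integrable_exp_neg_sq:
  assumes "0 < \<kappa>" shows "integrable lborel (\<lambda>s::real. exp (- \<kappa> * s\<^sup>2))"
proof -
  \<comment> \<open>Chosen so that the normal density with standard deviation
    \<open>\<sigma>\<close> has exponent \<open>- \<kappa> * s\<^sup>2\<close>.\<close>
  define \<sigma> where "\<sigma> = sqrt (1 / (2 * \<kappa>))"
  have \<sigma>: "0 < \<sigma>" "\<sigma>\<^sup>2 = 1 / (2 * \<kappa>)" using assms by (auto simp: \<sigma>_def)
  have "integrable lborel (\<lambda>s. sqrt (2 * pi * \<sigma>\<^sup>2) * normal_density 0 \<sigma> s)"
    using \<sigma> by (intro integrable_mult_right integrable_normal_density)
  also have "(\<lambda>s. sqrt (2 * pi * \<sigma>\<^sup>2) * normal_density 0 \<sigma> s) = (\<lambda>s. exp (- \<kappa> * s\<^sup>2))"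
    using assms unfolding normal_density_def \<sigma>(2) by (auto simp: fun_eq_iff field_simps)
  finally show ?thesis .
qed

text \<open>Half of the Gaussian decay absorbs the power: \<open>a * ln s\<close> is at most
  \<open>a * s\<close>, which Young's inequality bounds by
  \<open>a\<^sup>2 * t / 2 + s\<^sup>2 / (2 * t)\<close>.\<close>

lemma gauss_weight_le:
  assumes "0 \<le> a" "0 < t"
  shows "gauss_weight a t s \<le> exp (a\<^sup>2 * t / 2) * exp (- (1 / (2 * t)) * s\<^sup>2)"
proof (cases "s \<in> half_line a")
  case False then show ?thesis using assms by (simp add: gauss_weight_def power_weight_def)
next
  case True
  have "power_factor a s \<le> exp (a\<^sup>2 * t / 2 + s\<^sup>2 / (2 * t))"
  proof (cases "a = 0")
    case True then show ?thesis using assms by (simp add: power_factor_def)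
  next
    case False
    with \<open>s \<in> half_line a\<close> assms have s: "0 < s" by (simp add: half_line_def)
    have "a * ln s \<le> a * s" using ln_le_minus_one[OF s] assms by (intro mult_left_mono) auto
    also have "a * s \<le> a\<^sup>2 * t / 2 + s\<^sup>2 / (2 * t)"
    proof -
      have "0 \<le> (a * t - s)\<^sup>2 / (2 * t)" using assms by simp
      also have "\<dots> = a\<^sup>2 * t / 2 + s\<^sup>2 / (2 * t) - a * s"
        using assms by (simp add: field_simps power2_eq_square)
      finally show ?thesis by simp
    qed
    finally show ?thesis using False s by (simp add: power_factor_def powr_def)
  qed
  then have "power_factor a s * exp (- s\<^sup>2 / t) \<le> exp (a\<^sup>2 * t / 2 + s\<^sup>2 / (2 * t)) * exp (- s\<^sup>2 / t)"
    by (rule mult_right_mono) simp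
  also have "\<dots> = exp (a\<^sup>2 * t / 2) * exp (- (1 / (2 * t)) * s\<^sup>2)"
    using assms by (simp add: exp_add[symmetric] field_simps)
  finally show ?thesis using True by (simp add: gauss_weight_eq)
qed

lemma gauss_weight_integrable:
  assumes "0 \<le> a" "0 < t"
  shows "integrable lborel (gauss_weight a t)"
proof (rule Bochner_Integration.integrable_bound)
  show "integrable lborel (\<lambda>s. exp (a\<^sup>2 * t / 2) * exp (- (1 / (2 * t)) * s\<^sup>2))"
    using assms by (intro integrable_mult_right integrable_exp_neg_sq) simp
  show "AE s in lborel. norm (gauss_weight a t s) \<le> norm (exp (a\<^sup>2 * t / 2) * exp (- (1 / (2 * t)) * s\<^sup>2))"
    using gauss_weight_le[OF assms] gauss_weight_nonneg by simp
qed (use gauss_weight_measurable in measurable)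

lemma gauss_weight_integral_pos:
  assumes "0 \<le> a" "0 < t"
  shows "0 < (\<integral>s. gauss_weight a t s \<partial>lborel)"
proof -
  have "(\<integral>s. gauss_weight a t s \<partial>lborel) \<noteq> 0"
  proof
    assume "(\<integral>s. gauss_weight a t s \<partial>lborel) = 0"
    then have "AE s in lborel. gauss_weight a t s = 0"
      using integral_nonneg_eq_0_iff_AE[OF gauss_weight_integrable[OF assms]] gauss_weight_nonneg by simp
    \<comment> \<open>The interval \<open>{1..2}\<close> lies in \<open>half_line a\<close> for
      every \<open>a\<close>, and the weight is positive on it.\<close>
    then have "AE s in lborel. s \<notin> {1..2::real}"
      by eventually_elim (auto simp: gauss_weight_eq half_line_def power_factor_def split: if_splits)
    then have "emeasure lborel {1..2::real} = 0" by (subst (asm) AE_iff_measurable[of "{1..2}"]) auto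
    then show False by simp
  qed
  moreover have "0 \<le> (\<integral>s. gauss_weight a t s \<partial>lborel)" using gauss_weight_nonneg by simp
  ultimately show ?thesis by linarith
qed

text \<open>Putting domain and weight into the measure makes all later integrals run over the whole
  space and exposes their product structure. The Gaussian factor stays in the integrands because
  \<open>t\<close> varies.\<close>

definition muA :: "('n::finite \<Rightarrow> real) \<Rightarrow> (real ^ 'n) measure" where
  "muA \<alpha> = density lborel (\<lambda>x. ennreal (indicator (RNstar \<alpha>) x * wA \<alpha> x))"

lemma weight_prod:
  "indicator (RNstar \<alpha>) x * wA \<alpha> x = (\<Prod>i\<in>UNIV. power_weight (\<alpha> i) (x $ i))"
proof -
  have "indicator (RNstar \<alpha>) x = (\<Prod>i\<in>UNIV. indicator (half_line (\<alpha> i)) (x $ i) :: real)"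
    by (auto simp: indicator_def RNstar_def half_line_def prod_zero_iff)
  then show ?thesis by (simp add: wA_def power_weight_def power_factor_def prod.distrib)
qed

lemma sets_muA [simp, measurable_cong]: "sets (muA \<alpha>) = sets borel"
  by (simp add: muA_def)

lemma space_muA [simp]: "space (muA \<alpha>) = UNIV"
  by (simp add: muA_def)

lemma weight_measurable [measurable]: "(\<lambda>x. indicator (RNstar \<alpha>) x * wA \<alpha> x) \<in> borel_measurable borel"
  unfolding weight_prod by measurable

lemma muA_eq: "muA \<alpha> = density lborel (\<lambda>x. \<Prod>i\<in>UNIV. ennreal (power_weight (\<alpha> i) (x $ i)))"
  by (simp add: muA_def weight_prod prod_ennreal)

lemma norm_sq_vec: "(norm x)\<^sup>2 = (\<Sum>i\<in>UNIV. (x $ i)\<^sup>2)" for x :: "real ^ 'n::finite"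
  unfolding power2_norm_eq_inner inner_vec_def by (simp add: power2_eq_square)

lemma exp_norm_sq_prod: "exp (- (norm x)\<^sup>2 / t) = (\<Prod>i\<in>UNIV. exp (- (x $ i)\<^sup>2 / t))" for x :: "real ^ 'n::finite"
  by (simp add: norm_sq_vec exp_sum[symmetric] sum_divide_distrib sum_negf)

text \<open>The Gaussian times the monomial weight is a product of one-dimensional weights. After
  normalization, Efron--Stein reduces the claim to coordinate lines, with the same constant in each
  direction; \<open>c\<close> is the mean of \<open>f\<close> under the normalized measure.\<close>

theorem poincare_gauss:
  fixes f :: "real ^ 'n::finite \<Rightarrow> real"
  assumes \<alpha>: "\<And>i. 0 \<le> \<alpha> i" and t: "0 < t"
    and diff: "\<And>x. f differentiable (at x)" and bdd: "\<And>x. \<bar>f x\<bar> \<le> C"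
    and cont: "\<And>i. continuous_on UNIV (pdx i f)"
  shows "\<exists>c. (\<integral>\<^sup>+x. ennreal ((f x - c)\<^sup>2 * exp (- (norm x)\<^sup>2 / t)) \<partial>muA \<alpha>)
     \<le> ennreal (t / 2) * (\<Sum>i\<in>UNIV. \<integral>\<^sup>+x. ennreal ((pdx i f x)\<^sup>2 * exp (- (norm x)\<^sup>2 / t)) \<partial>muA \<alpha>)"
proof -
  have cf: "continuous_on UNIV f"
    by (intro continuous_at_imp_continuous_on ballI differentiable_imp_continuous_within diff)
  note [measurable] = borel_measurable_continuous_onI[OF cf] borel_measurable_continuous_onI[OF cont] gauss_weight_measurable
  define Z where "Z = (\<lambda>i. \<integral>s. gauss_weight (\<alpha> i) t s \<partial>lborel)"
  have Z: "0 < Z i" for i unfolding Z_def by (rule gauss_weight_integral_pos[OF \<alpha> t])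
  define p where "p = (\<lambda>i s. gauss_weight (\<alpha> i) t s / Z i)"
  have p0: "0 \<le> p i s" for i s using Z[of i] gauss_weight_nonneg by (simp add: p_def less_imp_le)
  have [measurable]: "p i \<in> borel_measurable borel" for i unfolding p_def by measurable
  define M where "M = (\<lambda>i. density lborel (\<lambda>s. ennreal (p i s)))"
  have [measurable_cong]: "sets (M i) = sets borel" for i by (simp add: M_def)
  have spM [simp]: "space (M i) = UNIV" for i by (simp add: M_def)
  have Mp: "prob_space (M i)" for i
  proof (rule prob_spaceI)
    have "(\<integral>\<^sup>+s. ennreal (p i s) \<partial>lborel) = ennreal (\<integral>s. p i s \<partial>lborel)"
      using gauss_weight_integrable[OF \<alpha> t] p0 by (intro nn_integral_eq_integral) (auto simp: p_def)
    also have "(\<integral>s. p i s \<partial>lborel) = 1" using Z[of i] by (simp add: p_def) (simp add: Z_def)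
    finally show "emeasure (M i) (space (M i)) = 1" by (simp add: M_def emeasure_density)
  qed
  define P where "P = distr (PiM UNIV M) borel (vec_lambda :: ('n \<Rightarrow> real) \<Rightarrow> real ^ 'n)"
  have vm [measurable]: "(vec_lambda :: ('n \<Rightarrow> real) \<Rightarrow> real ^ 'n) \<in> PiM UNIV M \<rightarrow>\<^sub>M borel"
    by (rule vec_lambda_measurable') (simp add: M_def)
  interpret PM: prob_space "PiM UNIV M" by (intro prob_space_PiM Mp)
  interpret P: prob_space P unfolding P_def by (rule PM.prob_space_distr) measurable
  define ZZ where "ZZ = (\<Prod>i\<in>UNIV. Z i)"
  have ZZ: "0 < ZZ" unfolding ZZ_def by (intro prod_pos ballI Z)
  \<comment> \<open>Translates between the probability measure \<open>P\<close> and
    \<open>muA\<close>; the two differ by the Gaussian and the total mass \<open>ZZ\<close>.\<close>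
  have Pint: "(\<integral>\<^sup>+x. ennreal (g x) \<partial>P) = ennreal (1 / ZZ) * (\<integral>\<^sup>+x. ennreal (g x * exp (- (norm x)\<^sup>2 / t)) \<partial>muA \<alpha>)"
    if [measurable]: "g \<in> borel_measurable borel" and g0: "\<And>x. 0 \<le> g x" for g
  proof -
    have "P = density lborel (\<lambda>x. \<Prod>i\<in>UNIV. ennreal (p i (x $ i)))"
      unfolding P_def M_def by (rule vec_product_density) measurable
    then have "(\<integral>\<^sup>+x. ennreal (g x) \<partial>P) = (\<integral>\<^sup>+x. (\<Prod>i\<in>UNIV. ennreal (p i (x $ i))) * ennreal (g x) \<partial>lborel)"
      by (simp add: nn_integral_density)
    also have "\<dots> = (\<integral>\<^sup>+x. ennreal (1 / ZZ) * (ennreal (indicator (RNstar \<alpha>) x * wA \<alpha> x) * ennreal (g x * exp (- (norm x)\<^sup>2 / t))) \<partial>lborel)"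
    proof (intro nn_integral_cong)
      fix x :: "real ^ 'n"
      have "(\<Prod>i\<in>UNIV. p i (x $ i)) = (1 / ZZ) * (indicator (RNstar \<alpha>) x * wA \<alpha> x * exp (- (norm x)\<^sup>2 / t))"
        unfolding weight_prod exp_norm_sq_prod by (simp add: p_def gauss_weight_def prod.distrib prod_dividef ZZ_def)
      then have "(\<Prod>i\<in>UNIV. p i (x $ i)) * g x = (1 / ZZ) * ((indicator (RNstar \<alpha>) x * wA \<alpha> x) * (g x * exp (- (norm x)\<^sup>2 / t)))"
        by simp
      moreover have "0 \<le> indicator (RNstar \<alpha>) x * wA \<alpha> x" unfolding weight_prod by (simp add: prod_nonneg)
      ultimately show "(\<Prod>i\<in>UNIV. ennreal (p i (x $ i))) * ennreal (g x) =
          ennreal (1 / ZZ) * (ennreal (indicator (RNstar \<alpha>) x * wA \<alpha> x) * ennreal (g x * exp (- (norm x)\<^sup>2 / t)))"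
        using ZZ g0[of x] by (simp add: prod_ennreal p0 ennreal_mult[symmetric] prod_nonneg)
    qed
    also have "\<dots> = ennreal (1 / ZZ) * (\<integral>\<^sup>+x. ennreal (g x * exp (- (norm x)\<^sup>2 / t)) \<partial>muA \<alpha>)"
      by (simp add: nn_integral_cmult muA_def nn_integral_density)
    finally show ?thesis .
  qed
  define h where "h = (\<lambda>y. f (vec_lambda y))"
  define d where "d = (\<lambda>i y. ennreal (t / 2) * ennreal ((pdx i f (vec_lambda y))\<^sup>2))"
  have hm [measurable]: "h \<in> borel_measurable (PiM UNIV M)" unfolding h_def by measurable
  have hb: "\<bar>h y\<bar> \<le> C" for y unfolding h_def by (rule bdd)
  have vh: "ennreal (var (PiM UNIV M) h) \<le> (\<Sum>i\<in>UNIV. \<integral>\<^sup>+y. d i y \<partial>PiM UNIV M)"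
  proof (rule efron_stein)
    show "d i \<in> borel_measurable (PiM UNIV M)" for i unfolding d_def by measurable
    fix i and y :: "'n \<Rightarrow> real"
    define k where "k = (\<lambda>s. f (vec_lambda (y(i := s))))"
    define k' where "k' = (\<lambda>s. pdx i f (vec_lambda (y(i := s))))"
    have kd: "(k has_real_derivative k' s) (at s)" for s
      unfolding k_def k'_def by (rule pdx_fiber) (rule diff)
    have kc: "continuous_on UNIV k'"
      unfolding k'_def by (rule continuous_on_compose2[OF cont continuous_vec_upd]) simp
    have "continuous_on UNIV k"
      using DERIV_isCont[OF kd] by (simp add: continuous_on_eq_continuous_at)
    then have [measurable]: "k \<in> borel_measurable borel" "k' \<in> borel_measurable borel"
      using kc by (auto intro: borel_measurable_continuous_onI)
    interpret Mi: prob_space "M i" by (rule Mp)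
    let ?m = "mode (\<alpha> i) t"
    have kb: "\<bar>k s\<bar> \<le> C" for s unfolding k_def by (rule bdd)
    have kmb: "\<bar>k s - k ?m\<bar> \<le> 2 * C" for s using kb[of s] kb[of ?m] by linarith
    \<comment> \<open>The mean minimizes the mean square deviation, so the variance is at most the
      deviation from the value at the mode.\<close>
    have "ennreal (var (M i) k) \<le> ennreal (\<integral>s. (k s - k ?m)\<^sup>2 \<partial>M i)"
      by (intro ennreal_leI Mi.var_le[OF _ kb]) measurable
    also have "\<dots> = (\<integral>\<^sup>+s. ennreal ((k s - k ?m)\<^sup>2) \<partial>M i)"
      by (intro nn_integral_eq_integral[symmetric] Mi.integrable_bdd[OF _ square_bdd[OF kmb]]) auto
    also have "\<dots> = (\<integral>\<^sup>+s. ennreal (1 / Z i) * (ennreal ((k s - k ?m)\<^sup>2) * ennreal (gauss_weight (\<alpha> i) t s)) \<partial>lborel)"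
      unfolding M_def using Z[of i] gauss_weight_nonneg
      by (subst nn_integral_density) (auto simp: p_def ennreal_mult[symmetric] mult_ac intro!: nn_integral_cong)
    also have "\<dots> = ennreal (1 / Z i) * (\<integral>\<^sup>+s. ennreal ((k s - k ?m)\<^sup>2) * ennreal (gauss_weight (\<alpha> i) t s) \<partial>lborel)"
      by (intro nn_integral_cmult) measurable
    also have "\<dots> \<le> ennreal (1 / Z i) * (ennreal (t / 2) * (\<integral>\<^sup>+s. ennreal ((k' s)\<^sup>2) * ennreal (gauss_weight (\<alpha> i) t s) \<partial>lborel))"
      by (intro mult_left_mono poincare_1d[OF \<alpha> t kd kc]) simp
    also have "\<dots> = (\<integral>\<^sup>+s. ennreal (1 / Z i) * (ennreal (t / 2) * (ennreal ((k' s)\<^sup>2) * ennreal (gauss_weight (\<alpha> i) t s))) \<partial>lborel)"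
      by (simp add: nn_integral_cmult)
    also have "\<dots> = (\<integral>\<^sup>+s. ennreal (t / 2) * ennreal ((k' s)\<^sup>2) \<partial>M i)"
      unfolding M_def using Z[of i] gauss_weight_nonneg t
      by (subst nn_integral_density) (auto simp: p_def ennreal_mult[symmetric] mult_ac intro!: nn_integral_cong)
    finally show "ennreal (var (M i) (\<lambda>s. h (y(i := s)))) \<le> (\<integral>\<^sup>+s. d i (y(i := s)) \<partial>M i)"
      unfolding h_def d_def k_def k'_def .
  qed (use Mp hb in auto)
  define c where "c = (\<integral>y. h y \<partial>PiM UNIV M)"
  have hcb: "\<bar>h y - c\<bar> \<le> 2 * C" for y
    using hb[of y] PM.abs_integral_le[of h C] hb unfolding c_def by (smt (verit))
  have "(\<integral>\<^sup>+x. ennreal ((f x - c)\<^sup>2) \<partial>P) = (\<integral>\<^sup>+y. ennreal ((h y - c)\<^sup>2) \<partial>PiM UNIV M)"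
    unfolding P_def h_def by (subst nn_integral_distr) auto
  also have "\<dots> = ennreal (\<integral>y. (h y - c)\<^sup>2 \<partial>PiM UNIV M)"
    by (intro nn_integral_eq_integral PM.integrable_bdd[OF _ square_bdd[OF hcb]]) auto
  also have "\<dots> = ennreal (var (PiM UNIV M) h)"
    using PM.var_shift[OF hm hb, of c] by (simp add: c_def)
  also have "\<dots> \<le> (\<Sum>i\<in>UNIV. \<integral>\<^sup>+y. d i y \<partial>PiM UNIV M)" by (rule vh)
  also have "\<dots> = ennreal (t / 2) * (\<Sum>i\<in>UNIV. \<integral>\<^sup>+x. ennreal ((pdx i f x)\<^sup>2) \<partial>P)"
    unfolding d_def P_def by (subst nn_integral_distr) (auto simp: nn_integral_cmult sum_distrib_left)
  finally have "ennreal (1 / ZZ) * (\<integral>\<^sup>+x. ennreal ((f x - c)\<^sup>2 * exp (- (norm x)\<^sup>2 / t)) \<partial>muA \<alpha>)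
    \<le> ennreal (1 / ZZ) * (ennreal (t / 2) * (\<Sum>i\<in>UNIV. \<integral>\<^sup>+x. ennreal ((pdx i f x)\<^sup>2 * exp (- (norm x)\<^sup>2 / t)) \<partial>muA \<alpha>))"
    by (simp add: Pint sum_distrib_left mult.left_commute)
  \<comment> \<open>Both sides are linear in the measure, so the normalization cancels.\<close>
  then have "ennreal ZZ * (ennreal (1 / ZZ) * (\<integral>\<^sup>+x. ennreal ((f x - c)\<^sup>2 * exp (- (norm x)\<^sup>2 / t)) \<partial>muA \<alpha>))
    \<le> ennreal ZZ * (ennreal (1 / ZZ) * (ennreal (t / 2) * (\<Sum>i\<in>UNIV. \<integral>\<^sup>+x. ennreal ((pdx i f x)\<^sup>2 * exp (- (norm x)\<^sup>2 / t)) \<partial>muA \<alpha>)))"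
    by (rule mult_left_mono) simp
  then show ?thesis
    using ZZ by (intro exI[of _ c]) (simp add: mult.assoc[symmetric] ennreal_mult[symmetric])
qed

section \<open>Integration by parts\<close>

lemma muA_vec:
  "muA \<alpha> = distr (PiM UNIV (\<lambda>i. density lborel (\<lambda>s. ennreal (power_weight (\<alpha> i) s)))) borel vec_lambda"
  unfolding muA_eq by (rule vec_product_density[symmetric]) measurable

lemma wA_nonneg: "0 \<le> wA \<alpha> x"
  by (auto simp: wA_def intro: prod_nonneg)

lemma RNstar_measurable [measurable]: "RNstar \<alpha> \<in> sets borel"
proof -
  have "RNstar \<alpha> = {x \<in> space borel. \<forall>i. 0 < \<alpha> i \<longrightarrow> 0 < x $ i}" by (simp add: RNstar_def)
  then show ?thesis by simp
qed

lemma wA_measurable [measurable]: "wA \<alpha> \<in> borel_measurable borel"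
proof -
  have "wA \<alpha> = (\<lambda>x. \<Prod>i\<in>UNIV. power_factor (\<alpha> i) (x $ i))" by (simp add: wA_def power_factor_def fun_eq_iff)
  then show ?thesis by simp
qed

lemma nn_integral_muA:
  assumes [measurable]: "F \<in> borel_measurable borel" and "\<And>x. 0 \<le> F x"
  shows "(\<integral>\<^sup>+x\<in>RNstar \<alpha>. ennreal (F x * wA \<alpha> x) \<partial>lborel) = (\<integral>\<^sup>+x. ennreal (F x) \<partial>muA \<alpha>)"
proof -
  have "ennreal (F x * wA \<alpha> x) * indicator (RNstar \<alpha>) x
      = ennreal (indicator (RNstar \<alpha>) x * wA \<alpha> x) * ennreal (F x)" for x
    using assms(2)[of x] wA_nonneg[of \<alpha> x] by (simp add: ennreal_mult[symmetric] mult.commute split: split_indicator)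
  then show ?thesis unfolding muA_def by (simp add: nn_integral_density)
qed

lemma set_integral_muA:
  fixes F :: "real ^ 'n::finite \<Rightarrow> real"
  assumes [measurable]: "F \<in> borel_measurable borel"
  shows "(LINT x:RNstar \<alpha>|lborel. F x * wA \<alpha> x) = (\<integral>x. F x \<partial>muA \<alpha>)"
  unfolding muA_def set_lebesgue_integral_def using wA_nonneg[of \<alpha>]
  by (subst integral_density) (auto simp: mult_ac intro!: Bochner_Integration.integral_cong)

lemma AE_muA: "(AE x in lborel. P x) \<Longrightarrow> AE x in muA \<alpha>. P x"
  unfolding muA_def by (subst AE_density) auto

lemma integrable_gauss:
  fixes \<alpha> :: "'n::finite \<Rightarrow> real"
  assumes \<alpha>: "\<And>i. 0 \<le> \<alpha> i" and \<kappa>: "0 < \<kappa>"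
  shows "integrable (muA \<alpha>) (\<lambda>x. exp (- \<kappa> * (norm x)\<^sup>2))"
proof -
  interpret L: product_sigma_finite "\<lambda>_::'n. lborel :: real measure" ..
  define t where "t = 1 / \<kappa>"
  have t: "0 < t" using \<kappa> by (simp add: t_def)
  note [measurable] = gauss_weight_measurable
  have vl: "(vec_lambda :: ('n \<Rightarrow> real) \<Rightarrow> real ^ 'n) \<in> PiM UNIV (\<lambda>_. lborel) \<rightarrow>\<^sub>M borel"
    by (rule vec_lambda_measurable') simp
  have "integrable (PiM UNIV (\<lambda>_::'n. lborel)) (\<lambda>y. \<Prod>i\<in>UNIV. gauss_weight (\<alpha> i) t (y i))"
    by (intro L.product_integrable_prod gauss_weight_integrable \<alpha> t) auto
  then have "integrable lborel (\<lambda>x :: real ^ 'n. \<Prod>i\<in>UNIV. gauss_weight (\<alpha> i) t (x $ i))"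
    by (subst lborel_vec_eq, subst integrable_distr_eq[OF vl]) auto
  also have "(\<lambda>x :: real ^ 'n. \<Prod>i\<in>UNIV. gauss_weight (\<alpha> i) t (x $ i)) =
      (\<lambda>x. (indicator (RNstar \<alpha>) x * wA \<alpha> x) *\<^sub>R exp (- \<kappa> * (norm x)\<^sup>2))"
  proof
    fix x :: "real ^ 'n"
    have "exp (- \<kappa> * (norm x)\<^sup>2) = exp (- (norm x)\<^sup>2 / t)" by (simp add: t_def mult.commute)
    then show "(\<Prod>i\<in>UNIV. gauss_weight (\<alpha> i) t (x $ i)) = (indicator (RNstar \<alpha>) x * wA \<alpha> x) *\<^sub>R exp (- \<kappa> * (norm x)\<^sup>2)"
      unfolding weight_prod exp_norm_sq_prod by (simp add: gauss_weight_def prod.distrib)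
  qed
  finally show ?thesis
    unfolding muA_def by (subst integrable_density) (auto simp: wA_nonneg)
qed

lemma integrable_gauss_bound:
  fixes F :: "real ^ 'n::finite \<Rightarrow> real"
  assumes \<alpha>: "\<And>i. 0 \<le> \<alpha> i" and \<kappa>: "0 < \<kappa>"
    and F: "F \<in> borel_measurable borel" and b: "\<And>x. \<bar>F x\<bar> \<le> C * exp (- \<kappa> * (norm x)\<^sup>2)"
  shows "integrable (muA \<alpha>) F"
proof (rule Bochner_Integration.integrable_bound)
  show "integrable (muA \<alpha>) (\<lambda>x. C * exp (- \<kappa> * (norm x)\<^sup>2))"
    by (intro integrable_mult_right integrable_gauss \<alpha> \<kappa>)
  show "F \<in> borel_measurable (muA \<alpha>)" using F by simp
  show "AE x in muA \<alpha>. norm (F x) \<le> norm (C * exp (- \<kappa> * (norm x)\<^sup>2))"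
    using b by (intro AE_I2) (metis abs_ge_self order_trans real_norm_def)
qed

text \<open>Times the weight, the integrand is the derivative of
  \<open>s * power_factor a s * k s\<close>. The extra \<open>s\<close> cancels the singular
  \<open>a / s\<close> and kills the boundary term at \<open>0\<close> when \<open>a > 0\<close>;
  Gaussian decay kills those at infinity.\<close>

lemma integration_by_parts_1d:
  fixes k k' :: "real \<Rightarrow> real"
  assumes a: "0 \<le> a" and \<kappa>: "0 < \<kappa>"
    and d: "\<And>s. (k has_real_derivative k' s) (at s)" and c: "continuous_on UNIV k'"
    and b: "\<And>s. \<bar>k s\<bar> \<le> C * exp (- \<kappa> * s\<^sup>2)" and b': "\<And>s. \<bar>s * k' s\<bar> \<le> C * exp (- \<kappa> * s\<^sup>2)"
  shows "(\<integral>s. s * k' s + (1 + a) * k s \<partial>density lborel (\<lambda>s. ennreal (power_weight a s))) = 0"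
proof -
  define l :: ereal where "l = (if a = 0 then -\<infinity> else 0)"
  have hl: "half_line a = einterval l \<infinity>"
    using a by (auto simp: half_line_def l_def einterval_def)
  define F where "F = (\<lambda>s. s * power_factor a s * k s)"
  define f where "f = (\<lambda>s. power_factor a s * (s * k' s + (1 + a) * k s))"
  have ck: "continuous_on UNIV k"
    using DERIV_isCont[OF d] by (simp add: continuous_on_eq_continuous_at)
  note [measurable] = borel_measurable_continuous_onI[OF ck] borel_measurable_continuous_onI[OF c]
  have dF: "(F has_real_derivative f s) (at s)" if "s \<in> half_line a" for s
  proof -
    have "(F has_real_derivative (1 * power_factor a s + a / s * power_factor a s * s) * k s + k' s * (s * power_factor a s)) (at s)"
      unfolding F_def by (intro DERIV_mult DERIV_ident d power_factor_deriv[OF a that])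
    also have "(1 * power_factor a s + a / s * power_factor a s * s) * k s + k' s * (s * power_factor a s) = f s"
    proof (cases "s = 0")
      case True
      \<comment> \<open>For \<open>a > 0\<close> the origin is outside the half line, so the
        quotient \<open>a / s\<close> at \<open>s = 0\<close> only occurs with numerator
        \<open>0\<close>.\<close>
      then have "a = 0" using that a by (auto simp: half_line_def)
      then show ?thesis using True by (simp add: f_def)
    next
      case False then show ?thesis by (simp add: f_def algebra_simps)
    qed
    finally show ?thesis .
  qed
  have int: "integrable lborel (\<lambda>s. power_weight a s * (s * k' s + (1 + a) * k s))"
  proof (rule Bochner_Integration.integrable_bound)
    show "integrable lborel (\<lambda>s. (C + (1 + a) * C) * gauss_weight a (1 / \<kappa>) s)"
      using a \<kappa> by (intro integrable_mult_right gauss_weight_integrable) auto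
    show "AE s in lborel. norm (power_weight a s * (s * k' s + (1 + a) * k s)) \<le> norm ((C + (1 + a) * C) * gauss_weight a (1 / \<kappa>) s)"
    proof (intro AE_I2)
      fix s
      have "\<bar>s * k' s + (1 + a) * k s\<bar> \<le> \<bar>s * k' s\<bar> + (1 + a) * \<bar>k s\<bar>"
        using a abs_triangle_ineq[of "s * k' s" "(1 + a) * k s"] by (simp add: abs_mult)
      also have "\<dots> \<le> C * exp (- \<kappa> * s\<^sup>2) + (1 + a) * (C * exp (- \<kappa> * s\<^sup>2))"
        using a by (intro add_mono mult_left_mono b b') auto
      finally have "power_weight a s * \<bar>s * k' s + (1 + a) * k s\<bar> \<le> power_weight a s * (C * exp (- \<kappa> * s\<^sup>2) + (1 + a) * (C * exp (- \<kappa> * s\<^sup>2)))"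
        by (rule mult_left_mono) simp
      also have "\<dots> = (C + (1 + a) * C) * gauss_weight a (1 / \<kappa>) s"
        using a \<kappa> by (simp add: gauss_weight_def algebra_simps)
      finally have "\<bar>power_weight a s * (s * k' s + (1 + a) * k s)\<bar> \<le> (C + (1 + a) * C) * gauss_weight a (1 / \<kappa>) s"
        by (simp add: abs_mult)
      from order_trans[OF this abs_ge_self]
      show "norm (power_weight a s * (s * k' s + (1 + a) * k s)) \<le> norm ((C + (1 + a) * C) * gauss_weight a (1 / \<kappa>) s)"
        unfolding real_norm_def .
    qed
  qed measurable
  have mwf: "power_weight a s * (s * k' s + (1 + a) * k s) = indicator (half_line a) s *\<^sub>R f s" for s
    by (simp add: power_weight_def f_def)
  have Fb: "\<bar>F s\<bar> \<le> \<bar>s\<bar> * power_factor a s * (C * exp (- \<kappa> * s\<^sup>2))" for s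
    unfolding F_def abs_mult using b[of s] by (intro mult_mono) auto
  have Ftop: "(F \<longlongrightarrow> 0) at_top"
  proof (rule Lim_null_comparison)
    show "\<forall>\<^sub>F s in at_top. norm (F s) \<le> s * power_factor a s * (C * exp (- \<kappa> * s\<^sup>2))"
      using eventually_ge_at_top[of 0]
    proof eventually_elim
      case (elim s) then show ?case using Fb[of s] by simp
    qed
    have "((\<lambda>s. s * s powr a * (C * exp (- \<kappa> * s\<^sup>2))) \<longlongrightarrow> 0) at_top" using \<kappa> by real_asymp
    moreover have "((\<lambda>s. s * 1 * (C * exp (- \<kappa> * s\<^sup>2))) \<longlongrightarrow> 0) at_top" using \<kappa> by real_asymp
    ultimately show "((\<lambda>s. s * power_factor a s * (C * exp (- \<kappa> * s\<^sup>2))) \<longlongrightarrow> 0) at_top"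
      unfolding power_factor_def by (cases "a = 0") auto
  qed
  have "(LBINT s=l..\<infinity>. f s) = 0 - 0"
  proof (rule interval_integral_FTC_integrable)
    show "l < \<infinity>" by (simp add: l_def)
    show "(F has_vector_derivative f s) (at s)" if "l < ereal s" "ereal s < \<infinity>" for s
      using dF[of s] that hl by (auto simp: einterval_def has_real_derivative_iff_has_vector_derivative)
    show "isCont f s" if "l < ereal s" "ereal s < \<infinity>" for s
    proof -
      have "s \<in> half_line a" using that hl by (auto simp: einterval_def)
      then have "isCont (power_factor a) s" using power_factor_deriv[OF a] DERIV_isCont by blast
      then show ?thesis unfolding f_def
        using ck c by (intro continuous_intros) (auto simp: continuous_on_eq_continuous_at)
    qed
    show "set_integrable lborel (einterval l \<infinity>) f"
      using int unfolding set_integrable_def hl[symmetric] mwf .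
    show "((F \<circ> real_of_ereal) \<longlongrightarrow> 0) (at_left \<infinity>)"
      using Ftop by (simp add: ereal_tendsto_simps)
    show "((F \<circ> real_of_ereal) \<longlongrightarrow> 0) (at_right l)"
    proof (cases "a = 0")
      case True
      have "(F \<longlongrightarrow> 0) at_bot"
      proof (rule Lim_null_comparison)
        show "\<forall>\<^sub>F s in at_bot. norm (F s) \<le> - s * (C * exp (- \<kappa> * s\<^sup>2))"
          using eventually_le_at_bot[of 0]
        proof eventually_elim
          case (elim s) then show ?case using Fb[of s] True by (simp add: power_factor_def)
        qed
        show "((\<lambda>s. - s * (C * exp (- \<kappa> * s\<^sup>2))) \<longlongrightarrow> 0) at_bot" using \<kappa> by real_asymp
      qed
      then show ?thesis using True by (simp add: l_def ereal_tendsto_simps)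
    next
      case False
      have "((\<lambda>s. s * s powr a * k s) \<longlongrightarrow> 0 * 0 powr a * k 0) (at_right 0)"
      proof (intro tendsto_mult)
        show "((\<lambda>s. s powr a) \<longlongrightarrow> 0 powr a) (at_right 0)" using False a by real_asymp
        show "(k \<longlongrightarrow> k 0) (at_right 0)"
          using ck by (auto simp: continuous_on_def intro: tendsto_within_subset)
      qed (rule tendsto_ident_at)
      then have "(F \<longlongrightarrow> 0) (at_right 0)" using False by (simp add: F_def power_factor_def)
      then show ?thesis using False by (simp add: l_def zero_ereal_def ereal_tendsto_simps)
    qed
  qed
  then have "(\<integral>s. indicator (half_line a) s *\<^sub>R f s \<partial>lborel) = 0"
    by (simp add: interval_lebesgue_integral_def set_lebesgue_integral_def hl l_def)
  then have "(\<integral>s. power_weight a s * (s * k' s + (1 + a) * k s) \<partial>lborel) = 0" unfolding mwf .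
  then show ?thesis by (subst integral_density) auto
qed

text \<open>Fubini in coordinate \<open>i\<close>. It carries both integration by parts and, later,
  an oddness argument from a line to the whole space.\<close>

lemma integral_muA_fiber_zero:
  fixes H :: "real ^ 'n::finite \<Rightarrow> real"
  assumes iH: "integrable (muA \<alpha>) H"
    and zero: "\<And>y. (\<integral>s. H (vec_lambda (y(i := s))) \<partial>density lborel (\<lambda>s. ennreal (power_weight (\<alpha> i) s))) = 0"
  shows "(\<integral>x. H x \<partial>muA \<alpha>) = 0"
proof -
  define W where "W = (\<lambda>i. density lborel (\<lambda>s. ennreal (power_weight (\<alpha> i) s)))"
  interpret product_sigma_finite W
    unfolding W_def by (intro product_sigma_finite.intro sigma_finite_density_lborel) auto
  have vl: "(vec_lambda :: ('n \<Rightarrow> real) \<Rightarrow> real ^ 'n) \<in> PiM UNIV W \<rightarrow>\<^sub>M borel"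
    by (rule vec_lambda_measurable') (simp add: W_def)
  have [measurable]: "H \<in> borel_measurable borel" using iH by auto
  have iH': "integrable (PiM (insert i (UNIV - {i})) W) (\<lambda>y. H (vec_lambda y))"
    using iH unfolding muA_vec W_def[symmetric] by (simp add: integrable_distr_eq[OF vl] insert_absorb)
  have "(\<integral>x. H x \<partial>muA \<alpha>) = (\<integral>y. H (vec_lambda y) \<partial>PiM (insert i (UNIV - {i})) W)"
    unfolding muA_vec W_def[symmetric] by (simp add: integral_distr[OF vl] insert_absorb)
  also have "\<dots> = (\<integral>y. (\<integral>s. H (vec_lambda (y(i := s))) \<partial>W i) \<partial>PiM (UNIV - {i}) W)"
    by (rule product_integral_insert[OF _ _ iH']) auto
  also have "\<dots> = 0" unfolding W_def zero by simp
  finally show ?thesis .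
qed

text \<open>Gaussian bounds in \<open>x\<close> restrict to coordinate lines with the same constants
  because a component is at most the norm. Summed over \<open>i\<close>, the factors
  \<open>1 + \<alpha> i\<close> give the dimension \<open>D\<close>.\<close>

theorem integration_by_parts:
  fixes h :: "real ^ 'n::finite \<Rightarrow> real"
  assumes \<alpha>: "\<And>i. 0 \<le> \<alpha> i" and \<kappa>: "0 < \<kappa>"
    and diff: "\<And>x. h differentiable (at x)" and c: "continuous_on UNIV (pdx i h)"
    and b: "\<And>x. \<bar>h x\<bar> \<le> C * exp (- \<kappa> * (norm x)\<^sup>2)" and b': "\<And>x. \<bar>x $ i * pdx i h x\<bar> \<le> C * exp (- \<kappa> * (norm x)\<^sup>2)"
  shows "integrable (muA \<alpha>) h" "integrable (muA \<alpha>) (\<lambda>x. x $ i * pdx i h x)"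
    and "(\<integral>x. x $ i * pdx i h x \<partial>muA \<alpha>) = - (1 + \<alpha> i) * (\<integral>x. h x \<partial>muA \<alpha>)"
proof -
  have ch: "continuous_on UNIV h"
    by (intro continuous_at_imp_continuous_on ballI differentiable_imp_continuous_within diff)
  note [measurable] = borel_measurable_continuous_onI[OF ch] borel_measurable_continuous_onI[OF c]
  show i1: "integrable (muA \<alpha>) h" by (rule integrable_gauss_bound[OF \<alpha> \<kappa> _ b]) measurable
  show i2: "integrable (muA \<alpha>) (\<lambda>x. x $ i * pdx i h x)" by (rule integrable_gauss_bound[OF \<alpha> \<kappa> _ b']) measurable
  define H where "H = (\<lambda>x. x $ i * pdx i h x + (1 + \<alpha> i) * h x)"
  have iH: "integrable (muA \<alpha>) H" unfolding H_def using i1 i2 by simp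
  have "(\<integral>x. H x \<partial>muA \<alpha>) = 0"
  proof (rule integral_muA_fiber_zero[OF iH, of i])
    fix y :: "'n \<Rightarrow> real"
    have C: "0 \<le> C" using b[of 0] by simp
    have le: "exp (- \<kappa> * (norm (vec_lambda (y(i := s)) :: real ^ 'n))\<^sup>2) \<le> exp (- \<kappa> * s\<^sup>2)" for s
    proof -
      have "\<bar>(vec_lambda (y(i := s)) :: real ^ 'n) $ i\<bar> \<le> norm (vec_lambda (y(i := s)) :: real ^ 'n)"
        by (rule component_le_norm_cart)
      then have "s\<^sup>2 \<le> (norm (vec_lambda (y(i := s)) :: real ^ 'n))\<^sup>2"
        by (simp add: power2_le_iff_abs_le)
      then show ?thesis using \<kappa> by simp
    qed
    have "(\<integral>s. s * pdx i h (vec_lambda (y(i := s))) + (1 + \<alpha> i) * h (vec_lambda (y(i := s))) \<partial>density lborel (\<lambda>s. ennreal (power_weight (\<alpha> i) s))) = 0"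
    proof (rule integration_by_parts_1d[OF \<alpha> \<kappa>, where C = C])
      show "((\<lambda>s. h (vec_lambda (y(i := s)))) has_real_derivative pdx i h (vec_lambda (y(i := s)))) (at s)" for s
        by (rule pdx_fiber) (rule diff)
      show "continuous_on UNIV (\<lambda>s. pdx i h (vec_lambda (y(i := s))))"
        by (rule continuous_on_compose2[OF c continuous_vec_upd]) simp
      show "\<bar>h (vec_lambda (y(i := s)))\<bar> \<le> C * exp (- \<kappa> * s\<^sup>2)" for s
        using b[of "vec_lambda (y(i := s))"] mult_left_mono[OF le C] by (rule order_trans)
      show "\<bar>s * pdx i h (vec_lambda (y(i := s)))\<bar> \<le> C * exp (- \<kappa> * s\<^sup>2)" for s
        using order_trans[OF b'[of "vec_lambda (y(i := s))"] mult_left_mono[OF le C]] by simp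
    qed
    then show "(\<integral>s. H (vec_lambda (y(i := s))) \<partial>density lborel (\<lambda>s. ennreal (power_weight (\<alpha> i) s))) = 0"
      by (simp add: H_def)
  qed
  then have "(\<integral>x. x $ i * pdx i h x \<partial>muA \<alpha>) + (1 + \<alpha> i) * (\<integral>x. h x \<partial>muA \<alpha>) = 0"
    unfolding H_def using i1 i2 by simp
  then show "(\<integral>x. x $ i * pdx i h x \<partial>muA \<alpha>) = - (1 + \<alpha> i) * (\<integral>x. h x \<partial>muA \<alpha>)"
    by (simp only: mult_minus_left eq_neg_iff_add_eq_0)
qed

section \<open>The inequality for smooth functions of compact support\<close>

lemma smooth_fun_foldr: "smooth_fun f \<Longrightarrow> foldr pdx is f differentiable (at x)"
  by (simp add: smooth_fun_def)

lemma smooth_fun_differentiable: "smooth_fun f \<Longrightarrow> f differentiable (at x)"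
  using smooth_fun_foldr[of f "[]"] by simp

lemma smooth_fun_pdx: "smooth_fun f \<Longrightarrow> smooth_fun (pdx i f)"
  unfolding smooth_fun_def[of "pdx i f"] using smooth_fun_foldr[of f "is @ [i]" for "is"] by simp

lemma differentiable_continuous_on:
  "(\<And>x. f differentiable (at x)) \<Longrightarrow> continuous_on UNIV f" for f :: "real ^ 'n::finite \<Rightarrow> real"
  by (intro continuous_at_imp_continuous_on ballI differentiable_imp_continuous_within)

lemma smooth_fun_continuous: "smooth_fun f \<Longrightarrow> continuous_on UNIV f"
  by (intro differentiable_continuous_on smooth_fun_differentiable)

lemma pdx_eqI: "(f has_derivative f') (at x) \<Longrightarrow> pdx i f x = f' (axis i 1)"
  by (simp add: pdx_def frechet_derivative_at[symmetric])

lemma pdx_mult: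
  assumes "f differentiable (at x)" "g differentiable (at x)"
  shows "pdx i (\<lambda>x. f x * g x) x = f x * pdx i g x + pdx i f x * g x"
proof -
  have "((\<lambda>x. f x * g x) has_derivative (\<lambda>h. f x * frechet_derivative g (at x) h + frechet_derivative f (at x) h * g x)) (at x)"
    using assms by (intro has_derivative_mult) (auto simp: frechet_derivative_works)
  from pdx_eqI[OF this] show ?thesis by (simp add: pdx_def)
qed

lemma pdx_diff:
  assumes "f differentiable (at x)" "g differentiable (at x)"
  shows "pdx i (\<lambda>x. f x - g x) x = pdx i f x - pdx i g x"
proof -
  have "((\<lambda>x. f x - g x) has_derivative (\<lambda>h. frechet_derivative f (at x) h - frechet_derivative g (at x) h)) (at x)"
    using assms by (intro has_derivative_diff) (auto simp: frechet_derivative_works)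
  from pdx_eqI[OF this] show ?thesis by (simp add: pdx_def)
qed

lemma has_derivative_gauss:
  fixes x :: "real ^ 'n::finite"
  shows "((\<lambda>x. exp (c * (norm x)\<^sup>2)) has_derivative (\<lambda>h. exp (c * (norm x)\<^sup>2) * (2 * c * (x \<bullet> h)))) (at x)"
  unfolding power2_norm_eq_inner by (auto intro!: derivative_eq_intros simp: inner_commute)

lemma gauss_differentiable: "(\<lambda>x :: real ^ 'n::finite. exp (c * (norm x)\<^sup>2)) differentiable (at x)"
  using has_derivative_gauss unfolding differentiable_def by blast

lemma pdx_gauss: "pdx i (\<lambda>x :: real ^ 'n::finite. exp (c * (norm x)\<^sup>2)) x = 2 * c * x $ i * exp (c * (norm x)\<^sup>2)"
  by (subst pdx_eqI[OF has_derivative_gauss]) (simp add: inner_axis)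

lemma pdx_local_zero:
  fixes f :: "real ^ 'n::finite \<Rightarrow> real"
  assumes "open S" "x \<in> S" "\<And>y. y \<in> S \<Longrightarrow> f y = 0"
  shows "pdx i f x = 0"
proof -
  have "((\<lambda>_. 0) has_derivative (\<lambda>_. 0 :: real)) (at x)" by simp
  then have "(f has_derivative (\<lambda>_. 0)) (at x)"
    by (rule has_derivative_transform_within_open[OF _ assms(1,2)]) (simp add: assms(3))
  from pdx_eqI[OF this] show ?thesis by simp
qed

lemma NstarD:
  assumes "\<phi> \<in> Nstar \<alpha>"
  shows "smooth_fun \<phi>" "\<exists>R. (\<forall>x. R < norm x \<longrightarrow> \<phi> x = 0) \<and> (\<forall>i x. R < norm x \<longrightarrow> pdx i \<phi> x = 0)"
proof -
  show "smooth_fun \<phi>" using assms by (simp add: Nstar_def)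
  have "bounded {x. \<phi> x \<noteq> 0}" using assms by (simp add: Nstar_def)
  then obtain R where R: "\<And>x. \<phi> x \<noteq> 0 \<Longrightarrow> norm x \<le> R" by (auto simp: bounded_iff)
  then have z: "\<phi> x = 0" if "R < norm x" for x using that by force
  moreover have "pdx i \<phi> x = 0" if "R < norm x" for i x
  proof (rule pdx_local_zero[of "- cball 0 R"])
    show "x \<in> - cball 0 R" using that by simp
    show "\<phi> y = 0" if "y \<in> - cball 0 R" for y using that z by simp
  qed auto
  ultimately show "\<exists>R. (\<forall>x. R < norm x \<longrightarrow> \<phi> x = 0) \<and> (\<forall>i x. R < norm x \<longrightarrow> pdx i \<phi> x = 0)" by blast
qed

lemma compact_support_gauss_bound:
  fixes g :: "real ^ 'n::finite \<Rightarrow> real"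
  assumes c: "continuous_on UNIV g" and z: "\<And>x. R < norm x \<Longrightarrow> g x = 0" and \<kappa>: "0 < \<kappa>"
  obtains C where "\<And>x. \<bar>g x\<bar> \<le> C * exp (- \<kappa> * (norm x)\<^sup>2)"
proof -
  have "bounded (g ` cball 0 R)"
    using c by (intro compact_imp_bounded compact_continuous_image) (auto intro: continuous_on_subset)
  then obtain B where "\<forall>y \<in> g ` cball 0 R. norm y \<le> B" unfolding bounded_iff by blast
  then have B: "\<bar>g x\<bar> \<le> B" if "norm x \<le> R" for x using that by simp
  \<comment> \<open>The factor \<open>exp (\<kappa> * R\<^sup>2)\<close> offsets the Gaussian on the
    ball. The modulus of \<open>B\<close> covers an empty ball, where \<open>B\<close> may be
    negative.\<close>
  have "\<bar>g x\<bar> \<le> (\<bar>B\<bar> * exp (\<kappa> * R\<^sup>2)) * exp (- \<kappa> * (norm x)\<^sup>2)" for x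
  proof (cases "R < norm x")
    case True then show ?thesis using z by simp
  next
    case False
    then have "(norm x)\<^sup>2 \<le> R\<^sup>2" by (intro power_mono) auto
    then have "1 \<le> exp (\<kappa> * R\<^sup>2) * exp (- \<kappa> * (norm x)\<^sup>2)"
      using \<kappa> by (simp add: exp_add[symmetric])
    then have "\<bar>B\<bar> * 1 \<le> \<bar>B\<bar> * (exp (\<kappa> * R\<^sup>2) * exp (- \<kappa> * (norm x)\<^sup>2))"
      by (rule mult_left_mono) simp
    then show ?thesis using B[of x] False by (simp add: mult.assoc)
  qed
  then show ?thesis by (rule that)
qed

lemma integrable_compact_support:
  fixes g :: "real ^ 'n::finite \<Rightarrow> real"
  assumes \<alpha>: "\<And>i. 0 \<le> \<alpha> i" and c: "continuous_on UNIV g" and z: "\<And>x. R < norm x \<Longrightarrow> g x = 0"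
  shows "integrable (muA \<alpha>) g"
proof -
  obtain C where "\<And>x. \<bar>g x\<bar> \<le> C * exp (- 1 * (norm x)\<^sup>2)"
    using compact_support_gauss_bound[OF c z zero_less_one] by blast
  then show ?thesis
    by (intro integrable_gauss_bound[OF \<alpha> zero_less_one]) (auto intro: borel_measurable_continuous_onI[OF c])
qed

lemma norm_grad_sq: "(norm (grad f x))\<^sup>2 = (\<Sum>i\<in>UNIV. (pdx i f x)\<^sup>2)"
  by (simp add: norm_sq_vec grad_def)

lemma Nstar_integrable:
  assumes \<alpha>: "\<And>i. 0 \<le> \<alpha> i" and \<phi>: "\<phi> \<in> Nstar \<alpha>"
  shows "integrable (muA \<alpha>) (\<lambda>x. (\<phi> x)\<^sup>2)" "integrable (muA \<alpha>) (\<lambda>x. (\<phi> x)\<^sup>2 * (x $ i)\<^sup>2)"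
    "integrable (muA \<alpha>) (\<lambda>x. (\<phi> x)\<^sup>2 * (norm x)\<^sup>2)"
    "integrable (muA \<alpha>) (\<lambda>x. (pdx i \<phi> x)\<^sup>2)" "integrable (muA \<alpha>) (\<lambda>x. (norm (grad \<phi> x))\<^sup>2)"
    "integrable (muA \<alpha>) (\<lambda>x. x $ i * (2 * \<phi> x * pdx i \<phi> x))"
    "(\<integral>x. x $ i * (2 * \<phi> x * pdx i \<phi> x) \<partial>muA \<alpha>) = - (1 + \<alpha> i) * (\<integral>x. (\<phi> x)\<^sup>2 \<partial>muA \<alpha>)"
proof -
  from NstarD[OF \<phi>] obtain R where sm: "smooth_fun \<phi>"
    and z: "\<And>x. R < norm x \<Longrightarrow> \<phi> x = 0" "\<And>i x. R < norm x \<Longrightarrow> pdx i \<phi> x = 0" by blast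
  note [continuous_intros] = smooth_fun_continuous[OF sm] smooth_fun_continuous[OF smooth_fun_pdx[OF sm]]
  note I = integrable_compact_support[OF \<alpha>, of _ R]
  show "integrable (muA \<alpha>) (\<lambda>x. (\<phi> x)\<^sup>2)" "integrable (muA \<alpha>) (\<lambda>x. (\<phi> x)\<^sup>2 * (x $ i)\<^sup>2)"
    "integrable (muA \<alpha>) (\<lambda>x. (\<phi> x)\<^sup>2 * (norm x)\<^sup>2)" "integrable (muA \<alpha>) (\<lambda>x. (norm (grad \<phi> x))\<^sup>2)"
    unfolding norm_grad_sq by (rule I; auto simp: z intro!: continuous_intros)+
  show "integrable (muA \<alpha>) (\<lambda>x. (pdx i \<phi> x)\<^sup>2)"
    by (rule I; auto simp: z intro!: continuous_intros)
  have p: "pdx i (\<lambda>x. (\<phi> x)\<^sup>2) = (\<lambda>x. 2 * \<phi> x * pdx i \<phi> x)"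
    unfolding power2_eq_square using smooth_fun_differentiable[OF sm] by (auto simp: pdx_mult)
  have d: "(\<lambda>x. (\<phi> x)\<^sup>2) differentiable (at x)" for x
    by (intro derivative_intros smooth_fun_differentiable[OF sm])
  have c: "continuous_on UNIV (pdx i (\<lambda>x. (\<phi> x)\<^sup>2))" unfolding p by (intro continuous_intros)
  obtain C1 where C1: "\<And>x. \<bar>(\<phi> x)\<^sup>2\<bar> \<le> C1 * exp (- 1 * (norm x)\<^sup>2)"
    by (rule compact_support_gauss_bound[of "\<lambda>x. (\<phi> x)\<^sup>2" R 1]) (auto simp: z intro!: continuous_intros)
  obtain C2 where C2: "\<And>x. \<bar>x $ i * pdx i (\<lambda>x. (\<phi> x)\<^sup>2) x\<bar> \<le> C2 * exp (- 1 * (norm x)\<^sup>2)"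
    unfolding p
    by (rule compact_support_gauss_bound[of "\<lambda>x. x $ i * (2 * \<phi> x * pdx i \<phi> x)" R 1])
       (auto simp: z intro!: continuous_intros)
  let ?C = "max C1 C2"
  have b1: "\<bar>(\<phi> x)\<^sup>2\<bar> \<le> ?C * exp (- 1 * (norm x)\<^sup>2)" for x
    by (rule order_trans[OF C1 mult_right_mono]) auto
  have b2: "\<bar>x $ i * pdx i (\<lambda>x. (\<phi> x)\<^sup>2) x\<bar> \<le> ?C * exp (- 1 * (norm x)\<^sup>2)" for x
    by (rule order_trans[OF C2 mult_right_mono]) auto
  note ibp = integration_by_parts[OF \<alpha> zero_less_one d c b1 b2]
  show "integrable (muA \<alpha>) (\<lambda>x. x $ i * (2 * \<phi> x * pdx i \<phi> x))"
    "(\<integral>x. x $ i * (2 * \<phi> x * pdx i \<phi> x) \<partial>muA \<alpha>) = - (1 + \<alpha> i) * (\<integral>x. (\<phi> x)\<^sup>2 \<partial>muA \<alpha>)"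
    using ibp(2,3) unfolding p by auto
qed

text \<open>The Gaussian in the measure turns the partial derivatives of
  \<open>f = \<phi> * e\<close> into \<open>pdx i \<phi> x + \<phi> x * x $ i / t\<close>. Expanding
  the square gives the gradient and the second moment, and the cross term is an exact derivative of
  \<open>\<phi>\<^sup>2\<close>. The Poincare constant \<open>t / 2\<close> is the source of the
  factor \<open>2\<close> on the left.\<close>

lemma Nstar_poincare:
  fixes \<alpha> :: "'n::finite \<Rightarrow> real"
  assumes \<alpha>: "\<And>i. 0 \<le> \<alpha> i" and \<phi>: "\<phi> \<in> Nstar \<alpha>" and t: "0 < t"
  shows "\<exists>c. 2 * (\<integral>x. (\<phi> x - c * exp (- (norm x)\<^sup>2 / (2 * t)))\<^sup>2 \<partial>muA \<alpha>)
    \<le> t * (\<integral>x. (norm (grad \<phi> x))\<^sup>2 \<partial>muA \<alpha>) + (1 / t) * (\<integral>x. (\<phi> x)\<^sup>2 * (norm x)\<^sup>2 \<partial>muA \<alpha>)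
      - dimA \<alpha> * (\<integral>x. (\<phi> x)\<^sup>2 \<partial>muA \<alpha>)"
proof -
  from NstarD[OF \<phi>] obtain R where sm: "smooth_fun \<phi>"
    and z: "\<And>x. R < norm x \<Longrightarrow> \<phi> x = 0" "\<And>i x. R < norm x \<Longrightarrow> pdx i \<phi> x = 0" by blast
  note [continuous_intros] = smooth_fun_continuous[OF sm] smooth_fun_continuous[OF smooth_fun_pdx[OF sm]]
  note int = Nstar_integrable[OF \<alpha> \<phi>]
  define e where "e = (\<lambda>x :: real ^ 'n. exp ((1 / (2 * t)) * (norm x)\<^sup>2))"
  define f where "f = (\<lambda>x. \<phi> x * e x)"
  have pf: "pdx i f = (\<lambda>x. (pdx i \<phi> x + \<phi> x * x $ i / t) * e x)" for i
  proof
    fix x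
    have "pdx i f x = \<phi> x * pdx i e x + pdx i \<phi> x * e x"
      unfolding f_def by (rule pdx_mult) (unfold e_def, rule smooth_fun_differentiable[OF sm], rule gauss_differentiable)
    also have "pdx i e x = 2 * (1 / (2 * t)) * x $ i * e x" unfolding e_def by (rule pdx_gauss)
    finally show "pdx i f x = (pdx i \<phi> x + \<phi> x * x $ i / t) * e x" by (simp add: algebra_simps)
  qed
  have ce [continuous_intros]: "continuous_on UNIV e" unfolding e_def by (intro continuous_intros)
  have fd: "f differentiable (at x)" for x
    unfolding f_def e_def by (intro differentiable_mult smooth_fun_differentiable[OF sm] gauss_differentiable)
  \<comment> \<open>Although \<open>e\<close> grows, \<open>f\<close> is bounded because
    \<open>\<phi>\<close> has compact support; this makes \<open>poincare_gauss\<close>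
    applicable.\<close>
  obtain C where C: "\<And>x. \<bar>f x\<bar> \<le> C * exp (- 1 * (norm x)\<^sup>2)"
    by (rule compact_support_gauss_bound[of f R 1]) (auto simp: f_def z intro!: continuous_intros)
  have fb: "\<bar>f x\<bar> \<le> \<bar>C\<bar>" for x
  proof -
    have "\<bar>f x\<bar> \<le> \<bar>C\<bar> * exp (- 1 * (norm x)\<^sup>2)"
      by (rule order_trans[OF C]) (auto intro: mult_right_mono)
    also have "\<dots> \<le> \<bar>C\<bar> * 1" by (intro mult_left_mono) auto
    finally show ?thesis by simp
  qed
  have fc: "continuous_on UNIV (pdx i f)" for i unfolding pf using t by (intro continuous_intros) auto
  obtain c where c: "(\<integral>\<^sup>+x. ennreal ((f x - c)\<^sup>2 * exp (- (norm x)\<^sup>2 / t)) \<partial>muA \<alpha>)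
     \<le> ennreal (t / 2) * (\<Sum>i\<in>UNIV. \<integral>\<^sup>+x. ennreal ((pdx i f x)\<^sup>2 * exp (- (norm x)\<^sup>2 / t)) \<partial>muA \<alpha>)"
    using poincare_gauss[where \<alpha> = \<alpha>, OF \<alpha> t fd fb fc] by blast
  have ee: "e x * e x * exp (- (norm x)\<^sup>2 / t) = 1" "e x * exp (- (norm x)\<^sup>2 / (2 * t)) = 1"
    "exp (- (norm x)\<^sup>2 / t) = exp (- (norm x)\<^sup>2 / (2 * t)) * exp (- (norm x)\<^sup>2 / (2 * t))" for x
    using t by (auto simp: e_def exp_add[symmetric] field_simps)
  have l: "(f x - c)\<^sup>2 * exp (- (norm x)\<^sup>2 / t) = (\<phi> x - c * exp (- (norm x)\<^sup>2 / (2 * t)))\<^sup>2" for x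
  proof -
    have "(f x - c)\<^sup>2 * exp (- (norm x)\<^sup>2 / t) = ((f x - c) * exp (- (norm x)\<^sup>2 / (2 * t)))\<^sup>2"
      unfolding ee(3) by (simp add: power2_eq_square)
    also have "(f x - c) * exp (- (norm x)\<^sup>2 / (2 * t)) = \<phi> x * (e x * exp (- (norm x)\<^sup>2 / (2 * t))) - c * exp (- (norm x)\<^sup>2 / (2 * t))"
      by (simp add: f_def algebra_simps)
    finally show ?thesis unfolding ee(2) by simp
  qed
  define q where "q = (\<lambda>i x. (pdx i \<phi> x)\<^sup>2 + (1 / t\<^sup>2) * ((\<phi> x)\<^sup>2 * (x $ i)\<^sup>2) + (1 / t) * (x $ i * (2 * \<phi> x * pdx i \<phi> x)))"
  have r: "(pdx i f x)\<^sup>2 * exp (- (norm x)\<^sup>2 / t) = (pdx i \<phi> x + \<phi> x * x $ i / t)\<^sup>2" for i x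
  proof -
    have "(pdx i f x)\<^sup>2 * exp (- (norm x)\<^sup>2 / t) = (pdx i \<phi> x + \<phi> x * x $ i / t)\<^sup>2 * (e x * e x * exp (- (norm x)\<^sup>2 / t))"
      unfolding pf by (simp add: power2_eq_square mult_ac)
    then show ?thesis unfolding ee(1) mult_1_right .
  qed
  have q: "(pdx i \<phi> x + \<phi> x * x $ i / t)\<^sup>2 = q i x" for i x
    using t by (simp add: q_def power2_eq_square field_simps)
  have qint: "integrable (muA \<alpha>) (q i)" for i unfolding q_def using int by simp
  have q0: "0 \<le> q i x" for i x unfolding q[symmetric] by simp
  \<comment> \<open>Integration by parts for \<open>\<phi>\<^sup>2\<close> evaluates the cross
    term.\<close>
  have ql: "(\<integral>x. q i x \<partial>muA \<alpha>) = (\<integral>x. (pdx i \<phi> x)\<^sup>2 \<partial>muA \<alpha>) + (1 / t\<^sup>2) * (\<integral>x. (\<phi> x)\<^sup>2 * (x $ i)\<^sup>2 \<partial>muA \<alpha>)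
      - (1 / t) * ((1 + \<alpha> i) * (\<integral>x. (\<phi> x)\<^sup>2 \<partial>muA \<alpha>))" for i
    unfolding q_def using int t by simp (simp add: field_simps)
  define Q where "Q = (\<Sum>i\<in>UNIV. \<integral>x. q i x \<partial>muA \<alpha>)"
  have g2: "(\<integral>x. (norm (grad \<phi> x))\<^sup>2 \<partial>muA \<alpha>) = (\<Sum>i\<in>UNIV. \<integral>x. (pdx i \<phi> x)\<^sup>2 \<partial>muA \<alpha>)"
    unfolding norm_grad_sq using int by simp
  have x2: "(\<integral>x. (\<phi> x)\<^sup>2 * (norm x)\<^sup>2 \<partial>muA \<alpha>) = (\<Sum>i\<in>UNIV. \<integral>x. (\<phi> x)\<^sup>2 * (x $ i)\<^sup>2 \<partial>muA \<alpha>)"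
    unfolding norm_sq_vec sum_distrib_left using int by simp
  have d: "(\<Sum>i\<in>UNIV. (1 + \<alpha> i) * s) = dimA \<alpha> * s" for s
    by (simp add: dimA_def sum_distrib_right[symmetric] sum.distrib)
  have Q: "Q = (\<integral>x. (norm (grad \<phi> x))\<^sup>2 \<partial>muA \<alpha>) + (1 / t\<^sup>2) * (\<integral>x. (\<phi> x)\<^sup>2 * (norm x)\<^sup>2 \<partial>muA \<alpha>)
      - (1 / t) * (dimA \<alpha> * (\<integral>x. (\<phi> x)\<^sup>2 \<partial>muA \<alpha>))"
    unfolding Q_def ql g2 x2 d[symmetric] by (simp only: sum.distrib sum_subtractf sum_distrib_left)
  have "(\<integral>\<^sup>+x. ennreal ((\<phi> x - c * exp (- (norm x)\<^sup>2 / (2 * t)))\<^sup>2) \<partial>muA \<alpha>)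
     \<le> ennreal (t / 2) * (\<Sum>i\<in>UNIV. \<integral>\<^sup>+x. ennreal (q i x) \<partial>muA \<alpha>)"
    using c unfolding l r q .
  also have "\<dots> = ennreal (t / 2) * (\<Sum>i\<in>UNIV. ennreal (\<integral>x. q i x \<partial>muA \<alpha>))"
    using qint q0 by (simp add: nn_integral_eq_integral)
  also have "\<dots> = ennreal (t / 2 * Q)"
  proof -
    have "(\<Sum>i\<in>UNIV. ennreal (\<integral>x. q i x \<partial>muA \<alpha>)) = ennreal Q"
      unfolding Q_def using q0 by (intro sum_ennreal) (simp add: integral_nonneg_AE)
    then show ?thesis using t by (simp only:) (intro ennreal_mult'[symmetric]; simp)
  qed
  finally have fin: "(\<integral>\<^sup>+x. ennreal ((\<phi> x - c * exp (- (norm x)\<^sup>2 / (2 * t)))\<^sup>2) \<partial>muA \<alpha>) \<le> ennreal (t / 2 * Q)" .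
  have Q0: "0 \<le> Q" unfolding Q_def using q0 by (intro sum_nonneg integral_nonneg_AE) auto
  have [measurable]: "\<phi> \<in> borel_measurable borel"
    by (rule borel_measurable_continuous_onI) (rule smooth_fun_continuous[OF sm])
  have "(\<integral>x. (\<phi> x - c * exp (- (norm x)\<^sup>2 / (2 * t)))\<^sup>2 \<partial>muA \<alpha>)
      = enn2real (\<integral>\<^sup>+x. ennreal ((\<phi> x - c * exp (- (norm x)\<^sup>2 / (2 * t)))\<^sup>2) \<partial>muA \<alpha>)"
    by (rule integral_eq_nn_integral) auto
  also have "\<dots> \<le> t / 2 * Q"
    using enn2real_mono[OF fin] t Q0 by simp
  finally have "2 * (\<integral>x. (\<phi> x - c * exp (- (norm x)\<^sup>2 / (2 * t)))\<^sup>2 \<partial>muA \<alpha>) \<le> t * Q" by simp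
  also have "t * Q = t * (\<integral>x. (norm (grad \<phi> x))\<^sup>2 \<partial>muA \<alpha>) + (1 / t) * (\<integral>x. (\<phi> x)\<^sup>2 * (norm x)\<^sup>2 \<partial>muA \<alpha>)
      - dimA \<alpha> * (\<integral>x. (\<phi> x)\<^sup>2 \<partial>muA \<alpha>)"
    unfolding Q using t by (simp add: field_simps power2_eq_square)
  finally show ?thesis by blast
qed

section \<open>Passage to the completion\<close>

text \<open>Young's inequality. Small \<open>\<epsilon>\<close> keeps the coefficient of the main
  term near one, so that no constant is lost in the limit; \<open>\<epsilon> = 1\<close> gives the
  crude bound with two twos.\<close>

lemma norm_sq_add_le:
  fixes a b :: "'b::real_normed_vector"
  assumes "0 < \<epsilon>"
  shows "(norm (a + b))\<^sup>2 \<le> (1 + \<epsilon>) * (norm a)\<^sup>2 + (1 + 1 / \<epsilon>) * (norm b)\<^sup>2"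
proof -
  have "0 \<le> (\<epsilon> * norm a - norm b)\<^sup>2 / \<epsilon>" using assms by simp
  also have "\<dots> = \<epsilon> * (norm a)\<^sup>2 + (norm b)\<^sup>2 / \<epsilon> - 2 * norm a * norm b"
    using assms by (simp add: power2_eq_square field_simps)
  finally have "(norm a + norm b)\<^sup>2 \<le> (1 + \<epsilon>) * (norm a)\<^sup>2 + (1 + 1 / \<epsilon>) * (norm b)\<^sup>2"
    by (simp add: power2_sum algebra_simps)
  moreover have "(norm (a + b))\<^sup>2 \<le> (norm a + norm b)\<^sup>2"
    by (intro power_mono norm_triangle_ineq) simp
  ultimately show ?thesis by linarith
qed

lemma norm_sq_diff_le:
  fixes a b :: "'b::real_normed_vector"
  assumes "0 < \<epsilon>"
  shows "\<bar>(norm a)\<^sup>2 - (norm b)\<^sup>2\<bar> \<le> (1 + 1 / \<epsilon>) * (norm (a - b))\<^sup>2 + \<epsilon> * (norm b)\<^sup>2"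
proof -
  define d where "d = norm (a - b)"
  have "\<bar>norm a - norm b\<bar> \<le> d" unfolding d_def by (rule norm_triangle_ineq3)
  then have "\<bar>norm a - norm b\<bar> * (norm a + norm b) \<le> d * (2 * norm b + d)"
    by (intro mult_mono) auto
  moreover have "\<bar>(norm a)\<^sup>2 - (norm b)\<^sup>2\<bar> = \<bar>norm a - norm b\<bar> * (norm a + norm b)"
    by (simp add: power2_eq_square square_diff_square_factored abs_mult)
  moreover have "0 \<le> (\<epsilon> * norm b - d)\<^sup>2 / \<epsilon>" using assms by simp
  moreover have "(\<epsilon> * norm b - d)\<^sup>2 / \<epsilon> = \<epsilon> * (norm b)\<^sup>2 + d\<^sup>2 / \<epsilon> - 2 * norm b * d"
    using assms by (simp add: power2_eq_square field_simps)
  ultimately show ?thesis unfolding d_def[symmetric] by (simp add: algebra_simps power2_eq_square)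
qed

lemma square_integrable_diff:
  fixes f g :: "'a \<Rightarrow> 'b::{second_countable_topology, real_normed_vector}"
  assumes [measurable]: "f \<in> borel_measurable M" "g \<in> borel_measurable M"
    and "integrable M (\<lambda>x. (norm (f x))\<^sup>2)" "integrable M (\<lambda>x. (norm (g x))\<^sup>2)"
  shows "integrable M (\<lambda>x. (norm (f x - g x))\<^sup>2)"
proof (rule Bochner_Integration.integrable_bound)
  show "integrable M (\<lambda>x. 2 * (norm (f x))\<^sup>2 + 2 * (norm (g x))\<^sup>2)" using assms by simp
  show "AE x in M. norm ((norm (f x - g x))\<^sup>2) \<le> norm (2 * (norm (f x))\<^sup>2 + 2 * (norm (g x))\<^sup>2)"
    using norm_sq_add_le[of 1 "f x" "- g x" for x] by (intro AE_I2) simp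
qed measurable

text \<open>Square integrability of the limit is a conclusion: a single index at finite distance
  from \<open>v\<close> provides it. Convergence of the square norms then follows from the estimate
  with a free \<open>\<epsilon>\<close>.\<close>

lemma L2_limit:
  fixes v :: "'a \<Rightarrow> 'b::{second_countable_topology, real_normed_vector}"
  assumes [measurable]: "\<And>n. V n \<in> borel_measurable M" "v \<in> borel_measurable M"
    and iV: "\<And>n. integrable M (\<lambda>x. (norm (V n x))\<^sup>2)"
    and lim: "(\<lambda>n. \<integral>\<^sup>+x. ennreal ((norm (V n x - v x))\<^sup>2) \<partial>M) \<longlonglongrightarrow> 0"
  shows "integrable M (\<lambda>x. (norm (v x))\<^sup>2)"
    and "\<And>n. integrable M (\<lambda>x. (norm (V n x - v x))\<^sup>2)"
    and "(\<lambda>n. \<integral>x. (norm (V n x - v x))\<^sup>2 \<partial>M) \<longlonglongrightarrow> 0"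
    and "(\<lambda>n. \<integral>x. (norm (V n x))\<^sup>2 \<partial>M) \<longlonglongrightarrow> (\<integral>x. (norm (v x))\<^sup>2 \<partial>M)"
proof -
  have "\<forall>\<^sub>F n in sequentially. (\<integral>\<^sup>+x. ennreal ((norm (V n x - v x))\<^sup>2) \<partial>M) < 1"
    using lim by (rule order_tendstoD) simp
  then obtain n where n: "(\<integral>\<^sup>+x. ennreal ((norm (V n x - v x))\<^sup>2) \<partial>M) < 1"
    by (auto simp: eventually_sequentially)
  have "integrable M (\<lambda>x. (norm (V n x - v x))\<^sup>2)"
    by (rule integrableI_bounded) (use n in \<open>auto intro: less_trans\<close>)
  from square_integrable_diff[OF _ _ iV[of n], of "\<lambda>x. V n x - v x"] this
  show iv: "integrable M (\<lambda>x. (norm (v x))\<^sup>2)" by simp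
  show id: "integrable M (\<lambda>x. (norm (V n x - v x))\<^sup>2)" for n
    by (rule square_integrable_diff) (use iV iv in auto)
  have "(\<lambda>n. ennreal (\<integral>x. (norm (V n x - v x))\<^sup>2 \<partial>M)) \<longlonglongrightarrow> ennreal 0"
    using lim id by (simp add: nn_integral_eq_integral)
  then show r: "(\<lambda>n. \<integral>x. (norm (V n x - v x))\<^sup>2 \<partial>M) \<longlonglongrightarrow> 0"
    by (subst (asm) tendsto_ennreal_iff) auto
  define W where "W = (\<integral>x. (norm (v x))\<^sup>2 \<partial>M)"
  have W: "0 \<le> W" by (simp add: W_def)
  show "(\<lambda>n. \<integral>x. (norm (V n x))\<^sup>2 \<partial>M) \<longlonglongrightarrow> W"
  proof (rule LIMSEQ_I)
    fix e :: real assume e: "0 < e"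
    \<comment> \<open>The summand \<open>1\<close> keeps the denominator positive when
      \<open>W = 0\<close> and makes \<open>\<epsilon> * W < e / 2\<close> strict.\<close>
    define \<epsilon> where "\<epsilon> = e / (2 * (W + 1))"
    have \<epsilon>: "0 < \<epsilon>" "\<epsilon> * W < e / 2" using e W by (auto simp: \<epsilon>_def field_simps)
    have bd: "\<bar>(\<integral>x. (norm (V n x))\<^sup>2 \<partial>M) - W\<bar> \<le> (1 + 1 / \<epsilon>) * (\<integral>x. (norm (V n x - v x))\<^sup>2 \<partial>M) + \<epsilon> * W" for n
    proof -
      have "\<bar>(\<integral>x. (norm (V n x))\<^sup>2 \<partial>M) - W\<bar> = \<bar>\<integral>x. (norm (V n x))\<^sup>2 - (norm (v x))\<^sup>2 \<partial>M\<bar>"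
        using iV iv by (simp add: W_def)
      also have "\<dots> \<le> (\<integral>x. \<bar>(norm (V n x))\<^sup>2 - (norm (v x))\<^sup>2\<bar> \<partial>M)" by simp
      also have "\<dots> \<le> (\<integral>x. (1 + 1 / \<epsilon>) * (norm (V n x - v x))\<^sup>2 + \<epsilon> * (norm (v x))\<^sup>2 \<partial>M)"
        using iV iv id norm_sq_diff_le[OF \<epsilon>(1)] by (intro integral_mono) auto
      also have "\<dots> = (1 + 1 / \<epsilon>) * (\<integral>x. (norm (V n x - v x))\<^sup>2 \<partial>M) + \<epsilon> * W"
        using iv id by (simp add: W_def)
      finally show ?thesis .
    qed
    have "(\<lambda>n. (1 + 1 / \<epsilon>) * (\<integral>x. (norm (V n x - v x))\<^sup>2 \<partial>M)) \<longlonglongrightarrow> (1 + 1 / \<epsilon>) * 0"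
      by (intro tendsto_mult tendsto_const r)
    then have "\<forall>\<^sub>F n in sequentially. (1 + 1 / \<epsilon>) * (\<integral>x. (norm (V n x - v x))\<^sup>2 \<partial>M) < e / 2"
      by (rule order_tendstoD) (use e in simp)
    then have "\<forall>\<^sub>F n in sequentially. norm ((\<integral>x. (norm (V n x))\<^sup>2 \<partial>M) - W) < e"
      using bd \<epsilon>(2) by (auto elim!: eventually_mono) (smt (verit))
    then show "\<exists>no. \<forall>n\<ge>no. norm ((\<integral>x. (norm (V n x))\<^sup>2 \<partial>M) - W) < e"
      by (simp add: eventually_sequentially)
  qed
qed

lemma foldr_pdx_diff:
  assumes f: "smooth_fun f" and g: "smooth_fun g"
  shows "foldr pdx is (\<lambda>x. f x - g x) = (\<lambda>x. foldr pdx is f x - foldr pdx is g x)"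
proof (induction "is")
  case (Cons i "is")
  show ?case using smooth_fun_foldr[OF f, of "is"] smooth_fun_foldr[OF g, of "is"] by (simp add: Cons pdx_diff fun_eq_iff)
qed simp

lemma Nstar_diff:
  assumes "\<phi> \<in> Nstar \<alpha>" "\<psi> \<in> Nstar \<alpha>"
  shows "(\<lambda>x. \<phi> x - \<psi> x) \<in> Nstar \<alpha>"
proof -
  have s: "smooth_fun \<phi>" "smooth_fun \<psi>" using assms by (auto simp: Nstar_def)
  have "smooth_fun (\<lambda>x. \<phi> x - \<psi> x)"
    unfolding smooth_fun_def foldr_pdx_diff[OF s] using s by (auto intro!: derivative_intros smooth_fun_foldr)
  moreover have "bounded {x. \<phi> x - \<psi> x \<noteq> 0}"
  proof (rule bounded_subset)
    show "bounded ({x. \<phi> x \<noteq> 0} \<union> {x. \<psi> x \<noteq> 0})" using assms by (simp add: Nstar_def)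
  qed auto
  ultimately show ?thesis using assms s by (simp add: Nstar_def pdx_diff smooth_fun_differentiable)
qed

lemma grad_diff:
  "smooth_fun f \<Longrightarrow> smooth_fun g \<Longrightarrow> grad (\<lambda>x. f x - g x) x = grad f x - grad g x"
  by (simp add: grad_def vec_eq_iff pdx_diff smooth_fun_differentiable)

lemma grad_measurable: "smooth_fun f \<Longrightarrow> grad f \<in> borel_measurable borel"
  unfolding grad_def
  by (intro borel_measurable_continuous_onI continuous_on_vec_lambda smooth_fun_continuous smooth_fun_pdx)

lemma dimA_pos: "(\<And>i. 0 \<le> \<alpha> i) \<Longrightarrow> 0 < dimA \<alpha>"
  unfolding dimA_def by (intro add_pos_nonneg sum_nonneg) auto

text \<open>The norm of \<open>S\<^sub>A\<close> does not control \<open>\<integral>u\<^sup>2 x\<^sup>A\<close> directly near the origin; the uncertainty principle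
  for the differences \<open>\<phi>\<^sub>n - \<phi>\<^sub>m\<close> does, and Fatou's lemma identifies the limit with \<open>u\<close>.\<close>

lemma SA_limits:
  assumes \<alpha>: "\<And>i. 0 \<le> \<alpha> i" and "SA \<alpha> u G"
  shows "u \<in> borel_measurable borel" "integrable (muA \<alpha>) (\<lambda>x. (u x)\<^sup>2)"
    and "\<exists>\<phi>. (\<forall>n. \<phi> n \<in> Nstar \<alpha>)
      \<and> (\<lambda>n. \<integral>x. (norm (grad (\<phi> n) x))\<^sup>2 \<partial>muA \<alpha>) \<longlonglongrightarrow> (\<integral>x. (norm (G x))\<^sup>2 \<partial>muA \<alpha>)
      \<and> (\<lambda>n. \<integral>x. (\<phi> n x)\<^sup>2 * (norm x)\<^sup>2 \<partial>muA \<alpha>) \<longlonglongrightarrow> (\<integral>x. (u x)\<^sup>2 * (norm x)\<^sup>2 \<partial>muA \<alpha>)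
      \<and> (\<lambda>n. \<integral>x. (\<phi> n x)\<^sup>2 \<partial>muA \<alpha>) \<longlonglongrightarrow> (\<integral>x. (u x)\<^sup>2 \<partial>muA \<alpha>)
      \<and> (\<lambda>n. \<integral>x. (\<phi> n x - u x)\<^sup>2 \<partial>muA \<alpha>) \<longlonglongrightarrow> 0"
proof -
  let ?\<mu> = "muA \<alpha>"
  from assms(2) obtain \<phi> where um: "u \<in> borel_measurable borel" and Gm [measurable]: "G \<in> borel_measurable borel"
    and \<phi>: "\<And>n. \<phi> n \<in> Nstar \<alpha>"
    and b: "(\<lambda>n. \<integral>\<^sup>+x\<in>RNstar \<alpha>. ennreal ((\<phi> n x - u x)\<^sup>2 * (norm x)\<^sup>2 * wA \<alpha> x) \<partial>lborel) \<longlonglongrightarrow> 0"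
    and a: "(\<lambda>n. \<integral>\<^sup>+x\<in>RNstar \<alpha>. ennreal ((norm (grad (\<phi> n) x - G x))\<^sup>2 * wA \<alpha> x) \<partial>lborel) \<longlonglongrightarrow> 0"
    unfolding SA_def by auto
  show um: "u \<in> borel_measurable borel" by (rule um)
  note [measurable] = um
  have sm: "smooth_fun (\<phi> n)" for n using \<phi> by (simp add: Nstar_def)
  have [measurable]: "\<phi> n \<in> borel_measurable borel" for n
    by (rule borel_measurable_continuous_onI) (rule smooth_fun_continuous[OF sm])
  have [measurable]: "grad (\<phi> n) \<in> borel_measurable borel" for n by (rule grad_measurable[OF sm])
  note int = Nstar_integrable[OF \<alpha> \<phi>]
  have a': "(\<lambda>n. \<integral>\<^sup>+x. ennreal ((norm (grad (\<phi> n) x - G x))\<^sup>2) \<partial>?\<mu>) \<longlonglongrightarrow> 0"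
    using a by (subst (asm) nn_integral_muA) auto
  \<comment> \<open>Moving \<open>norm x\<close> into the function makes this ordinary
    \<open>L\<^sup>2\<close> convergence, so that \<open>L2_limit\<close> applies.\<close>
  have b': "(\<lambda>n. \<integral>\<^sup>+x. ennreal ((norm (\<phi> n x * norm x - u x * norm x))\<^sup>2) \<partial>?\<mu>) \<longlonglongrightarrow> 0"
  proof -
    have "(norm (\<phi> n x * norm x - u x * norm x))\<^sup>2 = (\<phi> n x - u x)\<^sup>2 * (norm x)\<^sup>2" for n x
      by (simp add: power_mult_distrib left_diff_distrib[symmetric])
    then show ?thesis using b by (subst (asm) nn_integral_muA) auto
  qed
  have iB: "integrable ?\<mu> (\<lambda>x. (norm (\<phi> n x * norm x))\<^sup>2)" for n
    using int(3) by (simp add: power_mult_distrib)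
  note LA = L2_limit[OF _ _ int(5) a', simplified]
  note LB = L2_limit[OF _ _ iB b', simplified]
  define A' where "A' = (\<lambda>n. \<integral>x. (norm (grad (\<phi> n) x - G x))\<^sup>2 \<partial>?\<mu>)"
  define B' where "B' = (\<lambda>n. \<integral>x. (\<phi> n x * norm x - u x * norm x)\<^sup>2 \<partial>?\<mu>)"
  have A'0: "A' \<longlonglongrightarrow> 0" unfolding A'_def by (rule LA(3))
  have B'0: "B' \<longlonglongrightarrow> 0" unfolding B'_def by (rule LB(3))
  have "\<exists>r. strict_mono r \<and> (AE x in ?\<mu>. (\<lambda>n. (\<phi> (r n) x * norm x - u x * norm x)\<^sup>2) \<longlonglongrightarrow> 0)"
    by (rule tendsto_L1_AE_subseq) (use LB(2,3) in auto)
  then obtain r where r: "strict_mono r" and AEr: "AE x in ?\<mu>. (\<lambda>n. (\<phi> (r n) x * norm x - u x * norm x)\<^sup>2) \<longlonglongrightarrow> 0"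
    by blast
  \<comment> \<open>Off the origin one may divide by \<open>norm x\<close>; thus the subsequence
    itself converges almost everywhere to \<open>u\<close>.\<close>
  have "AE x in ?\<mu>. x \<noteq> 0" by (rule AE_muA) (rule AE_lborel_singleton)
  with AEr have conv: "AE x in ?\<mu>. (\<lambda>n. \<phi> (r n) x) \<longlonglongrightarrow> u x"
  proof eventually_elim
    case (elim x)
    from tendsto_real_sqrt[OF elim(1)] have "(\<lambda>n. \<phi> (r n) x * norm x - u x * norm x) \<longlonglongrightarrow> 0"
      by (simp add: tendsto_rabs_zero_iff)
    then have "(\<lambda>n. (\<phi> (r n) x * norm x - u x * norm x) / norm x) \<longlonglongrightarrow> 0 / norm x"
      using elim(2) by (intro tendsto_divide tendsto_const) auto
    moreover have "(\<phi> (r n) x * norm x - u x * norm x) / norm x = \<phi> (r n) x - u x" for n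
      using elim(2) by (simp add: left_diff_distrib[symmetric])
    ultimately show ?case by (simp add: LIM_zero_iff)
  qed
  define D where "D = dimA \<alpha>"
  have D: "0 < D" unfolding D_def by (rule dimA_pos[OF \<alpha>])
  \<comment> \<open>\<open>Nstar_poincare\<close> at \<open>t = 1\<close> with its nonnegative left
    side discarded: \<open>D\<close> times the square norm is at most the gradient term plus the
    second moment.\<close>
  have cauchy: "(\<integral>x. (\<phi> n x - \<phi> m x)\<^sup>2 \<partial>?\<mu>) \<le> 2 / D * (A' n + A' m + B' n + B' m)" for n m
  proof -
    let ?\<psi> = "\<lambda>x. \<phi> n x - \<phi> m x"
    have \<psi>: "?\<psi> \<in> Nstar \<alpha>" by (intro Nstar_diff \<phi>)
    note i\<psi> = Nstar_integrable[OF \<alpha> \<psi>]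
    obtain c where c: "2 * (\<integral>x. (?\<psi> x - c * exp (- (norm x)\<^sup>2 / (2 * 1)))\<^sup>2 \<partial>?\<mu>)
        \<le> 1 * (\<integral>x. (norm (grad ?\<psi> x))\<^sup>2 \<partial>?\<mu>) + (1 / 1) * (\<integral>x. (?\<psi> x)\<^sup>2 * (norm x)\<^sup>2 \<partial>?\<mu>) - D * (\<integral>x. (?\<psi> x)\<^sup>2 \<partial>?\<mu>)"
      using Nstar_poincare[OF \<alpha> \<psi> zero_less_one] unfolding D_def by blast
    have "0 \<le> (\<integral>x. (?\<psi> x - c * exp (- (norm x)\<^sup>2 / (2 * 1)))\<^sup>2 \<partial>?\<mu>)" by simp
    with c have "D * (\<integral>x. (?\<psi> x)\<^sup>2 \<partial>?\<mu>) \<le> (\<integral>x. (norm (grad ?\<psi> x))\<^sup>2 \<partial>?\<mu>) + (\<integral>x. (?\<psi> x)\<^sup>2 * (norm x)\<^sup>2 \<partial>?\<mu>)"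
      by linarith
    also have "(\<integral>x. (norm (grad ?\<psi> x))\<^sup>2 \<partial>?\<mu>) \<le> (\<integral>x. 2 * (norm (grad (\<phi> n) x - G x))\<^sup>2 + 2 * (norm (grad (\<phi> m) x - G x))\<^sup>2 \<partial>?\<mu>)"
    proof (rule integral_mono)
      fix x
      have "grad ?\<psi> x = (grad (\<phi> n) x - G x) + - (grad (\<phi> m) x - G x)" by (simp add: grad_diff sm)
      then show "(norm (grad ?\<psi> x))\<^sup>2 \<le> 2 * (norm (grad (\<phi> n) x - G x))\<^sup>2 + 2 * (norm (grad (\<phi> m) x - G x))\<^sup>2"
        using norm_sq_add_le[of 1 "grad (\<phi> n) x - G x" "- (grad (\<phi> m) x - G x)"]
        by (simp only: norm_minus_cancel) simp
    qed (use i\<psi>(5) LA(2) in auto)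
    also have "\<dots> = 2 * A' n + 2 * A' m" unfolding A'_def using LA(2) by simp
    also have "(\<integral>x. (?\<psi> x)\<^sup>2 * (norm x)\<^sup>2 \<partial>?\<mu>) \<le> (\<integral>x. 2 * (\<phi> n x * norm x - u x * norm x)\<^sup>2 + 2 * (\<phi> m x * norm x - u x * norm x)\<^sup>2 \<partial>?\<mu>)"
    proof (rule integral_mono)
      fix x :: "real ^ 'a"
      have "(?\<psi> x)\<^sup>2 * (norm x)\<^sup>2 = (norm ((\<phi> n x * norm x - u x * norm x) + (u x * norm x - \<phi> m x * norm x)))\<^sup>2"
        by (simp add: power_mult_distrib[symmetric] left_diff_distrib)
      also have "\<dots> \<le> 2 * (norm (\<phi> n x * norm x - u x * norm x))\<^sup>2 + 2 * (norm (u x * norm x - \<phi> m x * norm x))\<^sup>2"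
        using norm_sq_add_le[of 1 "\<phi> n x * norm x - u x * norm x" "u x * norm x - \<phi> m x * norm x"] by simp
      finally show "(?\<psi> x)\<^sup>2 * (norm x)\<^sup>2 \<le> 2 * (\<phi> n x * norm x - u x * norm x)\<^sup>2 + 2 * (\<phi> m x * norm x - u x * norm x)\<^sup>2"
        by (simp add: power2_commute)
    qed (use i\<psi>(3) LB(2) in auto)
    also have "\<dots> = 2 * B' n + 2 * B' m" unfolding B'_def using LB(2) by simp
    finally show ?thesis using D by (simp add: field_simps)
  qed
  \<comment> \<open>The index \<open>n\<close> stays fixed while the other runs along
    \<open>r\<close>; only the errors belonging to \<open>n\<close> survive.\<close>
  have s: "(\<integral>\<^sup>+x. ennreal ((\<phi> n x - u x)\<^sup>2) \<partial>?\<mu>) \<le> ennreal (2 / D * (A' n + B' n))" for n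
  proof -
    have "(\<integral>\<^sup>+x. ennreal ((\<phi> n x - u x)\<^sup>2) \<partial>?\<mu>) = (\<integral>\<^sup>+x. liminf (\<lambda>k. ennreal ((\<phi> n x - \<phi> (r k) x)\<^sup>2)) \<partial>?\<mu>)"
    proof (rule nn_integral_cong_AE)
      show "AE x in ?\<mu>. ennreal ((\<phi> n x - u x)\<^sup>2) = liminf (\<lambda>k. ennreal ((\<phi> n x - \<phi> (r k) x)\<^sup>2))"
        using conv
      proof eventually_elim
        case (elim x)
        have "(\<lambda>k. ennreal ((\<phi> n x - \<phi> (r k) x)\<^sup>2)) \<longlonglongrightarrow> ennreal ((\<phi> n x - u x)\<^sup>2)"
          by (intro tendsto_ennrealI tendsto_intros elim)
        from lim_imp_Liminf[OF _ this] show ?case by simp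
      qed
    qed
    also have "\<dots> \<le> liminf (\<lambda>k. \<integral>\<^sup>+x. ennreal ((\<phi> n x - \<phi> (r k) x)\<^sup>2) \<partial>?\<mu>)"
      by (rule nn_integral_liminf) measurable
    also have "\<dots> \<le> liminf (\<lambda>k. ennreal (2 / D * (A' n + A' (r k) + B' n + B' (r k))))"
    proof (intro Liminf_mono always_eventually allI)
      fix k
      have "(\<integral>\<^sup>+x. ennreal ((\<phi> n x - \<phi> (r k) x)\<^sup>2) \<partial>?\<mu>) = ennreal (\<integral>x. (\<phi> n x - \<phi> (r k) x)\<^sup>2 \<partial>?\<mu>)"
        using Nstar_integrable(1)[OF \<alpha> Nstar_diff[OF \<phi> \<phi>]] by (intro nn_integral_eq_integral) auto
      also have "\<dots> \<le> ennreal (2 / D * (A' n + A' (r k) + B' n + B' (r k)))"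
        by (intro ennreal_leI cauchy)
      finally show "(\<integral>\<^sup>+x. ennreal ((\<phi> n x - \<phi> (r k) x)\<^sup>2) \<partial>?\<mu>) \<le> \<dots>" .
    qed
    also have "\<dots> = ennreal (2 / D * (A' n + 0 + B' n + 0))"
    proof (rule lim_imp_Liminf)
      show "(\<lambda>k. ennreal (2 / D * (A' n + A' (r k) + B' n + B' (r k)))) \<longlonglongrightarrow> ennreal (2 / D * (A' n + 0 + B' n + 0))"
        using LIMSEQ_subseq_LIMSEQ[OF A'0 r] LIMSEQ_subseq_LIMSEQ[OF B'0 r]
        by (intro tendsto_ennrealI tendsto_intros) (auto simp: o_def)
    qed simp
    finally show ?thesis by simp
  qed
  have c': "(\<lambda>n. \<integral>\<^sup>+x. ennreal ((norm (\<phi> n x - u x))\<^sup>2) \<partial>?\<mu>) \<longlonglongrightarrow> 0"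
  proof (rule tendsto_sandwich[of "\<lambda>_. 0"])
    have "(\<lambda>n. ennreal (2 / D * (A' n + B' n))) \<longlonglongrightarrow> ennreal (2 / D * (0 + 0))"
      by (intro tendsto_ennrealI tendsto_intros A'0 B'0)
    then show "(\<lambda>n. ennreal (2 / D * (A' n + B' n))) \<longlonglongrightarrow> 0" by simp
  qed (use s in auto)
  have iN: "integrable ?\<mu> (\<lambda>x. (norm (\<phi> n x))\<^sup>2)" for n using int(1) by simp
  note LN = L2_limit[OF _ _ iN c', simplified]
  show "integrable ?\<mu> (\<lambda>x. (u x)\<^sup>2)" by (rule LN(1)) 
  show "\<exists>\<phi>. (\<forall>n. \<phi> n \<in> Nstar \<alpha>)
      \<and> (\<lambda>n. \<integral>x. (norm (grad (\<phi> n) x))\<^sup>2 \<partial>muA \<alpha>) \<longlonglongrightarrow> (\<integral>x. (norm (G x))\<^sup>2 \<partial>muA \<alpha>)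
      \<and> (\<lambda>n. \<integral>x. (\<phi> n x)\<^sup>2 * (norm x)\<^sup>2 \<partial>muA \<alpha>) \<longlonglongrightarrow> (\<integral>x. (u x)\<^sup>2 * (norm x)\<^sup>2 \<partial>muA \<alpha>)
      \<and> (\<lambda>n. \<integral>x. (\<phi> n x)\<^sup>2 \<partial>muA \<alpha>) \<longlonglongrightarrow> (\<integral>x. (u x)\<^sup>2 \<partial>muA \<alpha>)
      \<and> (\<lambda>n. \<integral>x. (\<phi> n x - u x)\<^sup>2 \<partial>muA \<alpha>) \<longlonglongrightarrow> 0"
    using \<phi> LA(4) LB(4) LN(3,4) by (intro exI[of _ \<phi>]) (auto simp: power_mult_distrib)
qed

lemma two_sqrt_mult_ge:
  fixes A B K :: real
  assumes A: "0 \<le> A" and B: "0 \<le> B" and le: "\<And>t. 0 < t \<Longrightarrow> K \<le> t * A + (1 / t) * B"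
  shows "K \<le> 2 * (sqrt A * sqrt B)"
proof (rule field_le_epsilon)
  fix e :: real assume e: "0 < e"
  obtain d where d: "0 < d" "2 * (sqrt (A + d) * sqrt (B + d)) < 2 * (sqrt A * sqrt B) + e"
  proof -
    have "((\<lambda>d. 2 * (sqrt (A + d) * sqrt (B + d))) \<longlongrightarrow> 2 * (sqrt (A + 0) * sqrt (B + 0))) (at_right 0)"
      by (intro tendsto_intros)
    then have "\<forall>\<^sub>F d in at_right 0. 2 * (sqrt (A + d) * sqrt (B + d)) < 2 * (sqrt A * sqrt B) + e"
      by (rule order_tendstoD) (use e in simp)
    moreover have "\<forall>\<^sub>F d in at_right (0::real). 0 < d" by (rule eventually_at_right_less)
    ultimately have "\<forall>\<^sub>F d in at_right 0. 0 < d \<and> 2 * (sqrt (A + d) * sqrt (B + d)) < 2 * (sqrt A * sqrt B) + e"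
      by eventually_elim simp
    then show ?thesis using eventually_happens'[of "at_right (0::real)"] that by auto
  qed
  define p where "p = sqrt (A + d)"
  define q where "q = sqrt (B + d)"
  have p: "0 < p" "p * p = A + d" using A d by (auto simp: p_def)
  have q: "0 < q" "q * q = B + d" using B d by (auto simp: q_def)
  have "K \<le> (q / p) * A + (1 / (q / p)) * B" using p q by (intro le) auto
  also have "\<dots> \<le> (q / p) * (p * p) + (1 / (q / p)) * (q * q)"
    using p q d by (intro add_mono mult_left_mono) auto
  also have "\<dots> = 2 * (p * q)" using p(1) q(1) by (simp add: field_simps)
  finally show "K \<le> 2 * (sqrt A * sqrt B) + e" using d by (simp add: p_def q_def)
qed

section \<open>The deficit and the distance as integrals over the weighted measure\<close>

lemma dA_eq:
  assumes [measurable]: "u \<in> borel_measurable borel"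
  shows "dA \<alpha> u = (INF p \<in> {(c, l). (l::real) \<noteq> 0}.
     sqrt (\<integral>x. (u x - fst p * exp (- (norm x)\<^sup>2 / (2 * (snd p)\<^sup>2)))\<^sup>2 \<partial>muA \<alpha>))"
  unfolding dA_def by (subst set_integral_muA) auto

lemma dA_nonneg:
  assumes "u \<in> borel_measurable borel"
  shows "0 \<le> dA \<alpha> u"
  unfolding dA_eq[OF assms] by (rule cINF_greatest) (auto intro!: exI[of _ 1])

lemma dA_sq_le:
  assumes u: "u \<in> borel_measurable borel" and t: "0 < t"
  shows "(dA \<alpha> u)\<^sup>2 \<le> (\<integral>x. (u x - c * exp (- (norm x)\<^sup>2 / (2 * t)))\<^sup>2 \<partial>muA \<alpha>)"
proof -
  let ?v = "\<lambda>p. sqrt (\<integral>x. (u x - fst p * exp (- (norm x)\<^sup>2 / (2 * (snd p)\<^sup>2)))\<^sup>2 \<partial>muA \<alpha>)"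
  \<comment> \<open>The scale \<open>sqrt t\<close> has square \<open>t\<close>, matching the
    exponent of the Gaussian.\<close>
  have "dA \<alpha> u \<le> ?v (c, sqrt t)"
    unfolding dA_eq[OF u] by (rule cINF_lower) (use t in \<open>auto intro!: bdd_belowI2[of _ 0]\<close>)
  then have "(dA \<alpha> u)\<^sup>2 \<le> (?v (c, sqrt t))\<^sup>2"
    by (rule power_mono) (rule dA_nonneg[OF u])
  then show ?thesis using t by simp
qed

lemma deltaA_eq:
  assumes [measurable]: "u \<in> borel_measurable borel" "G \<in> borel_measurable borel"
  shows "deltaA \<alpha> u G = sqrt (\<integral>x. (norm (G x))\<^sup>2 \<partial>muA \<alpha>) * sqrt (\<integral>x. (u x)\<^sup>2 * (norm x)\<^sup>2 \<partial>muA \<alpha>)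
     - dimA \<alpha> / 2 * (\<integral>x. (u x)\<^sup>2 \<partial>muA \<alpha>)"
proof -
  have "(LINT x:RNstar \<alpha>|lborel. (norm (G x))\<^sup>2 * wA \<alpha> x) = (\<integral>x. (norm (G x))\<^sup>2 \<partial>muA \<alpha>)"
    "(LINT x:RNstar \<alpha>|lborel. (u x)\<^sup>2 * (norm x)\<^sup>2 * wA \<alpha> x) = (\<integral>x. (u x)\<^sup>2 * (norm x)\<^sup>2 \<partial>muA \<alpha>)"
    "(LINT x:RNstar \<alpha>|lborel. (u x)\<^sup>2 * wA \<alpha> x) = (\<integral>x. (u x)\<^sup>2 \<partial>muA \<alpha>)"
    by (rule set_integral_muA, measurable)+
  then show ?thesis unfolding deltaA_def by simp
qed

lemma le_if_le_one_plus_eps: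
  fixes x y :: real
  assumes "\<And>\<epsilon>. 0 < \<epsilon> \<Longrightarrow> x \<le> (1 + \<epsilon>) * y"
  shows "x \<le> y"
proof (rule tendsto_lowerbound)
  have "((\<lambda>\<epsilon>. (1 + \<epsilon>) * y) \<longlongrightarrow> (1 + 0) * y) (at_right 0)" by (intro tendsto_intros)
  then show "((\<lambda>\<epsilon>. (1 + \<epsilon>) * y) \<longlongrightarrow> y) (at_right 0)" by simp
  show "\<forall>\<^sub>F \<epsilon> in at_right 0. x \<le> (1 + \<epsilon>) * y"
    using eventually_at_right_less[of "0::real"] by eventually_elim (rule assms)
qed simp

text \<open>Each approximant \<open>\<phi> n\<close> supplies its own \<open>c\<close>, which bounds
  \<open>dA\<close> at \<open>u\<close> up to a weighted triangle inequality. The limits are taken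
  in the order \<open>n \<longlonglongrightarrow> \<infinity>\<close>, then
  \<open>\<epsilon> \<longlonglongrightarrow> 0\<close>, and only then is \<open>t\<close>
  optimized.\<close>

theorem stability:
  assumes \<alpha>: "\<And>i. 0 \<le> \<alpha> i" and SA: "SA \<alpha> u G"
  shows "(dA \<alpha> u)\<^sup>2 \<le> deltaA \<alpha> u G"
proof -
  let ?\<mu> = "muA \<alpha>"
  note um [measurable] = SA_limits(1)[OF \<alpha> SA]
  have Gm: "G \<in> borel_measurable borel" using SA by (simp add: SA_def)
  note iu = SA_limits(2)[OF \<alpha> SA]
  define A where "A = (\<integral>x. (norm (G x))\<^sup>2 \<partial>?\<mu>)"
  define B where "B = (\<integral>x. (u x)\<^sup>2 * (norm x)\<^sup>2 \<partial>?\<mu>)"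
  define N where "N = (\<integral>x. (u x)\<^sup>2 \<partial>?\<mu>)"
  define D where "D = dimA \<alpha>"
  obtain \<phi> where \<phi>: "\<And>n. \<phi> n \<in> Nstar \<alpha>"
    and lA: "(\<lambda>n. \<integral>x. (norm (grad (\<phi> n) x))\<^sup>2 \<partial>?\<mu>) \<longlonglongrightarrow> A"
    and lB: "(\<lambda>n. \<integral>x. (\<phi> n x)\<^sup>2 * (norm x)\<^sup>2 \<partial>?\<mu>) \<longlonglongrightarrow> B"
    and lN: "(\<lambda>n. \<integral>x. (\<phi> n x)\<^sup>2 \<partial>?\<mu>) \<longlonglongrightarrow> N"
    and lS: "(\<lambda>n. \<integral>x. (\<phi> n x - u x)\<^sup>2 \<partial>?\<mu>) \<longlonglongrightarrow> 0"
    using SA_limits(3)[OF \<alpha> SA] unfolding A_def B_def N_def by blast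
  have [measurable]: "\<phi> n \<in> borel_measurable borel" for n
    by (rule borel_measurable_continuous_onI) (use \<phi> in \<open>auto simp: Nstar_def intro: smooth_fun_continuous\<close>)
  have key: "D * N + 2 * (dA \<alpha> u)\<^sup>2 \<le> t * A + (1 / t) * B" if t: "0 < t" for t
  proof -
    define Q where "Q = (\<lambda>n. (t * (\<integral>x. (norm (grad (\<phi> n) x))\<^sup>2 \<partial>?\<mu>) + (1 / t) * (\<integral>x. (\<phi> n x)\<^sup>2 * (norm x)\<^sup>2 \<partial>?\<mu>)
      - D * (\<integral>x. (\<phi> n x)\<^sup>2 \<partial>?\<mu>)) / 2)"
    define g where "g = (\<lambda>x :: real ^ 'a. exp (- (norm x)\<^sup>2 / (2 * t)))"
    have [measurable]: "g \<in> borel_measurable borel" unfolding g_def by measurable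
    have ig: "integrable ?\<mu> (\<lambda>x. (c * g x)\<^sup>2)" for c
    proof -
      have "(c * g x)\<^sup>2 = c\<^sup>2 * exp (- (1 / t) * (norm x)\<^sup>2)" for x
        using t by (simp add: g_def power_mult_distrib exp_double[symmetric])
      then show ?thesis using t by (simp add: integrable_gauss[OF \<alpha>, of "1 / t", simplified])
    qed
    have "(dA \<alpha> u)\<^sup>2 \<le> (1 + \<epsilon>) * ((t * A + (1 / t) * B - D * N) / 2)" if \<epsilon>: "0 < \<epsilon>" for \<epsilon>
    proof -
      have le: "(dA \<alpha> u)\<^sup>2 \<le> (1 + \<epsilon>) * Q n + (1 + 1 / \<epsilon>) * (\<integral>x. (\<phi> n x - u x)\<^sup>2 \<partial>?\<mu>)" for n
      proof -
        obtain c where "2 * (\<integral>x. (\<phi> n x - c * exp (- (norm x)\<^sup>2 / (2 * t)))\<^sup>2 \<partial>?\<mu>)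
            \<le> t * (\<integral>x. (norm (grad (\<phi> n) x))\<^sup>2 \<partial>?\<mu>) + (1 / t) * (\<integral>x. (\<phi> n x)\<^sup>2 * (norm x)\<^sup>2 \<partial>?\<mu>)
              - dimA \<alpha> * (\<integral>x. (\<phi> n x)\<^sup>2 \<partial>?\<mu>)"
          using Nstar_poincare[OF \<alpha> \<phi>[of n] t] by blast
        moreover have "2 * a \<le> b \<Longrightarrow> a \<le> b / 2" for a b :: real by simp
        ultimately have c: "(\<integral>x. (\<phi> n x - c * g x)\<^sup>2 \<partial>?\<mu>) \<le> Q n"
          unfolding Q_def g_def D_def by blast
        have i1: "integrable ?\<mu> (\<lambda>x. (u x - c * g x)\<^sup>2)"
          using square_integrable_diff[of u ?\<mu> "\<lambda>x. c * g x"] iu ig[of c] by simp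
        have i2: "integrable ?\<mu> (\<lambda>x. (\<phi> n x - c * g x)\<^sup>2)"
          using square_integrable_diff[of "\<phi> n" ?\<mu> "\<lambda>x. c * g x"] Nstar_integrable(1)[OF \<alpha> \<phi>] ig[of c] by simp
        have i3: "integrable ?\<mu> (\<lambda>x. (\<phi> n x - u x)\<^sup>2)"
          using square_integrable_diff[of "\<phi> n" ?\<mu> u] Nstar_integrable(1)[OF \<alpha> \<phi>] iu by simp
        have "(dA \<alpha> u)\<^sup>2 \<le> (\<integral>x. (u x - c * g x)\<^sup>2 \<partial>?\<mu>)"
          unfolding g_def by (rule dA_sq_le[OF um t])
        also have "\<dots> \<le> (\<integral>x. (1 + \<epsilon>) * (\<phi> n x - c * g x)\<^sup>2 + (1 + 1 / \<epsilon>) * (\<phi> n x - u x)\<^sup>2 \<partial>?\<mu>)"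
        proof (rule integral_mono)
          fix x
          show "(u x - c * g x)\<^sup>2 \<le> (1 + \<epsilon>) * (\<phi> n x - c * g x)\<^sup>2 + (1 + 1 / \<epsilon>) * (\<phi> n x - u x)\<^sup>2"
            using norm_sq_add_le[OF \<epsilon>, of "\<phi> n x - c * g x" "u x - \<phi> n x"] by (simp add: power2_commute)
        qed (use i1 i2 i3 in auto)
        also have "\<dots> = (1 + \<epsilon>) * (\<integral>x. (\<phi> n x - c * g x)\<^sup>2 \<partial>?\<mu>) + (1 + 1 / \<epsilon>) * (\<integral>x. (\<phi> n x - u x)\<^sup>2 \<partial>?\<mu>)"
          using i2 i3 by simp
        also have "\<dots> \<le> (1 + \<epsilon>) * Q n + (1 + 1 / \<epsilon>) * (\<integral>x. (\<phi> n x - u x)\<^sup>2 \<partial>?\<mu>)"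
          using \<epsilon> c by (intro add_right_mono mult_left_mono) auto
        finally show ?thesis .
      qed
      have "(\<lambda>n. (1 + \<epsilon>) * Q n + (1 + 1 / \<epsilon>) * (\<integral>x. (\<phi> n x - u x)\<^sup>2 \<partial>?\<mu>))
         \<longlonglongrightarrow> (1 + \<epsilon>) * ((t * A + (1 / t) * B - D * N) / 2) + (1 + 1 / \<epsilon>) * 0"
        unfolding Q_def by (intro tendsto_intros lA lB lN lS) simp
      from LIMSEQ_le_const[OF this] le
      have "(dA \<alpha> u)\<^sup>2 \<le> (1 + \<epsilon>) * ((t * A + (1 / t) * B - D * N) / 2) + (1 + 1 / \<epsilon>) * 0" by blast
      then show ?thesis by simp
    qed
    from le_if_le_one_plus_eps[OF this] show ?thesis by simp
  qed
  \<comment> \<open>Halving this gives the deficit on the right and exactly one squared distance on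
    the left.\<close>
  have "D * N + 2 * (dA \<alpha> u)\<^sup>2 \<le> 2 * (sqrt A * sqrt B)"
    by (rule two_sqrt_mult_ge[OF _ _ key]) (auto simp: A_def B_def)
  then show ?thesis
    unfolding deltaA_eq[OF um Gm] A_def[symmetric] B_def[symmetric] N_def[symmetric] D_def[symmetric] by simp
qed

section \<open>The extremal function\<close>

text \<open>The standard flat function, divided by powers of \<open>s\<close> so that derivatives
  are linear combinations of members of the same family.\<close>

definition flat_exp :: "nat \<Rightarrow> real \<Rightarrow> real" where
  "flat_exp k s = (if 0 < s then exp (- 1 / s) / s ^ k else 0)"

lemma flat_exp_tendsto_0: "(flat_exp k \<longlongrightarrow> 0) (at_right 0)"
proof -
  have "((\<lambda>s. inverse s ^ k / exp (inverse s)) \<longlongrightarrow> 0) (at_right (0::real))"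
    by (rule filterlim_compose[OF tendsto_power_div_exp_0 filterlim_inverse_at_top_right])
  then show ?thesis
  proof (rule Lim_transform_eventually)
    show "\<forall>\<^sub>F s in at_right 0. inverse s ^ k / exp (inverse s) = flat_exp k s"
      using eventually_at_right_less[of "0::real"]
      by eventually_elim (simp add: flat_exp_def exp_minus field_simps)
  qed
qed

text \<open>Only \<open>s = 0\<close> is delicate: the right difference quotient there is
  \<open>flat_exp (k + 1)\<close>, which tends to \<open>0\<close>, and the left one
  vanishes.\<close>

lemma flat_exp_deriv: "(flat_exp k has_real_derivative flat_exp (k + 2) s - real k * flat_exp (k + 1) s) (at s)"
proof -
  consider "0 < s" | "s < 0" | "s = 0" by linarith
  then show ?thesis
  proof cases
    case 1
    have "((\<lambda>s. exp (- 1 / s) * inverse (s ^ k)) has_real_derivative flat_exp (k + 2) s - real k * flat_exp (k + 1) s) (at s)"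
    proof -
      have "((\<lambda>s. exp (- 1 / s) * inverse (s ^ k)) has_real_derivative
          exp (- 1 / s) * (1 / s\<^sup>2) * inverse (s ^ k) + exp (- 1 / s) * - (inverse (s ^ k) * (real k * s ^ (k - 1)) * inverse (s ^ k))) (at s)"
        using 1 by (auto intro!: derivative_eq_intros simp: power2_eq_square)
      also have "exp (- 1 / s) * (1 / s\<^sup>2) * inverse (s ^ k) = flat_exp (k + 2) s"
        using 1 by (simp add: flat_exp_def field_simps power2_eq_square)
      \<comment> \<open>For \<open>k = 0\<close> the exponent \<open>k - 1\<close> is truncated to
        \<open>0\<close>, harmlessly, since the factor \<open>real k\<close> vanishes; hence the
        case split.\<close>
      also have "exp (- 1 / s) * - (inverse (s ^ k) * (real k * s ^ (k - 1)) * inverse (s ^ k)) = - (real k * flat_exp (k + 1) s)"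
        using 1 by (cases k) (simp_all add: flat_exp_def field_simps)
      finally show ?thesis by simp
    qed
    then show ?thesis
      by (rule has_field_derivative_transform_within_open[of _ _ _ "{0<..}"])
         (use 1 in \<open>auto simp: flat_exp_def field_simps\<close>)
  next
    case 2
    have "((\<lambda>_. 0) has_real_derivative 0) (at s)" by simp
    then have "(flat_exp k has_real_derivative 0) (at s)"
      by (rule has_field_derivative_transform_within_open[of _ _ _ "{..<0}"]) (use 2 in \<open>auto simp: flat_exp_def\<close>)
    then show ?thesis using 2 by (simp add: flat_exp_def)
  next
    case 3
    have "((\<lambda>h. (flat_exp k (0 + h) - flat_exp k 0) / h) \<longlongrightarrow> 0) (at 0)"
    proof (rule filterlim_split_at)
      show "((\<lambda>h. (flat_exp k (0 + h) - flat_exp k 0) / h) \<longlongrightarrow> 0) (at_left 0)"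
        by (rule tendsto_eventually) (auto simp: flat_exp_def eventually_at_left_field intro!: exI[of _ "-1"])
      show "((\<lambda>h. (flat_exp k (0 + h) - flat_exp k 0) / h) \<longlongrightarrow> 0) (at_right 0)"
        using flat_exp_tendsto_0[of "k + 1"]
      proof (rule Lim_transform_eventually)
        show "\<forall>\<^sub>F h in at_right 0. flat_exp (k + 1) h = (flat_exp k (0 + h) - flat_exp k 0) / h"
          using eventually_at_right_less[of "0::real"] by eventually_elim (simp add: flat_exp_def)
      qed
    qed
    then have "(flat_exp k has_real_derivative 0) (at 0)" unfolding DERIV_def .
    then show ?thesis using 3 by (simp add: flat_exp_def)
  qed
qed

lemma flat_exp_nonneg: "0 \<le> flat_exp k s"
  by (simp add: flat_exp_def)

lemma flat_exp_0_le: "s \<le> 1 \<Longrightarrow> exp 1 * flat_exp 0 s \<le> 1"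
  by (simp add: flat_exp_def exp_add[symmetric] field_simps)

lemma sq_le_exp:
  assumes "0 \<le> (y::real)" shows "y\<^sup>2 \<le> 4 * exp y"
proof -
  have "y / 2 \<le> exp (y / 2)" using exp_ge_add_one_self[of "y / 2"] by linarith
  then have "(y / 2)\<^sup>2 \<le> (exp (y / 2))\<^sup>2" using assms by (intro power_mono) auto
  also have "(exp (y / 2))\<^sup>2 = exp y" by (simp add: power2_eq_square exp_add[symmetric])
  finally show ?thesis by (simp add: power_divide)
qed

lemma flat_exp_2_le: "flat_exp 2 s \<le> 4"
proof (cases "0 < s")
  case True
  have "(1 / s)\<^sup>2 * exp (- 1 / s) \<le> 4 * exp (1 / s) * exp (- 1 / s)"
    using True by (intro mult_right_mono sq_le_exp) auto
  also have "\<dots> = 4" by (simp add: exp_add[symmetric])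
  finally show ?thesis using True by (simp add: flat_exp_def power_divide)
qed (simp add: flat_exp_def)

text \<open>An algebra of functions closed under partial derivatives consists of smooth functions.\<close>

inductive bump_algebra :: "real \<Rightarrow> (real ^ 'n::finite \<Rightarrow> real) \<Rightarrow> bool" for c where
  const: "bump_algebra c (\<lambda>_. a)"
| coord: "bump_algebra c (\<lambda>x. x $ i)"
| gauss: "bump_algebra c (\<lambda>x. exp ((- 1 / 2) * (norm x)\<^sup>2))"
| flat_exp: "bump_algebra c (\<lambda>x. flat_exp k (1 - c * (norm x)\<^sup>2))"
| add: "bump_algebra c f \<Longrightarrow> bump_algebra c g \<Longrightarrow> bump_algebra c (\<lambda>x. f x + g x)"
| mult: "bump_algebra c f \<Longrightarrow> bump_algebra c g \<Longrightarrow> bump_algebra c (\<lambda>x. f x * g x)"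

lemma has_derivative_flat_exp_radial:
  fixes x :: "real ^ 'n::finite"
  shows "((\<lambda>x. flat_exp k (1 - c * (norm x)\<^sup>2)) has_derivative
    (\<lambda>h. (flat_exp (k + 2) (1 - c * (norm x)\<^sup>2) - real k * flat_exp (k + 1) (1 - c * (norm x)\<^sup>2)) * (- (2 * c * (x \<bullet> h))))) (at x)"
proof -
  have "((\<lambda>x. 1 - c * (norm x)\<^sup>2) has_derivative (\<lambda>h. - (2 * c * (x \<bullet> h)))) (at x)"
    unfolding power2_norm_eq_inner by (auto intro!: derivative_eq_intros simp: inner_commute)
  from has_derivative_compose[OF this, OF flat_exp_deriv[of k, unfolded has_field_derivative_def]]
  show ?thesis by simp
qed

lemma pdx_flat_exp_radial:
  "pdx i (\<lambda>x :: real ^ 'n::finite. flat_exp k (1 - c * (norm x)\<^sup>2)) x =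
    (flat_exp (k + 2) (1 - c * (norm x)\<^sup>2) - real k * flat_exp (k + 1) (1 - c * (norm x)\<^sup>2)) * (- (2 * c * x $ i))"
  by (subst pdx_eqI[OF has_derivative_flat_exp_radial]) (simp add: inner_axis)

lemma pdx_coord: "pdx i (\<lambda>x :: real ^ 'n::finite. x $ j) x = (if i = j then 1 else 0)"
  by (subst pdx_eqI[OF bounded_linear_imp_has_derivative[OF bounded_linear_vec_nth]]) (simp add: axis_def)

lemma pdx_add:
  assumes "f differentiable (at x)" "g differentiable (at x)"
  shows "pdx i (\<lambda>x. f x + g x) x = pdx i f x + pdx i g x"
proof -
  have "((\<lambda>x. f x + g x) has_derivative (\<lambda>h. frechet_derivative f (at x) h + frechet_derivative g (at x) h)) (at x)"
    using assms by (intro has_derivative_add) (auto simp: frechet_derivative_works)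
  from pdx_eqI[OF this] show ?thesis by (simp add: pdx_def)
qed

lemma coord_differentiable: "(\<lambda>x :: real ^ 'n::finite. x $ j) differentiable (at x)"
  using bounded_linear_imp_has_derivative[OF bounded_linear_vec_nth] unfolding differentiable_def by blast

lemma bump_algebra_pdx:
  assumes "bump_algebra c f"
  shows "(\<forall>x. f differentiable (at x)) \<and> (\<forall>i. bump_algebra c (pdx i f))"
  using assms
proof induction
  case (const a)
  have "pdx i (\<lambda>_. a) = (\<lambda>_. 0)" for i :: 'a by (auto simp: pdx_eqI[OF has_derivative_const])
  then show ?case by (auto intro: bump_algebra.const)
next
  case (coord j)
  have "pdx i (\<lambda>x :: real ^ 'a. x $ j) = (\<lambda>_. if i = j then 1 else 0)" for i by (auto simp: pdx_coord)
  then show ?case by (auto intro: bump_algebra.const coord_differentiable)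
next
  case gauss
  have "pdx i (\<lambda>x :: real ^ 'a. exp ((- 1 / 2) * (norm x)\<^sup>2)) = (\<lambda>x. (-1) * (x $ i) * exp ((- 1 / 2) * (norm x)\<^sup>2))" for i
    unfolding pdx_gauss by simp
  then show ?case by (simp only:) (intro allI conjI gauss_differentiable bump_algebra.intros)
next
  case (flat_exp k)
  \<comment> \<open>The derivative is written with sums and products only, the operations that
    generate the algebra.\<close>
  have "pdx i (\<lambda>x :: real ^ 'a. flat_exp k (1 - c * (norm x)\<^sup>2)) =
    (\<lambda>x. (flat_exp (k + 2) (1 - c * (norm x)\<^sup>2) + (- real k) * flat_exp (k + 1) (1 - c * (norm x)\<^sup>2)) * ((- 2 * c) * x $ i))" for i
    unfolding pdx_flat_exp_radial by (simp add: algebra_simps)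
  moreover have "(\<lambda>x :: real ^ 'a. flat_exp k (1 - c * (norm x)\<^sup>2)) differentiable (at x)" for x
    using has_derivative_flat_exp_radial unfolding differentiable_def by blast
  ultimately show ?case by (simp only:) (intro allI conjI TrueI bump_algebra.intros)
next
  case (add f g)
  then have "pdx i (\<lambda>x. f x + g x) = (\<lambda>x. pdx i f x + pdx i g x)" for i by (auto simp: pdx_add)
  then show ?case using add by (auto intro: bump_algebra.intros)
next
  case (mult f g)
  then have eq: "pdx i (\<lambda>x. f x * g x) = (\<lambda>x. f x * pdx i g x + pdx i f x * g x)" for i by (auto simp: pdx_mult)
  have "bump_algebra c (pdx i (\<lambda>x. f x * g x))" for i
    unfolding eq using mult by (intro bump_algebra.add bump_algebra.mult) auto
  then show ?case using mult by auto
qed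

lemma bump_algebra_smooth:
  assumes "bump_algebra c f" shows "smooth_fun f"
proof -
  have "bump_algebra c (foldr pdx is f)" for "is"
    by (induction "is") (use assms bump_algebra_pdx in auto)
  then show ?thesis unfolding smooth_fun_def using bump_algebra_pdx by blast
qed

text \<open>Divided by the Gaussian with \<open>t = 1\<close> this is the linear function
  \<open>x $ j\<close>, which attains the one-dimensional Poincare constant when direction
  \<open>j\<close> is unweighted.\<close>

definition extremal :: "'n::finite \<Rightarrow> real ^ 'n \<Rightarrow> real" where
  "extremal j x = x $ j * exp ((- 1 / 2) * (norm x)\<^sup>2)"

text \<open>The cutoff is normalized to tend to \<open>1\<close> as \<open>c\<close> tends to \<open>0\<close>; no plateau is needed.\<close>

definition cutoff :: "real \<Rightarrow> real ^ 'n::finite \<Rightarrow> real" where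
  "cutoff c x = exp 1 * flat_exp 0 (1 - c * (norm x)\<^sup>2)"

lemma extremal_alg: "bump_algebra c (extremal j)"
  unfolding extremal_def by (intro bump_algebra.intros)

lemma cutoff_alg: "bump_algebra c (cutoff c)"
  unfolding cutoff_def by (intro bump_algebra.intros)

lemmas extremal_smooth = bump_algebra_smooth[OF extremal_alg]
lemmas cutoff_smooth = bump_algebra_smooth[OF cutoff_alg]

lemma pdx_extremal:
  "pdx i (extremal j) x = ((if i = j then 1 else 0) - x $ i * x $ j) * exp ((- 1 / 2) * (norm x)\<^sup>2)"
proof -
  have "pdx i (extremal j) x = x $ j * pdx i (\<lambda>x. exp ((- 1 / 2) * (norm x)\<^sup>2)) x + pdx i (\<lambda>x. x $ j) x * exp ((- 1 / 2) * (norm x)\<^sup>2)"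
    unfolding extremal_def by (rule pdx_mult[OF coord_differentiable gauss_differentiable])
  then show ?thesis unfolding pdx_gauss pdx_coord by (simp add: algebra_simps)
qed

lemma pdx_cutoff: "pdx i (cutoff c) x = - (exp 1 * flat_exp 2 (1 - c * (norm x)\<^sup>2) * 2 * c) * x $ i"
proof -
  have "(\<lambda>x :: real ^ 'a. flat_exp 0 (1 - c * (norm x)\<^sup>2)) differentiable (at x)"
    using has_derivative_flat_exp_radial unfolding differentiable_def by blast
  then have "pdx i (cutoff c) x = exp 1 * pdx i (\<lambda>x. flat_exp 0 (1 - c * (norm x)\<^sup>2)) x + pdx i (\<lambda>x. exp 1) x * flat_exp 0 (1 - c * (norm x)\<^sup>2)"
    unfolding cutoff_def by (intro pdx_mult) auto
  then show ?thesis unfolding pdx_flat_exp_radial pdx_eqI[OF has_derivative_const] by (simp add: numeral_2_eq_2)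
qed

lemma cutoff_bounds: "0 \<le> c \<Longrightarrow> 0 \<le> cutoff c x" "0 \<le> c \<Longrightarrow> cutoff c x \<le> 1"
  unfolding cutoff_def by (auto intro: flat_exp_0_le mult_nonneg_nonneg flat_exp_nonneg)

text \<open>The \<open>8\<close> combines the bound \<open>4\<close> on \<open>flat_exp 2\<close>
  with the factor \<open>2\<close> from differentiating the squared norm. Being of order
  \<open>c\<^sup>2\<close> times the squared norm, the gradient contributes a vanishing multiple of
  a second moment as \<open>c\<close> tends to \<open>0\<close>.\<close>

lemma norm_grad_cutoff:
  assumes "0 \<le> c" shows "(norm (grad (cutoff c) x))\<^sup>2 \<le> (8 * exp 1 * c)\<^sup>2 * (norm x)\<^sup>2"
proof -
  let ?a = "exp 1 * flat_exp 2 (1 - c * (norm x)\<^sup>2) * 2 * c"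
  have "(norm (grad (cutoff c) x))\<^sup>2 = ?a\<^sup>2 * (norm x)\<^sup>2"
    unfolding norm_grad_sq pdx_cutoff norm_sq_vec[of x] by (simp add: power_mult_distrib sum_distrib_left)
  moreover have "exp 1 * flat_exp 2 (1 - c * (norm x)\<^sup>2) * 2 * c \<le> exp 1 * 4 * 2 * c"
    using assms by (intro mult_right_mono mult_left_mono flat_exp_2_le) auto
  then have "?a\<^sup>2 \<le> (8 * exp 1 * c)\<^sup>2"
    using assms flat_exp_nonneg by (intro power_mono) (auto simp: mult_ac)
  ultimately show ?thesis by (simp add: mult_right_mono)
qed

lemma extremal_cutoff_Nstar:
  fixes \<alpha> :: "'n::finite \<Rightarrow> real"
  assumes j: "\<alpha> j = 0" and c: "0 < c"
  shows "(\<lambda>x. extremal j x * cutoff c x) \<in> Nstar \<alpha>"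
proof -
  have "smooth_fun (\<lambda>x. extremal j x * cutoff c x)"
    by (rule bump_algebra_smooth[of c]) (intro bump_algebra.mult extremal_alg cutoff_alg)
  moreover have "bounded {x. extremal j x * cutoff c x \<noteq> 0}"
  proof (rule bounded_subset[OF bounded_cball])
    show "{x. extremal j x * cutoff c x \<noteq> 0} \<subseteq> cball 0 (sqrt (1 / c))"
    proof
      fix x assume "x \<in> {x. extremal j x * cutoff c x \<noteq> 0}"
      then have "0 < 1 - c * (norm x)\<^sup>2" by (auto simp: cutoff_def flat_exp_def split: if_splits)
      then have "(norm x)\<^sup>2 \<le> 1 / c" using c by (simp add: field_simps)
      then show "x \<in> cball 0 (sqrt (1 / c))" by (simp add: real_le_rsqrt)
    qed
  qed
  moreover have "pdx i (\<lambda>x. extremal j x * cutoff c x) x = 0" if "0 < \<alpha> i" "x $ i = 0" for i x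
  proof -
    \<comment> \<open>On a face with \<open>0 < \<alpha> i\<close> this leaves only terms containing
      the factor \<open>x $ i = 0\<close> in the normal derivative.\<close>
    have "i \<noteq> j" using that j by auto
    have "pdx i (\<lambda>x. extremal j x * cutoff c x) x = extremal j x * pdx i (cutoff c) x + pdx i (extremal j) x * cutoff c x"
      by (intro pdx_mult smooth_fun_differentiable extremal_smooth cutoff_smooth)
    then show ?thesis using \<open>i \<noteq> j\<close> that by (simp add: pdx_cutoff pdx_extremal)
  qed
  ultimately show ?thesis by (simp add: Nstar_def)
qed

text \<open>To be read with \<open>r\<close> the squared norm: half of the exponent pays for the
  polynomial, using \<open>r\<^sup>2 \<le> 16 * exp (r / 2)\<close>, so
  \<open>17 = 1 + 16\<close>.\<close>

lemma poly_gauss_le: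
  fixes r :: real
  assumes "0 \<le> r" shows "(1 + r\<^sup>2) * exp (- r) \<le> 17 * exp (- (1 / 2) * r)"
proof -
  have "(r / 2)\<^sup>2 \<le> 4 * exp (r / 2)" using assms by (intro sq_le_exp) simp
  then have "r\<^sup>2 \<le> 16 * exp (r / 2)" by (simp add: power_divide)
  moreover have "1 \<le> exp (r / 2)" using assms by simp
  ultimately have "1 + r\<^sup>2 \<le> 17 * exp (r / 2)" by linarith
  then have "(1 + r\<^sup>2) * exp (- r) \<le> 17 * exp (r / 2) * exp (- r)" by (rule mult_right_mono) simp
  also have "\<dots> = 17 * exp (- (1 / 2) * r)" by (simp add: exp_add[symmetric])
  finally show ?thesis .
qed

lemma component_sq_le: "(x $ j)\<^sup>2 \<le> (norm x)\<^sup>2" for x :: "real ^ 'n::finite"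
  using component_le_norm_cart[of x j] by (simp add: power2_le_iff_abs_le)

lemma integrable_poly_gauss:
  fixes F :: "real ^ 'n::finite \<Rightarrow> real"
  assumes \<alpha>: "\<And>i. 0 \<le> \<alpha> i" and F: "F \<in> borel_measurable borel"
    and b: "\<And>x. \<bar>F x\<bar> \<le> C * ((1 + ((norm x)\<^sup>2)\<^sup>2) * exp (- (norm x)\<^sup>2))" and C: "0 \<le> C"
  shows "integrable (muA \<alpha>) F"
proof (rule integrable_gauss_bound[where \<kappa> = "1 / 2" and C = "C * 17", OF \<alpha> _ F])
  fix x :: "real ^ 'n"
  have "C * ((1 + ((norm x)\<^sup>2)\<^sup>2) * exp (- (norm x)\<^sup>2)) \<le> C * (17 * exp (- (1 / 2) * (norm x)\<^sup>2))"
    using C by (intro mult_left_mono poly_gauss_le) auto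
  with b[of x] show "\<bar>F x\<bar> \<le> C * 17 * exp (- (1 / 2) * (norm x)\<^sup>2)" by simp
qed simp

lemma extremal_sq: "(extremal j x)\<^sup>2 = (x $ j)\<^sup>2 * exp (- (norm x)\<^sup>2)"
  by (simp add: extremal_def power_mult_distrib exp_double[symmetric])

lemma le_one_plus_sq: "(y::real) \<le> 1 + y\<^sup>2"
  using zero_le_power2[of "y - 1/2"] by (simp add: power2_eq_square algebra_simps)

lemma norm_grad_extremal:
  "(norm (grad (extremal j) x))\<^sup>2 = (1 - 2 * (x $ j)\<^sup>2 + (x $ j)\<^sup>2 * (norm x)\<^sup>2) * exp (- (norm x)\<^sup>2)"
proof -
  let ?d = "\<lambda>i. if i = j then 1 else 0 :: real"
  have e: "(exp ((- 1 / 2) * (norm x)\<^sup>2))\<^sup>2 = exp (- (norm x)\<^sup>2)" by (simp add: exp_double[symmetric])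
  have "(\<Sum>i\<in>UNIV. (?d i - x $ i * x $ j)\<^sup>2) = (\<Sum>i\<in>UNIV. ?d i - 2 * (x $ j)\<^sup>2 * ?d i + (x $ j)\<^sup>2 * (x $ i)\<^sup>2)"
    by (intro sum.cong refl) (auto simp: power2_eq_square algebra_simps)
  also have "\<dots> = 1 - 2 * (x $ j)\<^sup>2 + (x $ j)\<^sup>2 * (norm x)\<^sup>2"
    by (simp add: sum.distrib sum_subtractf sum_distrib_left[symmetric] norm_sq_vec del: mult_eq_0_iff)
  finally show ?thesis
    unfolding norm_grad_sq pdx_extremal power_mult_distrib e by (simp add: sum_distrib_right[symmetric])
qed

lemma nn_integral_tendsto_0:
  assumes [measurable]: "\<And>n. F n \<in> borel_measurable M" "w \<in> borel_measurable M"
    and "integrable M w" and "\<And>n x. 0 \<le> F n x" "\<And>n x. F n x \<le> w x" and "\<And>x. (\<lambda>n. F n x) \<longlonglongrightarrow> (0::real)"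
  shows "(\<lambda>n::nat. \<integral>\<^sup>+x. ennreal (F n x) \<partial>M) \<longlonglongrightarrow> 0"
proof -
  have i: "integrable M (F n)" for n
  proof (rule Bochner_Integration.integrable_bound[OF assms(3)])
    have "\<bar>F n x\<bar> \<le> \<bar>w x\<bar>" for x using assms(4)[of n x] assms(5)[of n x] by linarith
    then show "AE x in M. norm (F n x) \<le> norm (w x)" by simp
  qed simp
  have "(\<lambda>n. \<integral>x. F n x \<partial>M) \<longlonglongrightarrow> (\<integral>x. 0 \<partial>M)"
    by (rule integral_dominated_convergence[where w = w]) (use assms in auto)
  then have "(\<lambda>n. ennreal (\<integral>x. F n x \<partial>M)) \<longlonglongrightarrow> ennreal 0" by (intro tendsto_ennrealI) simp
  then show ?thesis using i assms(4) by (simp add: nn_integral_eq_integral)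
qed

lemma extremal_measurable [measurable]: "extremal j \<in> borel_measurable borel"
  by (rule borel_measurable_continuous_onI) (rule smooth_fun_continuous[OF extremal_smooth])

section \<open>Moments, orthogonality and admissibility of the extremal function\<close>

context
  fixes \<alpha> :: "'n::finite \<Rightarrow> real" and j :: 'n
  assumes \<alpha>: "\<And>i. 0 \<le> \<alpha> i" and j: "\<alpha> j = 0"
begin

lemma extremal_integrable:
  "integrable (muA \<alpha>) (\<lambda>x. (extremal j x)\<^sup>2)"
  "integrable (muA \<alpha>) (\<lambda>x. (extremal j x)\<^sup>2 * (norm x)\<^sup>2)"
  "integrable (muA \<alpha>) (\<lambda>x. exp (- (norm x)\<^sup>2))"
  "integrable (muA \<alpha>) (\<lambda>x. (norm (grad (extremal j) x))\<^sup>2)"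
proof -
  have c: "(x $ j)\<^sup>2 \<le> 1 + ((norm x)\<^sup>2)\<^sup>2" for x :: "real ^ 'n"
    by (rule order_trans[OF component_sq_le le_one_plus_sq])
  have c2: "(x $ j)\<^sup>2 * (norm x)\<^sup>2 \<le> 1 + ((norm x)\<^sup>2)\<^sup>2" for x :: "real ^ 'n"
  proof -
    have "(x $ j)\<^sup>2 * (norm x)\<^sup>2 \<le> (norm x)\<^sup>2 * (norm x)\<^sup>2" by (intro mult_right_mono component_sq_le) simp
    then show ?thesis by (simp add: power2_eq_square)
  qed
  show i1: "integrable (muA \<alpha>) (\<lambda>x. (extremal j x)\<^sup>2)"
  proof (rule integrable_poly_gauss[OF \<alpha>, of _ 1])
    show "\<bar>(extremal j x)\<^sup>2\<bar> \<le> 1 * ((1 + ((norm x)\<^sup>2)\<^sup>2) * exp (- (norm x)\<^sup>2))" for x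
      using mult_right_mono[OF c[of x], of "exp (- (norm x)\<^sup>2)"] by (simp add: extremal_sq)
  qed simp_all
  show i2: "integrable (muA \<alpha>) (\<lambda>x. (extremal j x)\<^sup>2 * (norm x)\<^sup>2)"
  proof (rule integrable_poly_gauss[OF \<alpha>, of _ 1])
    show "\<bar>(extremal j x)\<^sup>2 * (norm x)\<^sup>2\<bar> \<le> 1 * ((1 + ((norm x)\<^sup>2)\<^sup>2) * exp (- (norm x)\<^sup>2))" for x
      using mult_right_mono[OF c2[of x], of "exp (- (norm x)\<^sup>2)"] by (simp add: extremal_sq mult_ac)
  qed simp_all
  show i3: "integrable (muA \<alpha>) (\<lambda>x. exp (- (norm x)\<^sup>2))"
    using integrable_gauss[OF \<alpha>, of 1] by simp
  have g: "(norm (grad (extremal j) x))\<^sup>2 = exp (- (norm x)\<^sup>2) - 2 * (extremal j x)\<^sup>2 + (extremal j x)\<^sup>2 * (norm x)\<^sup>2" for x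
    unfolding norm_grad_extremal extremal_sq by (simp add: algebra_simps)
  show "integrable (muA \<alpha>) (\<lambda>x. (norm (grad (extremal j) x))\<^sup>2)"
    unfolding g using i1 i2 i3 by simp
qed

text \<open>For \<open>h = (extremal j)\<^sup>2\<close> the sum of \<open>x $ i * pdx i h x\<close>
  over \<open>i\<close> is \<open>2 * h x\<close> minus twice the squared norm times
  \<open>h x\<close>; integration by parts evaluates its integral as \<open>- D\<close> times that
  of \<open>h\<close>.\<close>

lemma extremal_second_moment:
  "(\<integral>x. (extremal j x)\<^sup>2 * (norm x)\<^sup>2 \<partial>muA \<alpha>) = (dimA \<alpha> + 2) / 2 * (\<integral>x. (extremal j x)\<^sup>2 \<partial>muA \<alpha>)"
proof -
  let ?h = "\<lambda>x. (extremal j x)\<^sup>2"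
  have p: "pdx i ?h x = 2 * extremal j x * pdx i (extremal j) x" for i x
    unfolding power2_eq_square by (subst pdx_mult) (auto intro: smooth_fun_differentiable extremal_smooth)
  have xp: "x $ i * pdx i ?h x = 2 * (if i = j then 1 else 0) * ?h x - 2 * ((x $ i)\<^sup>2 * ?h x)" for i x
    unfolding p pdx_extremal by (auto simp: extremal_def power2_eq_square algebra_simps)
  have le1: "?h x \<le> (1 + ((norm x)\<^sup>2)\<^sup>2) * exp (- (norm x)\<^sup>2)" for x
    unfolding extremal_sq
    using mult_right_mono[OF order_trans[OF component_sq_le[of x j] le_one_plus_sq], of "exp (- (norm x)\<^sup>2)"] by simp
  have le2: "(x $ i)\<^sup>2 * ?h x \<le> (1 + ((norm x)\<^sup>2)\<^sup>2) * exp (- (norm x)\<^sup>2)" for x i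
  proof -
    have "(x $ i)\<^sup>2 * (x $ j)\<^sup>2 \<le> (norm x)\<^sup>2 * (norm x)\<^sup>2" by (intro mult_mono component_sq_le) auto
    also have "\<dots> \<le> 1 + ((norm x)\<^sup>2)\<^sup>2" by (simp add: power2_eq_square)
    finally show ?thesis
      unfolding extremal_sq using mult_right_mono[of "(x $ i)\<^sup>2 * (x $ j)\<^sup>2" _ "exp (- (norm x)\<^sup>2)"] by (simp add: mult.assoc)
  qed
  have G: "(1 + ((norm x)\<^sup>2)\<^sup>2) * exp (- (norm x)\<^sup>2) \<le> 17 * exp (- (1 / 2) * (norm x)\<^sup>2)" for x :: "real ^ 'n"
    by (rule poly_gauss_le) simp
  define E where "E = (\<lambda>x :: real ^ 'n. exp (- (1 / 2) * (norm x)\<^sup>2))"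
  have E: "0 \<le> E x" "?h x \<le> 17 * E x" "(x $ i)\<^sup>2 * ?h x \<le> 17 * E x" for x i
    using order_trans[OF le1 G, of x] order_trans[OF le2 G, of x i] by (simp_all add: E_def)
  \<comment> \<open>The constant \<open>68 = 4 * 17\<close> is dictated by \<open>b'\<close>, with
    two terms of at most \<open>2 * 17\<close> each; integration by parts expects the same constant
    in both bounds.\<close>
  have b: "\<bar>?h x\<bar> \<le> 68 * exp (- (1 / 2) * (norm x)\<^sup>2)" for x
    using E(1,2)[of x] unfolding abs_power2 E_def by linarith
  have b': "\<bar>x $ i * pdx i ?h x\<bar> \<le> 68 * exp (- (1 / 2) * (norm x)\<^sup>2)" for x i
  proof -
    have "\<bar>x $ i * pdx i ?h x\<bar> \<le> 2 * ?h x + 2 * ((x $ i)\<^sup>2 * ?h x)" unfolding xp by (auto simp: abs_if)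
    then show ?thesis using E(2)[of x] E(3)[of x i] unfolding E_def by linarith
  qed
  have d: "?h differentiable (at x)" for x
    by (intro derivative_intros smooth_fun_differentiable extremal_smooth)
  have c: "continuous_on UNIV (pdx i ?h)" for i
  proof -
    have "pdx i ?h = (\<lambda>x. 2 * extremal j x * pdx i (extremal j) x)" using p by blast
    then show ?thesis
      by (simp only:) (intro continuous_intros smooth_fun_continuous extremal_smooth smooth_fun_pdx)
  qed
  have ibp: "(\<integral>x. x $ i * pdx i ?h x \<partial>muA \<alpha>) = - (1 + \<alpha> i) * (\<integral>x. ?h x \<partial>muA \<alpha>)" for i
    by (rule integration_by_parts(3)[where \<kappa> = "1 / 2", OF \<alpha> _ d c b b']) simp
  have ii: "integrable (muA \<alpha>) (\<lambda>x. (x $ i)\<^sup>2 * ?h x)" for i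
    by (rule integrable_poly_gauss[OF \<alpha>, of _ 1]) (use le2 in auto)
  note I = extremal_integrable
  have "- dimA \<alpha> * (\<integral>x. ?h x \<partial>muA \<alpha>) = (\<Sum>i\<in>UNIV. \<integral>x. x $ i * pdx i ?h x \<partial>muA \<alpha>)"
    by (simp only: ibp mult_minus_left sum_negf sum_distrib_right[symmetric]) (simp add: dimA_def sum.distrib)
  also have "\<dots> = (\<Sum>i\<in>UNIV. 2 * (if i = j then 1 else 0) * (\<integral>x. ?h x \<partial>muA \<alpha>) - 2 * (\<integral>x. (x $ i)\<^sup>2 * ?h x \<partial>muA \<alpha>))"
    unfolding xp using I(1) ii by simp
  also have "\<dots> = 2 * (\<integral>x. ?h x \<partial>muA \<alpha>) - 2 * (\<Sum>i\<in>UNIV. \<integral>x. (x $ i)\<^sup>2 * ?h x \<partial>muA \<alpha>)"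
    unfolding sum_subtractf sum_distrib_left[symmetric] sum_distrib_right[symmetric] by simp
  also have "(\<Sum>i\<in>UNIV. \<integral>x. (x $ i)\<^sup>2 * ?h x \<partial>muA \<alpha>) = (\<integral>x. ?h x * (norm x)\<^sup>2 \<partial>muA \<alpha>)"
    unfolding norm_sq_vec sum_distrib_left using ii by (simp add: mult.commute)
  finally show ?thesis by (simp only: add_divide_distrib ring_distribs)
qed

text \<open>Integration by parts of the Gaussian in direction \<open>j\<close>, where the factor
  \<open>1 + \<alpha> j\<close> is \<open>1\<close>.\<close>

lemma extremal_gauss_moment:
  "(\<integral>x. exp (- (norm x)\<^sup>2) \<partial>muA \<alpha>) = 2 * (\<integral>x. (extremal j x)\<^sup>2 \<partial>muA \<alpha>)"
proof -
  let ?h = "\<lambda>x :: real ^ 'n. exp ((-1) * (norm x)\<^sup>2)"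
  have p: "pdx i ?h x = - 2 * x $ i * ?h x" for i x unfolding pdx_gauss by simp
  have xp: "x $ j * pdx j ?h x = - 2 * (extremal j x)\<^sup>2" for x
    unfolding p extremal_sq by (simp add: power2_eq_square)
  have G: "(1 + ((norm x)\<^sup>2)\<^sup>2) * exp (- (norm x)\<^sup>2) \<le> 17 * exp (- (1 / 2) * (norm x)\<^sup>2)" for x :: "real ^ 'n"
    by (rule poly_gauss_le) simp
  have "(\<integral>x. x $ j * pdx j ?h x \<partial>muA \<alpha>) = - (1 + \<alpha> j) * (\<integral>x. ?h x \<partial>muA \<alpha>)"
  proof (rule integration_by_parts(3)[where \<kappa> = "1 / 2" and C = 34, OF \<alpha>])
    show "continuous_on UNIV (pdx j ?h)" unfolding p[abs_def] by (intro continuous_intros)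
    show "\<bar>?h x\<bar> \<le> 34 * exp (- (1 / 2) * (norm x)\<^sup>2)" for x
    proof -
      have "?h x \<le> (1 + ((norm x)\<^sup>2)\<^sup>2) * exp (- (norm x)\<^sup>2)" by simp
      also note G
      also have "17 * exp (- (1 / 2) * (norm x)\<^sup>2) \<le> 34 * exp (- (1 / 2) * (norm x)\<^sup>2)" by simp
      finally show ?thesis by simp
    qed
    show "\<bar>x $ j * pdx j ?h x\<bar> \<le> 34 * exp (- (1 / 2) * (norm x)\<^sup>2)" for x
    proof -
      have "(extremal j x)\<^sup>2 \<le> (1 + ((norm x)\<^sup>2)\<^sup>2) * exp (- (norm x)\<^sup>2)"
        unfolding extremal_sq
        using mult_right_mono[OF order_trans[OF component_sq_le[of x j] le_one_plus_sq], of "exp (- (norm x)\<^sup>2)"] by simp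
      also note G
      finally show ?thesis unfolding xp by simp
    qed
    show "?h differentiable (at x)" for x by (rule gauss_differentiable)
  qed simp
  then show ?thesis unfolding xp by (simp add: j)
qed

text \<open>Pointwise the two integrands differ by
  \<open>exp (- (norm x)\<^sup>2) - 2 * (extremal j x)\<^sup>2\<close>, which integrates to zero.
  Equality of the two energies means that \<open>t = 1\<close> is the optimal scale.\<close>

lemma extremal_energy:
  "(\<integral>x. (norm (grad (extremal j) x))\<^sup>2 \<partial>muA \<alpha>) = (\<integral>x. (extremal j x)\<^sup>2 * (norm x)\<^sup>2 \<partial>muA \<alpha>)"
proof -
  have g: "(norm (grad (extremal j) x))\<^sup>2 = exp (- (norm x)\<^sup>2) - 2 * (extremal j x)\<^sup>2 + (extremal j x)\<^sup>2 * (norm x)\<^sup>2" for x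
    unfolding norm_grad_extremal extremal_sq by (simp add: algebra_simps)
  show ?thesis unfolding g using extremal_integrable extremal_gauss_moment by simp
qed

text \<open>Both roots are \<open>sqrt B\<close>, so their product is
  \<open>B = (D + 2) / 2 * N\<close>; subtracting \<open>D / 2 * N\<close> leaves
  \<open>N\<close>.\<close>

lemma extremal_deltaA:
  "deltaA \<alpha> (extremal j) (grad (extremal j)) = (\<integral>x. (extremal j x)\<^sup>2 \<partial>muA \<alpha>)"
proof -
  define N where "N = (\<integral>x. (extremal j x)\<^sup>2 \<partial>muA \<alpha>)"
  define B where "B = (\<integral>x. (extremal j x)\<^sup>2 * (norm x)\<^sup>2 \<partial>muA \<alpha>)"
  have "sqrt B * sqrt B = B" by (simp add: B_def)
  moreover have "B = (dimA \<alpha> + 2) / 2 * N" unfolding B_def N_def by (rule extremal_second_moment)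
  ultimately show ?thesis
    unfolding deltaA_eq[OF extremal_measurable grad_measurable[OF extremal_smooth]] extremal_energy
      N_def[symmetric] B_def[symmetric]
    by (simp add: field_simps)
qed

text \<open>The integrand is odd in \<open>x $ j\<close>, and since \<open>\<alpha> j = 0\<close>
  the \<open>j\<close>-th factor of the measure is Lebesgue measure on the whole line, invariant
  under reflection.\<close>

lemma extremal_orthogonal:
  assumes t: "0 < t"
  shows "integrable (muA \<alpha>) (\<lambda>x. extremal j x * exp (- (norm x)\<^sup>2 / t))"
    and "(\<integral>x. extremal j x * exp (- (norm x)\<^sup>2 / t) \<partial>muA \<alpha>) = 0"
proof -
  let ?H = "\<lambda>x. extremal j x * exp (- (norm x)\<^sup>2 / t)"
  show iH: "integrable (muA \<alpha>) ?H"
  proof (rule Bochner_Integration.integrable_bound)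
    show "integrable (muA \<alpha>) (\<lambda>x. (extremal j x)\<^sup>2 + exp (- (2 / t) * (norm x)\<^sup>2))"
      using t by (intro Bochner_Integration.integrable_add extremal_integrable integrable_gauss \<alpha>) auto
    show "AE x in muA \<alpha>. norm (?H x) \<le> norm ((extremal j x)\<^sup>2 + exp (- (2 / t) * (norm x)\<^sup>2))"
    proof (intro AE_I2)
      fix x
      define a where "a = extremal j x"
      define b where "b = exp (- (norm x)\<^sup>2 / t)"
      have "b\<^sup>2 = exp (- (2 / t) * (norm x)\<^sup>2)" by (simp add: b_def exp_double[symmetric])
      moreover have "\<bar>a * b\<bar> \<le> a\<^sup>2 + b\<^sup>2"
        using zero_le_power2[of "\<bar>a\<bar> - \<bar>b\<bar>"] mult_nonneg_nonneg[OF abs_ge_zero[of a] abs_ge_zero[of b]]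
        unfolding power2_diff power2_abs abs_mult by linarith
      ultimately show "norm (?H x) \<le> norm ((extremal j x)\<^sup>2 + exp (- (2 / t) * (norm x)\<^sup>2))"
        by (simp add: a_def b_def)
    qed
  qed measurable
  show "(\<integral>x. ?H x \<partial>muA \<alpha>) = 0"
  proof (rule integral_muA_fiber_zero[OF iH, of j])
    fix y :: "'n \<Rightarrow> real"
    let ?f = "\<lambda>s. ?H (vec_lambda (y(j := s)))"
    have one: "density lborel (\<lambda>s. ennreal (power_weight (\<alpha> j) s)) = lborel"
      by (simp add: j power_weight_def power_factor_def half_line_def density_1)
    have n: "(norm (vec_lambda (y(j := - s)) :: real ^ 'n))\<^sup>2 = (norm (vec_lambda (y(j := s)) :: real ^ 'n))\<^sup>2" for s
      unfolding norm_sq_vec by (intro sum.cong) auto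
    have odd: "?f (- s) = - ?f s" for s
      unfolding extremal_def n by simp
    have "(\<integral>s. ?f s \<partial>lborel) = (\<integral>s. ?f (- s) \<partial>lborel)"
      using lborel_integral_real_affine[of "-1" ?f 0] by simp
    also have "\<dots> = - (\<integral>s. ?f s \<partial>lborel)" unfolding odd by simp
    finally show "(\<integral>s. ?f s \<partial>density lborel (\<lambda>s. ennreal (power_weight (\<alpha> j) s))) = 0" unfolding one by simp
  qed
qed

text \<open>Pythagoras: by orthogonality, subtracting \<open>c\<close> times a Gaussian increases
  the square norm by \<open>c\<^sup>2\<close> times that of the Gaussian. The reverse inequality
  comes from stability.\<close>

lemma extremal_dA_ge: "(\<integral>x. (extremal j x)\<^sup>2 \<partial>muA \<alpha>) \<le> (dA \<alpha> (extremal j))\<^sup>2"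
proof -
  let ?N = "\<integral>x. (extremal j x)\<^sup>2 \<partial>muA \<alpha>"
  have le: "?N \<le> (\<integral>x. (extremal j x - c * exp (- (norm x)\<^sup>2 / t))\<^sup>2 \<partial>muA \<alpha>)" if t: "0 < t" for c t
  proof -
    define g where "g = (\<lambda>x :: real ^ 'n. exp (- (norm x)\<^sup>2 / t))"
    have g2: "(g x)\<^sup>2 = exp (- (2 / t) * (norm x)\<^sup>2)" for x by (simp add: g_def exp_double[symmetric])
    have ig: "integrable (muA \<alpha>) (\<lambda>x. (g x)\<^sup>2)" unfolding g2 using t by (intro integrable_gauss \<alpha>) simp
    have o': "integrable (muA \<alpha>) (\<lambda>x. extremal j x * g x)" "(\<integral>x. extremal j x * g x \<partial>muA \<alpha>) = 0"
      using extremal_orthogonal[OF t] by (simp_all add: g_def)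
    have "(\<integral>x. (extremal j x - c * g x)\<^sup>2 \<partial>muA \<alpha>) = (\<integral>x. (extremal j x)\<^sup>2 - 2 * c * (extremal j x * g x) + c\<^sup>2 * (g x)\<^sup>2 \<partial>muA \<alpha>)"
      by (intro Bochner_Integration.integral_cong refl) (simp add: power2_eq_square algebra_simps)
    also have "\<dots> = ?N + c\<^sup>2 * (\<integral>x. (g x)\<^sup>2 \<partial>muA \<alpha>)" using extremal_integrable(1) ig o' by simp
    finally show ?thesis by (simp add: g_def)
  qed
  have "sqrt ?N \<le> dA \<alpha> (extremal j)"
    unfolding dA_eq[OF extremal_measurable]
  proof (rule cINF_greatest)
    show "{(c, l). (l::real) \<noteq> 0} \<noteq> ({} :: (real \<times> real) set)" by (auto intro!: exI[of _ 1])
    fix p :: "real \<times> real" assume "p \<in> {(c, l). l \<noteq> 0}"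
    then have "0 < 2 * (snd p)\<^sup>2" by (auto simp: split_beta)
    then show "sqrt ?N \<le> sqrt (\<integral>x. (extremal j x - fst p * exp (- (norm x)\<^sup>2 / (2 * (snd p)\<^sup>2)))\<^sup>2 \<partial>muA \<alpha>)"
      by (intro real_sqrt_le_mono le)
  qed
  then have "(sqrt ?N)\<^sup>2 \<le> (dA \<alpha> (extremal j))\<^sup>2" by (intro power_mono) auto
  then show ?thesis by simp
qed

text \<open>Truncations by \<open>cutoff (c n)\<close> with
  \<open>c n \<longlonglongrightarrow> 0\<close> approximate the function. The product rule splits
  the gradient error into a cutoff gradient times \<open>u\<close> and \<open>1 - cutoff\<close>
  times the gradient of \<open>u\<close>; dominated convergence handles both.\<close>

lemma extremal_SA: "SA \<alpha> (extremal j) (grad (extremal j))"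
proof -
  let ?u = "extremal j"
  define c where "c = (\<lambda>n. 1 / real (Suc n))"
  have c: "0 < c n" "c n \<le> 1" for n by (auto simp: c_def)
  have c0: "c \<longlonglongrightarrow> 0" unfolding c_def by real_asymp
  define \<phi> where "\<phi> = (\<lambda>n x. ?u x * cutoff (c n) x)"
  have \<phi>: "\<phi> n \<in> Nstar \<alpha>" for n unfolding \<phi>_def by (rule extremal_cutoff_Nstar[where \<alpha> = \<alpha>, OF j c(1)])
  have gm [measurable]: "grad ?u \<in> borel_measurable borel" by (rule grad_measurable[OF extremal_smooth])
  have [measurable]: "grad (\<phi> n) \<in> borel_measurable borel" "\<phi> n \<in> borel_measurable borel"
    "cutoff (c n) \<in> borel_measurable (borel :: (real ^ 'n) measure)" for n
    using \<phi>[of n] cutoff_smooth[of "c n"]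
    by (auto simp: Nstar_def intro: grad_measurable borel_measurable_continuous_onI smooth_fun_continuous)
  have cl: "(\<lambda>n. cutoff (c n) x) \<longlonglongrightarrow> 1" for x :: "real ^ 'n"
  proof -
    have "isCont (flat_exp 0) 1" by (rule DERIV_isCont[OF flat_exp_deriv])
    moreover have "(\<lambda>n. 1 - c n * (norm x)\<^sup>2) \<longlonglongrightarrow> 1 - 0 * (norm x)\<^sup>2"
      by (intro tendsto_intros c0)
    ultimately have "(\<lambda>n. flat_exp 0 (1 - c n * (norm x)\<^sup>2)) \<longlonglongrightarrow> flat_exp 0 1"
      by (intro isCont_tendsto_compose[of 1 "flat_exp 0"]) auto
    from tendsto_mult_left[OF this, of "exp 1"] show ?thesis
      by (simp add: cutoff_def flat_exp_def exp_add[symmetric])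
  qed
  have cb: "(1 - cutoff (c n) x)\<^sup>2 \<le> 1" for n and x :: "real ^ 'n"
    using cutoff_bounds[of "c n" x] c(1)[of n] by (auto intro!: power_le_one)
  note int = extremal_integrable
  have 1: "(\<lambda>n. \<integral>\<^sup>+x. ennreal ((\<phi> n x - ?u x)\<^sup>2 * (norm x)\<^sup>2) \<partial>muA \<alpha>) \<longlonglongrightarrow> 0"
  proof (rule nn_integral_tendsto_0[OF _ _ int(2)])
    have eq: "(\<phi> n x - ?u x)\<^sup>2 = (1 - cutoff (c n) x)\<^sup>2 * (?u x)\<^sup>2" for n x
      unfolding \<phi>_def power_mult_distrib[symmetric] by (subst power2_commute) (simp add: algebra_simps)
    show "(\<phi> n x - ?u x)\<^sup>2 * (norm x)\<^sup>2 \<le> (?u x)\<^sup>2 * (norm x)\<^sup>2" for n x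
      unfolding eq using mult_right_mono[OF cb[of n x], of "(?u x)\<^sup>2"] by (intro mult_right_mono) auto
    have "(\<lambda>n. (1 - cutoff (c n) x)\<^sup>2 * (?u x)\<^sup>2 * (norm x)\<^sup>2) \<longlonglongrightarrow> (1 - 1)\<^sup>2 * (?u x)\<^sup>2 * (norm x)\<^sup>2" for x
      by (intro tendsto_intros cl)
    then show "(\<lambda>n. (\<phi> n x - ?u x)\<^sup>2 * (norm x)\<^sup>2) \<longlonglongrightarrow> 0" for x unfolding eq by simp
  qed simp_all
  define K where "K = (8 * exp 1 :: real)\<^sup>2"
  define F where "F = (\<lambda>n x. 2 * (K * (c n)\<^sup>2 * ((?u x)\<^sup>2 * (norm x)\<^sup>2)) + 2 * ((1 - cutoff (c n) x)\<^sup>2 * (norm (grad ?u x))\<^sup>2))"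
  have 2: "(\<lambda>n. \<integral>\<^sup>+x. ennreal (F n x) \<partial>muA \<alpha>) \<longlonglongrightarrow> 0"
  proof (rule nn_integral_tendsto_0)
    \<comment> \<open>The bounds \<open>c n \<le> 1\<close> and
      \<open>0 \<le> cutoff \<le> 1\<close> make the dominating function independent of
      \<open>n\<close>.\<close>
    let ?w = "\<lambda>x. 2 * (K * 1 * ((?u x)\<^sup>2 * (norm x)\<^sup>2)) + 2 * (1 * (norm (grad ?u x))\<^sup>2)"
    show "integrable (muA \<alpha>) ?w" using int by simp
    have "(c n)\<^sup>2 \<le> 1" for n using c[of n] by (intro power_le_one) auto
    then show "F n x \<le> ?w x" for n x
      unfolding F_def using cb[of n x]
      by (intro add_mono mult_left_mono mult_right_mono) (auto simp: K_def)
    show "0 \<le> F n x" for n x by (simp add: F_def K_def)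
    have "(\<lambda>n. F n x) \<longlonglongrightarrow> 2 * (K * 0\<^sup>2 * ((?u x)\<^sup>2 * (norm x)\<^sup>2)) + 2 * ((1 - 1)\<^sup>2 * (norm (grad ?u x))\<^sup>2)" for x
      unfolding F_def by (intro tendsto_intros cl c0)
    then show "(\<lambda>n. F n x) \<longlonglongrightarrow> 0" for x by simp
  qed (simp_all add: F_def)
  have le: "(norm (grad (\<phi> n) x - grad ?u x))\<^sup>2 \<le> F n x" for n x
  proof -
    have "grad (\<phi> n) x - grad ?u x = ?u x *\<^sub>R grad (cutoff (c n)) x + (cutoff (c n) x - 1) *\<^sub>R grad ?u x"
      unfolding \<phi>_def
      by (simp add: vec_eq_iff grad_def pdx_mult smooth_fun_differentiable extremal_smooth cutoff_smooth algebra_simps)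
    then have "(norm (grad (\<phi> n) x - grad ?u x))\<^sup>2 \<le> 2 * ((?u x)\<^sup>2 * (norm (grad (cutoff (c n)) x))\<^sup>2) + 2 * ((cutoff (c n) x - 1)\<^sup>2 * (norm (grad ?u x))\<^sup>2)"
      using norm_sq_add_le[of 1 "?u x *\<^sub>R grad (cutoff (c n)) x" "(cutoff (c n) x - 1) *\<^sub>R grad ?u x"]
      by (simp add: power_mult_distrib)
    also have "(?u x)\<^sup>2 * (norm (grad (cutoff (c n)) x))\<^sup>2 \<le> (?u x)\<^sup>2 * ((8 * exp 1 * c n)\<^sup>2 * (norm x)\<^sup>2)"
      using c(1)[of n] by (intro mult_left_mono norm_grad_cutoff) auto
    finally show ?thesis by (simp add: F_def K_def power_mult_distrib power2_commute mult_ac)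
  qed
  have 3: "(\<lambda>n. \<integral>\<^sup>+x. ennreal ((norm (grad (\<phi> n) x - grad ?u x))\<^sup>2) \<partial>muA \<alpha>) \<longlonglongrightarrow> 0"
    by (rule tendsto_sandwich[OF _ _ tendsto_const 2]) (auto intro!: always_eventually nn_integral_mono ennreal_leI le)
  show ?thesis
    unfolding SA_def
  proof (intro conjI exI[of _ \<phi>] allI \<phi>)
    show "(\<lambda>n. \<integral>\<^sup>+x\<in>RNstar \<alpha>. ennreal ((\<phi> n x - ?u x)\<^sup>2 * (norm x)\<^sup>2 * wA \<alpha> x) \<partial>lborel) \<longlonglongrightarrow> 0"
      using 1 by (subst nn_integral_muA) auto
    show "(\<lambda>n. \<integral>\<^sup>+x\<in>RNstar \<alpha>. ennreal ((norm (grad (\<phi> n) x - grad ?u x))\<^sup>2 * wA \<alpha> x) \<partial>lborel) \<longlonglongrightarrow> 0"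
      using 3 by (subst nn_integral_muA) auto
  qed auto
qed

text \<open>Reflection in \<open>x $ j\<close> preserves the domain because
  \<open>\<alpha> j = 0\<close>, fixes every radial Gaussian and changes the sign of the extremal
  function.\<close>

lemma extremal_not_EHUPA: "\<not> in_EHUPA \<alpha> (extremal j)"
proof
  assume "in_EHUPA \<alpha> (extremal j)"
  then obtain a b where ae: "AE x in lborel. x \<in> RNstar \<alpha> \<longrightarrow> extremal j x = a * exp (- b * (norm x)\<^sup>2)"
    by (auto simp: in_EHUPA_def)
  define d where "d = (\<lambda>x. extremal j x - a * exp (- b * (norm x)\<^sup>2))"
  have cd: "continuous_on UNIV d"
    unfolding d_def by (intro continuous_intros smooth_fun_continuous extremal_smooth)
  \<comment> \<open>An open null set is empty, so continuity upgrades the almost everywhere identity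
    to every point of the open domain.\<close>
  define S where "S = RNstar \<alpha> \<inter> {x. d x \<noteq> 0}"
  have "open (RNstar \<alpha>)"
  proof -
    have "RNstar \<alpha> = (\<Inter>i\<in>{i. 0 < \<alpha> i}. {x. 0 < x $ i})" by (auto simp: RNstar_def)
    also have "open \<dots>" by (intro open_INT) (auto intro!: open_Collect_less continuous_intros)
    finally show ?thesis .
  qed
  then have "open S" unfolding S_def
    by (intro open_Int open_Collect_neq cd continuous_on_const)
  have "AE x in lborel. x \<notin> S" using ae by eventually_elim (auto simp: S_def d_def)
  then have "S \<in> null_sets lborel"
    using \<open>open S\<close> by (subst (asm) AE_iff_null_sets[symmetric]) auto
  then have "negligible S" by (simp add: negligible_iff_null_sets null_sets_completionI)
  then have "S = {}" using open_not_negligible[OF \<open>open S\<close>] by blast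
  then have z: "extremal j x = a * exp (- b * (norm x)\<^sup>2)" if "x \<in> RNstar \<alpha>" for x
    using that by (auto simp: S_def d_def)
  define p where "p = (\<lambda>s :: real. (\<chi> i. if i = j then s else 1) :: real ^ 'n)"
  have pR: "p s \<in> RNstar \<alpha>" for s using j by (auto simp: p_def RNstar_def)
  have n: "(norm (p (- 1)))\<^sup>2 = (norm (p 1))\<^sup>2" unfolding norm_sq_vec p_def by (intro sum.cong) auto
  have "extremal j (p (- 1)) = extremal j (p 1)" unfolding z[OF pR] n ..
  moreover have "extremal j (p (- 1)) = - extremal j (p 1)" unfolding extremal_def n by (simp add: p_def)
  ultimately have "extremal j (p 1) = 0" by simp
  then show False by (simp add: extremal_def p_def)
qed

end

theorem theorem1p10:
  fixes \<alpha> :: "'n::finite \<Rightarrow> real"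
  assumes "\<forall>i. 0 \<le> \<alpha> i"
  shows "(\<forall>u G. SA \<alpha> u G \<longrightarrow> deltaA \<alpha> u G \<ge> (dA \<alpha> u)\<^sup>2) \<and>
         ((\<exists>i. \<alpha> i = 0) \<longrightarrow>
            (\<exists>u G. SA \<alpha> u G \<and> \<not> trivial_fun \<alpha> u \<and> \<not> in_EHUPA \<alpha> u \<and>
                   deltaA \<alpha> u G = (dA \<alpha> u)\<^sup>2))"
proof (intro conjI allI impI)
  have \<alpha>: "0 \<le> \<alpha> i" for i using assms by blast
  show "(dA \<alpha> u)\<^sup>2 \<le> deltaA \<alpha> u G" if "SA \<alpha> u G" for u G
    by (rule stability[OF \<alpha> that])
  assume "\<exists>i. \<alpha> i = 0"
  then obtain j where j: "\<alpha> j = 0" by blast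
  note sa = extremal_SA[where \<alpha> = \<alpha>, OF \<alpha> j] and ne = extremal_not_EHUPA[where \<alpha> = \<alpha>, OF \<alpha> j]
  have "\<not> trivial_fun \<alpha> (extremal j)"
  proof
    assume "trivial_fun \<alpha> (extremal j)"
    then have "in_EHUPA \<alpha> (extremal j)"
      \<comment> \<open>The zero function is the Gaussian with coefficient \<open>0\<close>, so
        nontriviality follows from not lying in the Gaussian family.\<close>
      unfolding trivial_fun_def in_EHUPA_def by (intro exI[of _ 0] exI[of _ 1]) simp
    with ne show False by contradiction
  qed
  \<comment> \<open>The square norm closes the circle: it equals the deficit and is at most the
    squared distance, which stability bounds by the deficit.\<close>
  moreover have "deltaA \<alpha> (extremal j) (grad (extremal j)) = (dA \<alpha> (extremal j))\<^sup>2"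
    using stability[OF \<alpha> sa] extremal_dA_ge[where \<alpha> = \<alpha>, OF \<alpha> j] extremal_deltaA[where \<alpha> = \<alpha>, OF \<alpha> j] by linarith
  ultimately show "\<exists>u G. SA \<alpha> u G \<and> \<not> trivial_fun \<alpha> u \<and> \<not> in_EHUPA \<alpha> u \<and> deltaA \<alpha> u G = (dA \<alpha> u)\<^sup>2"
    using sa ne by blast
qed

end
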